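(* There is no compact locally conformal parallel ${\rm Spin}(7)$-structure $(M,g,\Phi)$ which is second order nearly parallel, i.e. which satisfies $\nabla^{{\rm Spin}(7)}r=0$, where $r(X,Y)=\sum_i g(\xi_Xe_i,\xi_Ye_i)$, $\xi$ is the intrinsic torsion and $\nabla^{{\rm Spin}(7)}$ is the minimal ${\rm Spin}(7)$-connection.
   Context: A ${\rm Spin}(7)$-structure on an $8$-dimensional Riemannian manifold $(M,g)$ is a global $4$-form $\Phi$ such that around each point there is a local orthonormal frame $e_0,\dots,e_7$ with dual coframe $e^0,\dots,e^7$ in which (writing $e^{ijkl}=e^i\wedge e^j\wedge e^k\wedge e^l$) $$\Phi=e^{0123}-e^{0145}-e^{0167}-e^{0246}+e^{0257}-e^{0347}-e^{0356}+e^{4567}-e^{2367}-e^{2345}-e^{1357}+e^{1346}-e^{1256}-e^{1247}.$$ It is called compact if $M$ is compact. $M$ is oriented by $e^{01234567}$, $\star$ is the Hodge star, $\star\Phi=\Phi$, and $\delta\Phi=-\star d\star\Phi$ is the codifferential. ${\rm Spin}(7)\subset SO(8)$ is the stabilizer of $\Phi$. Pointwise, $\Lambda^2=\Lambda^2_7\oplus\Lambda^2_{21}$ with $\Lambda^2_7=\{\omega:\star(\Phi\wedge\omega)=3\omega\}$ and $\Lambda^2_{21}=\{\omega:\star(\Phi\wedge\omega)=-\omega\}$. Skew endomorphisms $A$ of $TM$ are identified with $2$-forms via $(Y,Z)\mapsto g(AY,Z)$; with this identification $\mathfrak{so}(8)=\mathfrak{spin}(7)\oplus\mathfrak{spin}(7)^{\perp}$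 corresponds to $\Lambda^2=\Lambda^2_{21}\oplus\Lambda^2_7$. Lee form: $\theta=\frac{1}{7}\star(\delta\Phi\wedge\Phi)$. The structure is locally conformal parallel (type $\mathcal{W}_8$) if $d\Phi=\theta\wedge\Phi$; equivalently, its intrinsic torsion is $\xi_X=\frac14(X^\flat\wedge\theta)_7$, where the subscript $7$ denotes the $\Lambda^2_7$-component. Let $\nabla$ be the Levi-Civita connection. The minimal ${\rm Spin}(7)$-connection $\nabla^{{\rm Spin}(7)}$ is the connection given by the $\mathfrak{spin}(7)$-component of the Levi-Civita connection form; the intrinsic torsion is the $(1,2)$-tensor $\xi=\nabla^{{\rm Spin}(7)}-\nabla$. Equivalently, $\nabla^{{\rm Spin}(7)}=\nabla+\xi$ is the unique metric connection with $\nabla^{{\rm Spin}(7)}\Phi=0$ and $\xi_X\in\Lambda^2_7$ for all $X$. In the definition of the symmetric $2$-tensor $r$, $(e_i)$ is any local orthonormal frame.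
   Formalization: The structure is additionally required to be non-parallel, i.e. its Lee form is not identically zero; without this the claim fails, since a flat 8-torus with constant Φ is compact with θ=0, ξ=0, r=0. *)

theory Defs
  imports "HOL-Analysis.Analysis"
begin

section \<open>Smooth functions on open sets\<close>

primrec Ck_on :: "nat \<Rightarrow> 'a::euclidean_space set \<Rightarrow> ('a \<Rightarrow> 'b::real_normed_vector) \<Rightarrow> bool" where
  "Ck_on 0 S f \<longleftrightarrow> continuous_on S f"
| "Ck_on (Suc k) S f \<longleftrightarrow>
     (\<forall>x\<in>S. f differentiable (at x)) \<and> (\<forall>v. Ck_on k S (\<lambda>x. frechet_derivative f (at x) v))"

text \<open>Only used for open sets.\<close>
definition smooth_on :: "'a::euclidean_space set \<Rightarrow> ('a \<Rightarrow> 'b::real_normed_vector) \<Rightarrow> bool" where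
  "smooth_on S f \<longleftrightarrow> (\<forall>k. Ck_on k S f)"


section \<open>Smooth 8-manifolds\<close>

text \<open>The manifold is the whole type \<open>'m\<close>, with its type class topology. A chart is a pair of its
  domain and its coordinate map (whose values outside the domain are irrelevant).\<close>

type_synonym E = "real^8"
type_synonym 'm chart = "'m set \<times> ('m \<Rightarrow> E)"

abbreviation chart_image :: "'m chart \<Rightarrow> E set" where
  "chart_image c \<equiv> snd c ` fst c"

definition transition :: "'m chart \<Rightarrow> 'm chart \<Rightarrow> E \<Rightarrow> E" where
  "transition c c' = snd c' \<circ> inv_into (fst c) (snd c)"

definition transition_domain :: "'m chart \<Rightarrow> 'm chart \<Rightarrow> E set" where
  "transition_domain c c' = snd c ` (fst c \<inter> fst c')"

definition smooth_atlas :: "'m::{t2_space, second_countable_topology} chart set \<Rightarrow> bool" where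
  "smooth_atlas A \<longleftrightarrow>
     (\<Union>c\<in>A. fst c) = UNIV \<and>
     (\<forall>c\<in>A. open (fst c) \<and> open (chart_image c) \<and>
        homeomorphism (fst c) (chart_image c) (snd c) (inv_into (fst c) (snd c))) \<and>
     (\<forall>c\<in>A. \<forall>c'\<in>A. smooth_on (transition_domain c c') (transition c c'))"


section \<open>Exterior algebra of one tangent space\<close>

text \<open>A \<open>k\<close>-form at a point is a function of a sequence of tangent vectors that uses only the first
  \<open>k\<close> entries, and is multilinear and alternating in them.\<close>

type_synonym form = "(nat \<Rightarrow> E) \<Rightarrow> real"

definition select :: "(nat \<Rightarrow> 'a) \<Rightarrow> nat set \<Rightarrow> nat \<Rightarrow> 'a" where
  "select v I = (\<lambda>a. v (sorted_list_of_set I ! a))"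

text \<open>The sign of the permutation listing \<open>I\<close> in increasing order, then \<open>J\<close> in increasing order.\<close>
definition shuffle_sign :: "nat set \<Rightarrow> nat set \<Rightarrow> real" where
  "shuffle_sign I J = (-1) ^ card {(i, j) \<in> I \<times> J. j < i}"

text \<open>The wedge product of a \<open>k\<close>-form and an \<open>l\<close>-form as a sum over \<open>(k, l)\<close>-shuffles, i.e. normalized
  such that \<open>(\<alpha> \<and> \<beta>) (u, v) = \<alpha> u * \<beta> v - \<alpha> v * \<beta> u\<close> for 1-forms.\<close>
definition wedge :: "nat \<Rightarrow> nat \<Rightarrow> form \<Rightarrow> form \<Rightarrow> form" where
  "wedge k l \<alpha> \<beta> = (\<lambda>v. \<Sum>I | I \<subseteq> {..<k+l} \<and> card I = k.
     shuffle_sign I ({..<k+l} - I) * \<alpha> (select v I) * \<beta> (select v ({..<k+l} - I)))"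

text \<open>For \<open>I = [i, j, \<dots>]\<close>, the wedge product \<open>\<epsilon> i \<and> \<epsilon> j \<and> \<dots>\<close> of 1-forms, written as a determinant.\<close>
definition coframe_wedge :: "(nat \<Rightarrow> E \<Rightarrow> real) \<Rightarrow> nat list \<Rightarrow> form" where
  "coframe_wedge \<epsilon> I = (\<lambda>v. \<Sum>\<sigma> | \<sigma> permutes {..<length I}.
     of_int (sign \<sigma>) * (\<Prod>a<length I. \<epsilon> (I ! a) (v (\<sigma> a))))"

text \<open>Frames are sequences of which only the entries \<open>0, \<dots>, 7\<close> matter.\<close>

definition orthonormal_basis :: "(E \<Rightarrow> E \<Rightarrow> real) \<Rightarrow> (nat \<Rightarrow> E) \<Rightarrow> bool" where
  "orthonormal_basis g e \<longleftrightarrow> (\<forall>i<8. \<forall>j<8. g (e i) (e j) = (if i = j then 1 else 0))"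

text \<open>The dual coframe of an orthonormal frame.\<close>
definition coframe :: "(E \<Rightarrow> E \<Rightarrow> real) \<Rightarrow> (nat \<Rightarrow> E) \<Rightarrow> nat \<Rightarrow> E \<Rightarrow> real" where
  "coframe g e i = g (e i)"

definition model_form :: "(nat \<Rightarrow> E \<Rightarrow> real) \<Rightarrow> form" where
  "model_form \<epsilon> = (\<lambda>v.
       coframe_wedge \<epsilon> [0,1,2,3] v - coframe_wedge \<epsilon> [0,1,4,5] v - coframe_wedge \<epsilon> [0,1,6,7] v
     - coframe_wedge \<epsilon> [0,2,4,6] v + coframe_wedge \<epsilon> [0,2,5,7] v - coframe_wedge \<epsilon> [0,3,4,7] v
     - coframe_wedge \<epsilon> [0,3,5,6] v + coframe_wedge \<epsilon> [4,5,6,7] v - coframe_wedge \<epsilon> [2,3,6,7] v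
     - coframe_wedge \<epsilon> [2,3,4,5] v - coframe_wedge \<epsilon> [1,3,5,7] v + coframe_wedge \<epsilon> [1,3,4,6] v
     - coframe_wedge \<epsilon> [1,2,5,6] v - coframe_wedge \<epsilon> [1,2,4,7] v)"

definition adapted_basis :: "(E \<Rightarrow> E \<Rightarrow> real) \<Rightarrow> form \<Rightarrow> (nat \<Rightarrow> E) \<Rightarrow> bool" where
  "adapted_basis g \<phi> e \<longleftrightarrow> orthonormal_basis g e \<and> \<phi> = model_form (coframe g e)"

text \<open>The Hodge star of a \<open>k\<close>-form for the metric \<open>g\<close> and the orientation \<open>e\<^sup>0\<^sup>1\<^sup>2\<^sup>3\<^sup>4\<^sup>5\<^sup>6\<^sup>7\<close>:
  the linear map sending each \<open>e\<^sup>I\<close> to \<open>shuffle_sign I (- I)\<close> times \<open>e\<close> with the complementary indices.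
  Any two adapted bases differ by an element of \<open>Spin(7) \<subseteq> SO(8)\<close>, so the choice of \<open>e\<close> is irrelevant.\<close>
definition hodge_star :: "(E \<Rightarrow> E \<Rightarrow> real) \<Rightarrow> form \<Rightarrow> nat \<Rightarrow> form \<Rightarrow> form" where
  "hodge_star g \<phi> k \<beta> = (let e = (SOME e. adapted_basis g \<phi> e) in
     (\<lambda>v. \<Sum>I | I \<subseteq> {..<8} \<and> card I = k. shuffle_sign I ({..<8} - I) * \<beta> (select e I) *
        coframe_wedge (coframe g e) (sorted_list_of_set ({..<8} - I)) v))"

definition Lambda2_7 :: "(E \<Rightarrow> E \<Rightarrow> real) \<Rightarrow> form \<Rightarrow> form set" where
  "Lambda2_7 g \<phi> = {\<omega>. hodge_star g \<phi> 6 (wedge 4 2 \<phi> \<omega>) = (\<lambda>v. 3 * \<omega> v)}"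

definition Lambda2_21 :: "(E \<Rightarrow> E \<Rightarrow> real) \<Rightarrow> form \<Rightarrow> form set" where
  "Lambda2_21 g \<phi> = {\<omega>. hodge_star g \<phi> 6 (wedge 4 2 \<phi> \<omega>) = (\<lambda>v. - \<omega> v)}"

definition two_form :: "(E \<Rightarrow> E \<Rightarrow> real) \<Rightarrow> (E \<Rightarrow> E) \<Rightarrow> form" where
  "two_form g B = (\<lambda>v. g (B (v 0)) (v 1))"


section \<open>Calculus in a chart\<close>

type_synonym loc_metric = "E \<Rightarrow> E \<Rightarrow> E \<Rightarrow> real"
type_synonym loc_form = "E \<Rightarrow> form"

text \<open>An affine connection is given by its coefficients, \<open>\<Gamma> x u v\<close> being the value at \<open>x\<close> of the
  covariant derivative in direction \<open>u\<close> of the vector field that is constantly \<open>v\<close> in the chart.\<close>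
type_synonym loc_connection = "E \<Rightarrow> E \<Rightarrow> E \<Rightarrow> E"

definition ext_deriv :: "nat \<Rightarrow> loc_form \<Rightarrow> loc_form" where
  "ext_deriv k \<omega> x = (\<lambda>v. \<Sum>i\<le>k. (-1) ^ i *
     frechet_derivative (\<lambda>y. \<omega> y (\<lambda>j. if j < i then v j else v (Suc j))) (at x) (v i))"

definition codiff :: "loc_metric \<Rightarrow> loc_form \<Rightarrow> loc_form" where
  "codiff g \<Phi> x = (\<lambda>v. - hodge_star (g x) (\<Phi> x) 5
     (ext_deriv 4 (\<lambda>y. hodge_star (g y) (\<Phi> y) 4 (\<Phi> y)) x) v)"

definition lee_form :: "loc_metric \<Rightarrow> loc_form \<Rightarrow> loc_form" where
  "lee_form g \<Phi> x = (\<lambda>v. 1/7 * hodge_star (g x) (\<Phi> x) 7 (wedge 3 4 (codiff g \<Phi> x) (\<Phi> x)) v)"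

definition covariant_deriv :: "loc_connection \<Rightarrow> (E \<Rightarrow> E) \<Rightarrow> E \<Rightarrow> E \<Rightarrow> E" where
  "covariant_deriv \<Gamma> Y x u = frechet_derivative Y (at x) u + \<Gamma> x u (Y x)"

definition covariant_deriv_tensor2 ::
    "loc_connection \<Rightarrow> (E \<Rightarrow> E \<Rightarrow> E \<Rightarrow> real) \<Rightarrow> E \<Rightarrow> E \<Rightarrow> E \<Rightarrow> E \<Rightarrow> real" where
  "covariant_deriv_tensor2 \<Gamma> r x u v w =
     frechet_derivative (\<lambda>y. r y v w) (at x) u - r x (\<Gamma> x u v) w - r x v (\<Gamma> x u w)"

text \<open>The torsion-free metric connection.\<close>
definition levi_civita_on :: "E set \<Rightarrow> loc_metric \<Rightarrow> loc_connection \<Rightarrow> bool" where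
  "levi_civita_on S g \<Gamma> \<longleftrightarrow> (\<forall>x\<in>S. bilinear (\<Gamma> x) \<and> (\<forall>u v. \<Gamma> x u v = \<Gamma> x v u) \<and>
     (\<forall>u v w. covariant_deriv_tensor2 \<Gamma> g x u v w = 0))"

definition adapted_frame_on ::
    "E set \<Rightarrow> loc_metric \<Rightarrow> loc_form \<Rightarrow> (E \<Rightarrow> nat \<Rightarrow> E) \<Rightarrow> bool" where
  "adapted_frame_on V g \<Phi> e \<longleftrightarrow>
     (\<forall>i<8. smooth_on V (\<lambda>y. e y i)) \<and> (\<forall>y\<in>V. adapted_basis (g y) (\<Phi> y) (e y))"

text \<open>The connection form in the orthonormal frame \<open>e\<close>, evaluated on the tangent vector \<open>u\<close> at \<open>x\<close>,
  as the endomorphism sending \<open>e\<^sub>j\<close> to its covariant derivative in direction \<open>u\<close>.\<close>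
definition connection_form ::
    "loc_metric \<Rightarrow> loc_connection \<Rightarrow> (E \<Rightarrow> nat \<Rightarrow> E) \<Rightarrow> E \<Rightarrow> E \<Rightarrow> E \<Rightarrow> E" where
  "connection_form g \<Gamma> e x u v =
     (\<Sum>j<8. coframe (g x) (e x) j v *\<^sub>R covariant_deriv \<Gamma> (\<lambda>y. e y j) x u)"

text \<open>In adapted frames, the connection form of \<open>D\<close> is the \<open>spin(7)\<close>-component of that of \<open>\<Gamma>\<close>, where
  \<open>spin(7)\<close> is \<open>\<Lambda>\<^sup>2\<^sub>2\<^sub>1\<close> and its orthogonal complement in \<open>so(8)\<close> is \<open>\<Lambda>\<^sup>2\<^sub>7\<close>.\<close>
definition spin7_component_on ::
    "E set \<Rightarrow> loc_metric \<Rightarrow> loc_form \<Rightarrow> loc_connection \<Rightarrow> loc_connection \<Rightarrow> bool" where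
  "spin7_component_on S g \<Phi> \<Gamma> D \<longleftrightarrow> (\<forall>x\<in>S. bilinear (D x)) \<and>
     (\<forall>V e. open V \<and> V \<subseteq> S \<and> adapted_frame_on V g \<Phi> e \<longrightarrow> (\<forall>x\<in>V. \<forall>u.
        two_form (g x) (connection_form g D e x u) \<in> Lambda2_21 (g x) (\<Phi> x) \<and>
        two_form (g x) (\<lambda>v. connection_form g \<Gamma> e x u v - connection_form g D e x u v)
          \<in> Lambda2_7 (g x) (\<Phi> x)))"

text \<open>The tensor \<open>r\<close> of a (1,2)-tensor \<open>\<xi>\<close>. The sum is the same for all orthonormal bases.\<close>
definition r_tensor :: "loc_metric \<Rightarrow> (E \<Rightarrow> E \<Rightarrow> E \<Rightarrow> E) \<Rightarrow> E \<Rightarrow> E \<Rightarrow> E \<Rightarrow> real" where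
  "r_tensor g \<xi> x v w = (let e = (SOME e. orthonormal_basis (g x) e) in
     \<Sum>i<8. g x (\<xi> x v (e i)) (\<xi> x w (e i)))"


section \<open>Spin(7)-structures\<close>

text \<open>Covariant tensor fields on the manifold are families of coordinate representations, one for each
  chart, that agree under pullback by the transition maps.\<close>

definition riemannian_metric ::
    "'m::{t2_space, second_countable_topology} chart set \<Rightarrow> ('m chart \<Rightarrow> loc_metric) \<Rightarrow> bool" where
  "riemannian_metric A g \<longleftrightarrow>
     (\<forall>c\<in>A. (\<forall>u v. smooth_on (chart_image c) (\<lambda>x. g c x u v)) \<and>
        (\<forall>x\<in>chart_image c. bilinear (g c x) \<and> (\<forall>u v. g c x u v = g c x v u) \<and>
           (\<forall>u. u \<noteq> 0 \<longrightarrow> g c x u u > 0))) \<and>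
     (\<forall>c\<in>A. \<forall>c'\<in>A. \<forall>x\<in>transition_domain c c'. \<forall>u v.
        let T = frechet_derivative (transition c c') (at x)
        in g c x u v = g c' (transition c c' x) (T u) (T v))"

definition spin7_structure ::
    "'m::{t2_space, second_countable_topology} chart set \<Rightarrow> ('m chart \<Rightarrow> loc_metric) \<Rightarrow>
       ('m chart \<Rightarrow> loc_form) \<Rightarrow> bool" where
  "spin7_structure A g \<Phi> \<longleftrightarrow> smooth_atlas A \<and> riemannian_metric A g \<and>
     (\<forall>c\<in>A. \<forall>c'\<in>A. \<forall>x\<in>transition_domain c c'. \<forall>v.
        \<Phi> c x v = \<Phi> c' (transition c c' x) (frechet_derivative (transition c c') (at x) \<circ> v)) \<and>
     (\<forall>c\<in>A. \<forall>x\<in>chart_image c. \<exists>V e. open V \<and> x \<in> V \<and> V \<subseteq> chart_image c \<and>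
        adapted_frame_on V (g c) (\<Phi> c) e)"

definition locally_conformal_parallel ::
    "'m chart set \<Rightarrow> ('m chart \<Rightarrow> loc_metric) \<Rightarrow> ('m chart \<Rightarrow> loc_form) \<Rightarrow> bool" where
  "locally_conformal_parallel A g \<Phi> \<longleftrightarrow> (\<forall>c\<in>A. \<forall>x\<in>chart_image c.
     ext_deriv 4 (\<Phi> c) x = wedge 1 4 (lee_form (g c) (\<Phi> c) x) (\<Phi> c x))"

text \<open>For a locally conformal parallel structure this is the degenerate case in which \<open>\<Phi>\<close> is parallel
  (as on a flat torus), i.e. in which the intrinsic torsion is zero.\<close>
definition lee_form_vanishes ::
    "'m chart set \<Rightarrow> ('m chart \<Rightarrow> loc_metric) \<Rightarrow> ('m chart \<Rightarrow> loc_form) \<Rightarrow> bool" where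
  "lee_form_vanishes A g \<Phi> \<longleftrightarrow> (\<forall>c\<in>A. \<forall>x\<in>chart_image c. lee_form (g c) (\<Phi> c) x = (\<lambda>v. 0))"

text \<open>\<open>LC\<close> (Levi-Civita) and \<open>D\<close> (minimal Spin(7)-connection) exist and are uniquely determined on the
  images of the charts by the first two conditions; \<open>D - LC\<close> is the intrinsic torsion.\<close>
definition second_order_nearly_parallel ::
    "'m chart set \<Rightarrow> ('m chart \<Rightarrow> loc_metric) \<Rightarrow> ('m chart \<Rightarrow> loc_form) \<Rightarrow> bool" where
  "second_order_nearly_parallel A g \<Phi> \<longleftrightarrow> (\<exists>LC D. \<forall>c\<in>A.
     levi_civita_on (chart_image c) (g c) (LC c) \<and>
     spin7_component_on (chart_image c) (g c) (\<Phi> c) (LC c) (D c) \<and>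
     (\<forall>x\<in>chart_image c. \<forall>u v w.
        covariant_deriv_tensor2 (D c) (r_tensor (g c) (\<lambda>x u v. D c x u v - LC c x u v)) x u v w = 0))"

end

theory Submission
  imports Defs
begin

text \<open>Let \<open>\<theta>\<close> be the Lee form, \<open>X\<close> its dual vector field and \<open>\<xi>\<close> the intrinsic torsion. Pointwise, the
  equation \<open>d\<Phi> = \<theta> \<and> \<Phi>\<close> determines \<open>\<xi>\<close>, as all \<open>\<xi>\<^sub>u\<close> are in \<open>\<Lambda>\<^sup>2\<^sub>7\<close>; one finds
  \<open>r = (|\<theta>|\<^sup>2 g - \<theta> \<otimes> \<theta>) / 32\<close>, and that the trace of \<open>u \<mapsto> \<xi>\<^sub>u X\<close> is \<open>- 7/16 |\<theta>|\<^sup>2\<close>. As the minimal connection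
  \<open>D = \<nabla> + \<xi>\<close> is metric, \<open>D r = 0\<close> makes \<open>|\<theta>|\<^sup>2\<close> locally constant and \<open>|\<theta>|\<^sup>2 D X\<close> zero. Hence the divergence
  of \<open>|\<theta>|\<^sup>2 X\<close>, which is \<open>|\<theta>|\<^sup>2\<close> times the trace of \<open>\<nabla> X = D X - \<xi> X\<close>, equals \<open>7/16 |\<theta>|\<^sup>4\<close>. The integral
  of a divergence over a compact manifold is zero, so \<open>\<theta> = 0\<close>. It is computed in charts, with a partition of
  unity \<open>\<rho>\<^sub>i\<close>: in the sum over \<open>i\<close> of the integrals of \<open>\<rho>\<^sub>i\<close> times the divergence, the remaining terms
  \<open>|\<theta>|\<^sup>2 X \<rho>\<^sub>i\<close> cancel because the sum of the \<open>\<rho>\<^sub>i\<close> is constant.\<close>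

section \<open>Algebra of the model form\<close>

text \<open>The Lee form is defined through the Hodge star, and thus through bases chosen point by
  point without any continuity. Its smoothness and its behaviour under transition maps are therefore
  taken from d\<Phi>, which is smooth and natural, together with the injectivity of \<theta>
  \<mapsto> \<theta> \<and> \<Phi>; the codifferential itself is never evaluated. The constants have
  one source. The torsion is \<open>\<xi>\<^sub>u = 1/4 (u \<and> \<theta>)\<^sub>7\<close>, and the
  projection to \<open>\<Lambda>\<^sup>2\<^sub>7\<close> adds \<omega> and the star of \<Phi> \<and>
  \<omega> and divides by 4, so in an adapted basis the components of \<xi> with an index 0 are, up
  to sign, components of \<theta> divided by 16. A two-form in
  \<open>\<Lambda>\<^sup>2\<^sub>7\<close> repeats each of its seven parameters in eight matrix
  entries, whence 8/256 = 1/32 in r; the trace has seven equal terms, whence 7/16. The factor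
  \<open>|\<theta>|\<^sup>2\<close> in the vector field allows zeros of \<theta> to be treated like
  all other points.\<close>

definition minor :: "nat list \<Rightarrow> (nat \<Rightarrow> nat \<Rightarrow> real) \<Rightarrow> real" where
  "minor I M = (\<Sum>\<sigma> | \<sigma> permutes {..<length I}.
     of_int (sign \<sigma>) * (\<Prod>a<length I. M (I ! a) (\<sigma> a)))"

definition model_poly :: "(nat \<Rightarrow> nat \<Rightarrow> real) \<Rightarrow> real" where
  "model_poly M =
       minor [0,1,2,3] M - minor [0,1,4,5] M - minor [0,1,6,7] M
     - minor [0,2,4,6] M + minor [0,2,5,7] M - minor [0,3,4,7] M
     - minor [0,3,5,6] M + minor [4,5,6,7] M - minor [2,3,6,7] M
     - minor [2,3,4,5] M - minor [1,3,5,7] M + minor [1,3,4,6] M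
     - minor [1,2,5,6] M - minor [1,2,4,7] M"

lemma coframe_wedge_minor: "coframe_wedge \<epsilon> I v = minor I (\<lambda>i m. \<epsilon> i (v m))"
  by (simp add: coframe_wedge_def minor_def)

lemma model_form_poly: "model_form \<epsilon> v = model_poly (\<lambda>i m. \<epsilon> i (v m))"
  by (simp add: model_form_def model_poly_def coframe_wedge_minor)

lemma minor_1: "minor [p] M = M p 0"
proof -
  have 0: "{..<length [p]} = {0}" by auto
  show ?thesis
    unfolding minor_def 0 by (simp add: sign_id)
qed

lemma minor_2: "minor [p,q] M = M p 0 * M q 1 - M p 1 * M q 0"
proof -
  have 0: "{..<length [p,q]} = {0,1}" by auto
  have f: "finite {1::nat}" "(0::nat) \<notin> {1}" by auto
  show ?thesis
    unfolding minor_def 0 sum_over_permutations_insert[OF f] permutes_sing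
    by (simp add: sign_swap_id permutation_swap_id sign_compose sign_id swap_id_eq)
qed

text \<open>Laplace expansion. The 24 permutations are enumerated by adding one element at a time: a
  permutation of an enlarged set is a transposition composed with a permutation of the smaller
  set.\<close>

lemma minor_4: "minor [p,q,r,s] M =
   M p 0 * (M q 1 * (M r 2 * M s 3 - M r 3 * M s 2) - M r 1 * (M q 2 * M s 3 - M q 3 * M s 2)
     + M s 1 * (M q 2 * M r 3 - M q 3 * M r 2))
 - M q 0 * (M p 1 * (M r 2 * M s 3 - M r 3 * M s 2) - M r 1 * (M p 2 * M s 3 - M p 3 * M s 2)
     + M s 1 * (M p 2 * M r 3 - M p 3 * M r 2))
 + M r 0 * (M p 1 * (M q 2 * M s 3 - M q 3 * M s 2) - M q 1 * (M p 2 * M s 3 - M p 3 * M s 2)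
     + M s 1 * (M p 2 * M q 3 - M p 3 * M q 2))
 - M s 0 * (M p 1 * (M q 2 * M r 3 - M q 3 * M r 2) - M q 1 * (M p 2 * M r 3 - M p 3 * M r 2)
     + M r 1 * (M p 2 * M q 3 - M p 3 * M q 2))"
proof -
  have 0: "{..<length [p,q,r,s]} = {0,1,2,3}" by auto
  have f: "finite {1::nat,2,3}" "(0::nat) \<notin> {1,2,3}"
    "finite {2::nat,3}" "(1::nat) \<notin> {2,3}" "finite {3::nat}" "(2::nat) \<notin> {3}" by auto
  show ?thesis
    unfolding minor_def 0
    unfolding sum_over_permutations_insert[OF f(1,2)]
    unfolding sum_over_permutations_insert[OF f(3,4)]
    unfolding sum_over_permutations_insert[OF f(5,6)]
    unfolding permutes_sing
    by (simp add: sign_swap_id permutation_swap_id permutation_compose sign_compose sign_id swap_id_eq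
      numeral_2_eq_2 numeral_3_eq_3 algebra_simps)
qed

text \<open>The model form as a polynomial in the components of four vectors. It no longer mentions
  metric or frame, so it can be evaluated and differentiated once for all points.\<close>

definition Q :: "(nat \<Rightarrow> real) \<Rightarrow> (nat \<Rightarrow> real) \<Rightarrow> (nat \<Rightarrow> real) \<Rightarrow> (nat \<Rightarrow> real) \<Rightarrow> real" where
  "Q a b c d = model_poly (\<lambda>i m. ([a, b, c, d] ! m) i)"

definition kron :: "nat \<Rightarrow> nat \<Rightarrow> real" where
  "kron k i = of_bool (i = k)"

lemma minor_4_swap:
  "minor [p,q,r,s] (\<lambda>i m. ([b, a, c, d] ! m) i) = - minor [p,q,r,s] (\<lambda>i m. ([a, b, c, d] ! m) i)"
  "minor [p,q,r,s] (\<lambda>i m. ([a, c, b, d] ! m) i) = - minor [p,q,r,s] (\<lambda>i m. ([a, b, c, d] ! m) i)"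
  "minor [p,q,r,s] (\<lambda>i m. ([a, b, d, c] ! m) i) = - minor [p,q,r,s] (\<lambda>i m. ([a, b, c, d] ! m) i)"
  by (simp_all add: minor_4 algebra_simps)

lemma Q_swap:
  "Q b a c d = - Q a b c d" "Q a c b d = - Q a b c d" "Q a b d c = - Q a b c d"
  unfolding Q_def model_poly_def
  by (simp_all add: minor_4_swap[where a=a and b=b and c=c and d=d] del: nth_Cons_Suc nth_Cons_0)

lemma minor_4_add:
  "minor [p,q,r,s] (\<lambda>i m. ([\<lambda>i. a i + a' i, b, c, d] ! m) i) =
   minor [p,q,r,s] (\<lambda>i m. ([a, b, c, d] ! m) i) + minor [p,q,r,s] (\<lambda>i m. ([a', b, c, d] ! m) i)"
  by (simp add: minor_4 algebra_simps)

lemma Q_add: "Q (\<lambda>i. a i + a' i) b c d = Q a b c d + Q a' b c d"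
  by (simp add: Q_def model_poly_def minor_4_add del: nth_Cons_Suc nth_Cons_0)

lemma minor_4_kron_eq_0:
  "k \<notin> {p,q,r,s} \<Longrightarrow> minor [p,q,r,s] (\<lambda>i m. ([a, kron k, c, d] ! m) i) = 0"
  "k \<notin> {p,q,r,s} \<Longrightarrow> minor [p,q,r,s] (\<lambda>i m. ([a, b, kron k, d] ! m) i) = 0"
  "k \<notin> {p,q,r,s} \<Longrightarrow> minor [p,q,r,s] (\<lambda>i m. ([a, b, c, kron k] ! m) i) = 0"
  by (simp_all add: minor_4 kron_def)

text \<open>Fourteen index quadruples occur in the model form, namely those with bitwise exclusive
  or 0. Three distinct indices lie in exactly one of them, so inserting three basis vectors leaves
  one coordinate of \<open>y\<close> up to sign.\<close>

lemma Q_table: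
  "Q y (kron 0) (kron 1) (kron 2) = - y 3"
  "Q y (kron 0) (kron 1) (kron 3) = y 2"
  "Q y (kron 0) (kron 1) (kron 4) = y 5"
  "Q y (kron 0) (kron 1) (kron 5) = - y 4"
  "Q y (kron 0) (kron 1) (kron 6) = y 7"
  "Q y (kron 0) (kron 1) (kron 7) = - y 6"
  "Q y (kron 0) (kron 2) (kron 3) = - y 1"
  "Q y (kron 0) (kron 2) (kron 4) = y 6"
  "Q y (kron 0) (kron 2) (kron 5) = - y 7"
  "Q y (kron 0) (kron 2) (kron 6) = - y 4"
  "Q y (kron 0) (kron 2) (kron 7) = y 5"
  "Q y (kron 0) (kron 3) (kron 4) = y 7"
  "Q y (kron 0) (kron 3) (kron 5) = y 6"
  "Q y (kron 0) (kron 3) (kron 6) = - y 5"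
  "Q y (kron 0) (kron 3) (kron 7) = - y 4"
  "Q y (kron 0) (kron 4) (kron 5) = y 1"
  "Q y (kron 0) (kron 4) (kron 6) = y 2"
  "Q y (kron 0) (kron 4) (kron 7) = y 3"
  "Q y (kron 0) (kron 5) (kron 6) = y 3"
  "Q y (kron 0) (kron 5) (kron 7) = - y 2"
  "Q y (kron 0) (kron 6) (kron 7) = y 1"
  "Q y (kron 1) (kron 2) (kron 3) = y 0"
  "Q y (kron 1) (kron 2) (kron 4) = y 7"
  "Q y (kron 1) (kron 2) (kron 5) = y 6"
  "Q y (kron 1) (kron 2) (kron 6) = - y 5"
  "Q y (kron 1) (kron 2) (kron 7) = - y 4"
  "Q y (kron 1) (kron 3) (kron 4) = - y 6"
  "Q y (kron 1) (kron 3) (kron 5) = y 7"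
  "Q y (kron 1) (kron 3) (kron 6) = y 4"
  "Q y (kron 1) (kron 3) (kron 7) = - y 5"
  "Q y (kron 1) (kron 4) (kron 5) = - y 0"
  "Q y (kron 1) (kron 4) (kron 6) = - y 3"
  "Q y (kron 1) (kron 4) (kron 7) = y 2"
  "Q y (kron 1) (kron 5) (kron 6) = y 2"
  "Q y (kron 1) (kron 5) (kron 7) = y 3"
  "Q y (kron 1) (kron 6) (kron 7) = - y 0"
  "Q y (kron 2) (kron 3) (kron 4) = y 5"
  "Q y (kron 2) (kron 3) (kron 5) = - y 4"
  "Q y (kron 2) (kron 3) (kron 6) = y 7"
  "Q y (kron 2) (kron 3) (kron 7) = - y 6"
  "Q y (kron 2) (kron 4) (kron 5) = y 3"
  "Q y (kron 2) (kron 4) (kron 6) = - y 0"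
  "Q y (kron 2) (kron 4) (kron 7) = - y 1"
  "Q y (kron 2) (kron 5) (kron 6) = - y 1"
  "Q y (kron 2) (kron 5) (kron 7) = y 0"
  "Q y (kron 2) (kron 6) (kron 7) = y 3"
  "Q y (kron 3) (kron 4) (kron 5) = - y 2"
  "Q y (kron 3) (kron 4) (kron 6) = y 1"
  "Q y (kron 3) (kron 4) (kron 7) = - y 0"
  "Q y (kron 3) (kron 5) (kron 6) = - y 0"
  "Q y (kron 3) (kron 5) (kron 7) = - y 1"
  "Q y (kron 3) (kron 6) (kron 7) = - y 2"
  "Q y (kron 4) (kron 5) (kron 6) = - y 7"
  "Q y (kron 4) (kron 5) (kron 7) = y 6"
  "Q y (kron 4) (kron 6) (kron 7) = - y 5"
  "Q y (kron 5) (kron 6) (kron 7) = y 4"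
  apply (simp_all add: Q_def)
  apply (simp_all only: model_poly_def)
  \<comment> \<open>A minor that misses one of the three basis indices has a zero column. Discarding
    these first leaves a single determinant to expand.\<close>
  apply (simp_all add: minor_4_kron_eq_0 del: nth_Cons_Suc nth_Cons_0)
  apply (simp_all add: minor_4 kron_def)
  done

text \<open>The simplifier writes the index 1 as \<open>Suc 0\<close>, and the table has to match
  that form.\<close>

lemmas Q_table_Suc = Q_table[unfolded One_nat_def]

section \<open>Shuffle sums and wedge products as explicit sums\<close>

text \<open>Pascal's rule: split by whether \<open>x\<close> belongs to \<open>I\<close>. Repeated
  rewriting unrolls the shuffle sum in \<open>wedge\<close> into explicit terms.\<close>

lemma sum_subsets_insert:
  assumes "finite A" "x \<notin> A"
  shows "(\<Sum>I | I \<subseteq> insert x A \<and> card I = Suc k. f I) =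
    (\<Sum>I | I \<subseteq> A \<and> card I = Suc k. f I) + (\<Sum>I | I \<subseteq> A \<and> card I = k. f (insert x I))"
proof -
  have fin: "finite {I. I \<subseteq> A \<and> card I = m}" for m
    using assms(1) by simp
  have eq: "{I. I \<subseteq> insert x A \<and> card I = Suc k} =
      {I. I \<subseteq> A \<and> card I = Suc k} \<union> insert x ` {I. I \<subseteq> A \<and> card I = k}" (is "?L = ?R")
  proof (intro equalityI subsetI)
    fix I assume I: "I \<in> ?L"
    then have sub: "I \<subseteq> insert x A" and card: "card I = Suc k" by auto
    have fI: "finite I" using card by (simp add: card_ge_0_finite)
    show "I \<in> ?R"
    proof (cases "x \<in> I")
      case True
      then have "I = insert x (I - {x})" "I - {x} \<subseteq> A" "card (I - {x}) = k"
        using sub card fI by auto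
      then show ?thesis by blast
    next
      case False
      then show ?thesis using sub card by auto
    qed
  next
    fix I assume "I \<in> ?R"
    then show "I \<in> ?L"
    proof
      assume "I \<in> insert x ` {I. I \<subseteq> A \<and> card I = k}"
      then obtain J where J: "I = insert x J" "J \<subseteq> A" "card J = k" by blast
      then have "x \<notin> J" "finite J" using assms finite_subset by auto
      then show ?thesis using J by auto
    qed auto
  qed
  have inj: "inj_on (insert x) {I. I \<subseteq> A \<and> card I = k}"
    using assms(2) by (intro inj_onI) (metis (no_types, lifting) insert_ident mem_Collect_eq subsetD)
  have disj: "{I. I \<subseteq> A \<and> card I = Suc k} \<inter> insert x ` {I. I \<subseteq> A \<and> card I = k} = {}"
    using assms(2) by blast
  show ?thesis
    unfolding eq by (simp only: sum.union_disjoint[OF fin finite_imageI[OF fin] disj] sum.reindex[OF inj] o_def)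
qed

lemma sum_subsets_0:
  assumes "finite A"
  shows "(\<Sum>I | I \<subseteq> A \<and> card I = 0. f I) = f {}"
proof -
  have "{I. I \<subseteq> A \<and> card I = 0} = {{}}"
    using assms finite_subset by fastforce
  then show ?thesis by simp
qed

lemma sum_subsets_empty: "(\<Sum>I | I \<subseteq> {} \<and> card I = Suc k. f I) = 0"
  by (rule sum.neutral) auto

text \<open>Counting inversions becomes a double product, which simplification evaluates on
  explicitly listed sets.\<close>

lemma shuffle_sign_prod:
  assumes "finite I" "finite J"
  shows "shuffle_sign I J = (\<Prod>i\<in>I. \<Prod>j\<in>J. if j < i then -1 else 1)"
proof -
  have "(\<Prod>i\<in>I. \<Prod>j\<in>J. if j < i then -1 else 1) = (\<Prod>p\<in>I \<times> J. if snd p < fst p then -1 else (1::real))"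
    by (simp add: prod.cartesian_product case_prod_unfold)
  also have "\<dots> = (-1) ^ card ((I \<times> J) \<inter> {p. snd p < fst p})"
    using assms by (subst prod.If_cases) auto
  also have "(I \<times> J) \<inter> {p. snd p < fst p} = {(i, j) \<in> I \<times> J. j < i}" by auto
  finally show ?thesis by (simp add: shuffle_sign_def)
qed


lemma sum_subsets_insert_numeral:
  assumes "finite A" "x \<notin> A"
  shows "(\<Sum>I | I \<subseteq> insert x A \<and> card I = numeral n. f I) =
    (\<Sum>I | I \<subseteq> A \<and> card I = numeral n. f I) + (\<Sum>I | I \<subseteq> A \<and> card I = pred_numeral n. f (insert x I))"
  using sum_subsets_insert[OF assms, of f "pred_numeral n"] by (simp only: numeral_eq_Suc)

lemma sum_subsets_empty_numeral: "(\<Sum>I | I \<subseteq> {} \<and> card I = numeral n. f I) = 0"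
  by (rule sum.neutral) auto

text \<open>The form that the end of the recursion takes once \<open>I \<subseteq> {}\<close> has
  been simplified to \<open>I = {}\<close>.\<close>

lemma sum_eq_empty_card:
  fixes f :: "'a set \<Rightarrow> 'b::comm_monoid_add"
  shows "(\<Sum>I | I = {} \<and> card I = Suc k. f I) = 0" "(\<Sum>I | I = {} \<and> card I = numeral n. f I) = 0"
  "(\<Sum>I | I = {} \<and> card I = 0. f I) = f {}"
proof -
  have "{I :: 'a set. I = {} \<and> card I = 0} = {{}}" by auto
  then show "(\<Sum>I | I = {} \<and> card I = 0. f I) = f {}" by simp
qed (rule sum.neutral; auto)+

lemmas sum_subsets_simps = sum_eq_empty_card sum_subsets_insert sum_subsets_insert_numeral
  sum_subsets_empty sum_subsets_empty_numeral sum_subsets_0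

lemma wedge_1_4: "wedge 1 4 \<alpha> \<beta> v =
    \<alpha> (select v {0}) * \<beta> (select v {1,2,3,4}) - \<alpha> (select v {1}) * \<beta> (select v {0,2,3,4})
  + \<alpha> (select v {2}) * \<beta> (select v {0,1,3,4}) - \<alpha> (select v {3}) * \<beta> (select v {0,1,2,4})
  + \<alpha> (select v {4}) * \<beta> (select v {0,1,2,3})"
proof -
  have 0: "{..<1+4} = {0,1,2,3,4::nat}" by auto
  show ?thesis
    unfolding wedge_def 0
    by (simp add: sum_subsets_simps shuffle_sign_prod insert_Diff_if)
qed

lemma wedge_4_2: "wedge 4 2 \<alpha> \<beta> v =
    \<alpha> (select v {0,1,2,3}) * \<beta> (select v {4,5}) - \<alpha> (select v {0,1,2,4}) * \<beta> (select v {3,5})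
  + \<alpha> (select v {0,1,2,5}) * \<beta> (select v {3,4}) + \<alpha> (select v {0,1,3,4}) * \<beta> (select v {2,5})
  - \<alpha> (select v {0,1,3,5}) * \<beta> (select v {2,4}) + \<alpha> (select v {0,1,4,5}) * \<beta> (select v {2,3})
  - \<alpha> (select v {0,2,3,4}) * \<beta> (select v {1,5}) + \<alpha> (select v {0,2,3,5}) * \<beta> (select v {1,4})
  - \<alpha> (select v {0,2,4,5}) * \<beta> (select v {1,3}) + \<alpha> (select v {0,3,4,5}) * \<beta> (select v {1,2})
  + \<alpha> (select v {1,2,3,4}) * \<beta> (select v {0,5}) - \<alpha> (select v {1,2,3,5}) * \<beta> (select v {0,4})
  + \<alpha> (select v {1,2,4,5}) * \<beta> (select v {0,3}) - \<alpha> (select v {1,3,4,5}) * \<beta> (select v {0,2})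
  + \<alpha> (select v {2,3,4,5}) * \<beta> (select v {0,1})"
proof -
  have 0: "{..<4+2} = {0,1,2,3,4,5::nat}" by auto
  show ?thesis
    unfolding wedge_def 0
    by (simp add: sum_subsets_simps shuffle_sign_prod insert_Diff_if)
qed

text \<open>The components are cut off at 8, so that those of a basis vector are exactly those of \<open>kron\<close>.\<close>
definition coords :: "(E \<Rightarrow> E \<Rightarrow> real) \<Rightarrow> (nat \<Rightarrow> E) \<Rightarrow> E \<Rightarrow> nat \<Rightarrow> real" where
  "coords g e v i = (if i < 8 then g (e i) v else 0)"

lemma model_poly_cong:
  assumes "\<And>i m. i < 8 \<Longrightarrow> m < 4 \<Longrightarrow> M i m = N i m"
  shows "model_poly M = model_poly N"
  unfolding model_poly_def minor_4 by (simp add: assms)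

lemma model_form_Q: "model_form (coframe g e) v =
    Q (coords g e (v 0)) (coords g e (v 1)) (coords g e (v 2)) (coords g e (v 3))"
  unfolding model_form_poly Q_def
proof (rule model_poly_cong)
  fix i m :: nat
  assume "i < 8" "m < 4"
  moreover from \<open>m < 4\<close> have "m = 0 \<or> m = 1 \<or> m = 2 \<or> m = 3" by linarith
  ultimately show "coframe g e i (v m) =
      ([coords g e (v 0), coords g e (v 1), coords g e (v 2), coords g e (v 3)] ! m) i"
    by (auto simp: coords_def coframe_def)
qed

lemma coords_basis:
  assumes "orthonormal_basis g e" "k < 8"
  shows "coords g e (e k) = kron k"
  using assms by (auto simp: coords_def kron_def orthonormal_basis_def fun_eq_iff)

text \<open>With increasing indices, the 2-form dual to \<open>p < q\<close> is 1 on
  \<open>e a, e b\<close> if \<open>p = a\<close> and \<open>q = b\<close>, and 0 otherwise. So one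
  summand of the star survives, the one whose index set is the complement of
  \<open>{a, b}\<close>.\<close>

lemma hodge_star_6_basis:
  assumes e: "e = (SOME e. adapted_basis g \<phi> e)" and on: "orthonormal_basis g e"
    and ab: "a < b" "b < 8"
  shows "hodge_star g \<phi> 6 \<beta> (\<lambda>n. [e a, e b] ! n) =
    shuffle_sign ({..<8} - {a, b}) {a, b} * \<beta> (select e ({..<8} - {a, b}))"
proof -
  let ?K = "{..<8} - {a, b}"
  have tm: "coframe_wedge (coframe g e) (sorted_list_of_set ({..<8} - I)) (\<lambda>n. [e a, e b] ! n) =
      of_bool (I = ?K)" if I: "I \<subseteq> {..<8}" "card I = 6" for I
  proof -
    have "card ({..<8} - I) = 2"
      using I by (simp add: card_Diff_subset finite_subset)
    then obtain p' q' where pq': "{..<8} - I = {p', q'}" "p' \<noteq> q'"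
      by (auto simp: card_2_iff)
    obtain p q where pq: "{..<8} - I = {p, q}" "p < q"
    proof (cases "p' < q'")
      case True then show ?thesis using pq' that by blast
    next
      case False
      then have "q' < p'" "{..<8} - I = {q', p'}" using pq' by auto
      then show ?thesis using that by blast
    qed
    have lt: "p < 8" "q < 8" using pq by auto
    have l: "sorted_list_of_set ({..<8} - I) = [p, q]"
      using pq by simp
    have "I = ?K \<longleftrightarrow> {..<8} - I = {..<8} - ?K" using I by auto
    also have "{..<8} - ?K = {a, b}" using ab by auto
    also have "{..<8} - I = {a, b} \<longleftrightarrow> {p, q} = {a, b}" by (simp only: pq(1))
    also have "\<dots> \<longleftrightarrow> p = a \<and> q = b"
      using pq(2) ab by (auto simp: doubleton_eq_iff)
    finally show ?thesis
      unfolding l coframe_wedge_minor minor_2 coframe_def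
      using on ab lt pq by (auto simp: orthonormal_basis_def)
  qed
  have K: "?K \<subseteq> {..<8} \<and> card ?K = 6"
    using ab by (subst card_Diff_subset) auto
  have "hodge_star g \<phi> 6 \<beta> (\<lambda>n. [e a, e b] ! n) = (\<Sum>I | I \<subseteq> {..<8} \<and> card I = 6.
      if I = ?K then shuffle_sign I ({..<8} - I) * \<beta> (select e I) else 0)"
    unfolding hodge_star_def Let_def e[symmetric] by (intro sum.cong) (auto simp: tm)
  also have "\<dots> = shuffle_sign ?K ({..<8} - ?K) * \<beta> (select e ?K)"
    using K by (subst sum.delta) auto
  also have "{..<8} - ?K = {a, b}" using ab by auto
  finally show ?thesis .
qed

text \<open>The star of an arbitrary function is alternating. Hence the eigenvalue equations
  defining \<open>Lambda2_7\<close> and \<open>Lambda2_21\<close> by themselves force the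
  corresponding endomorphisms to be skew.\<close>

lemma hodge_star_6_swap:
  "hodge_star g \<phi> 6 \<beta> (\<lambda>n. [u, v] ! n) = - hodge_star g \<phi> 6 \<beta> (\<lambda>n. [v, u] ! n)"
proof -
  have "coframe_wedge \<epsilon> (sorted_list_of_set ({..<8} - I)) (\<lambda>n. [u, v] ! n) =
      - coframe_wedge \<epsilon> (sorted_list_of_set ({..<8} - I)) (\<lambda>n. [v, u] ! n)"
    if "I \<subseteq> {..<8}" "card I = 6" for I \<epsilon>
  proof -
    have "length (sorted_list_of_set ({..<8} - I)) = 2"
      using that by (simp add: card_Diff_subset finite_subset)
    then obtain p q where "sorted_list_of_set ({..<8} - I) = [p, q]"
      by (auto simp: numeral_2_eq_2 length_Suc_conv simp del: length_sorted_list_of_set)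
    then show ?thesis by (simp add: coframe_wedge_minor minor_2)
  qed
  then show ?thesis
    unfolding hodge_star_def Let_def sum_negf[symmetric]
    by (intro sum.cong) auto
qed

section \<open>Orthonormal bases, traces and basis-independent sums\<close>

text \<open>Pairing with \<open>e k\<close> reads off coefficients, so the eight vectors are
  independent and span by dimension.\<close>

lemma orthonormal_basis_expansion:
  assumes "bilinear g" "orthonormal_basis g e"
  shows "v = (\<Sum>i<8. g (e i) v *\<^sub>R e i)"
proof -
  have lin: "linear (g u)" for u using assms(1) by (simp add: bilinear_def)
  have gs: "g (e k) (\<Sum>i<8. c i *\<^sub>R e i) = c k" if "k < 8" for c k
  proof -
    have "g (e k) (\<Sum>i<8. c i *\<^sub>R e i) = (\<Sum>i<8. c i * g (e k) (e i))"
      by (simp add: linear_sum[OF lin] linear_cmul[OF lin])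
    also have "\<dots> = (\<Sum>i<8. if i = k then c i else 0)"
      using assms(2) that by (intro sum.cong) (auto simp: orthonormal_basis_def)
    finally show ?thesis using that by simp
  qed
  have inj: "inj_on e {..<8}"
  proof (rule inj_onI)
    fix i j assume "i \<in> {..<8::nat}" "j \<in> {..<8}" "e i = e j"
    then have "g (e i) (e i) = g (e i) (e j)" "i < 8" "j < 8" by auto
    then show "i = j" using assms(2) unfolding orthonormal_basis_def by (metis zero_neq_one)
  qed
  let ?B = "e ` {..<8}"
  have ind: "independent ?B"
  proof (rule independent_if_scalars_zero)
    fix f x assume s: "(\<Sum>x\<in>?B. f x *\<^sub>R x) = 0" and "x \<in> ?B"
    then obtain k where k: "x = e k" "k < 8" by auto
    have "(\<Sum>i<8. f (e i) *\<^sub>R e i) = 0"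
      using s by (simp add: sum.reindex[OF inj])
    then show "f x = 0"
      using gs[OF k(2), of "\<lambda>i. f (e i)"] k(1) linear_0[OF lin] by simp
  qed simp
  have "card ?B = 8" using card_image[OF inj] by simp
  then have "UNIV \<subseteq> span ?B"
    using ind by (intro card_ge_dim_independent) auto
  then have "v \<in> span ?B" by blast
  then obtain c where "v = (\<Sum>x\<in>?B. c x *\<^sub>R x)"
    using span_finite[of ?B] by auto
  then have v: "v = (\<Sum>i<8. c (e i) *\<^sub>R e i)" by (simp add: sum.reindex[OF inj])
  have "g (e k) v = c (e k)" if "k < 8" for k
    using gs[OF that, of "\<lambda>i. c (e i)"] v by simp
  then show ?thesis using v by simp
qed

text \<open>Connects the orthonormal basis in which the torsion is known with the standard basis of
  the chart in which a divergence is written.\<close>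

lemma linear_trace_orthonormal:
  assumes "bilinear g" "orthonormal_basis g e" "linear (A :: E \<Rightarrow> E)"
  shows "(\<Sum>i<8. g (e i) (A (e i))) = (\<Sum>b\<in>Basis. A b \<bullet> b)"
proof -
  have lin: "linear (g u)" for u using assms(1) by (simp add: bilinear_def)
  have "(\<Sum>b\<in>Basis. A b \<bullet> b) = (\<Sum>b\<in>Basis. A (\<Sum>i<8. g (e i) b *\<^sub>R e i) \<bullet> b)"
    using orthonormal_basis_expansion[OF assms(1,2)] by simp
  also have "\<dots> = (\<Sum>b\<in>Basis. \<Sum>i<8. g (e i) b * (A (e i) \<bullet> b))"
    by (simp add: linear_sum[OF assms(3)] linear_cmul[OF assms(3)] inner_sum_left)
  also have "\<dots> = (\<Sum>i<8. \<Sum>b\<in>Basis. g (e i) b * (A (e i) \<bullet> b))"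
    by (rule sum.swap)
  also have "\<dots> = (\<Sum>i<8. g (e i) (\<Sum>b\<in>Basis. (A (e i) \<bullet> b) *\<^sub>R b))"
    by (simp add: linear_sum[OF lin] linear_cmul[OF lin] mult.commute)
  finally show ?thesis by (simp add: euclidean_representation)
qed

text \<open>\<open>r_tensor\<close> sums over an unspecified orthonormal basis; this exchanges it
  for an adapted one.\<close>

lemma orthonormal_basis_sum_invariant:
  fixes h :: "E \<Rightarrow> E \<Rightarrow> real"
  assumes "bilinear g" "\<And>u v. g u v = g v u" "orthonormal_basis g e" "orthonormal_basis g f" "bilinear h"
  shows "(\<Sum>i<8. h (e i) (e i)) = (\<Sum>i<8. h (f i) (f i))"
proof -
  have le: "linear (g u)" for u using assms(1) by (simp add: bilinear_def)
  have 1: "h (e i) (e i) = (\<Sum>j<8. g (f j) (e i) * h (e i) (f j))" for i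
  proof -
    have lin: "linear (h (e i))" using assms(5) by (simp add: bilinear_def)
    have "h (e i) (e i) = h (e i) (\<Sum>j<8. g (f j) (e i) *\<^sub>R f j)"
      using orthonormal_basis_expansion[OF assms(1,4)] by simp
    then show ?thesis by (simp add: linear_sum[OF lin] linear_cmul[OF lin])
  qed
  have 2: "h (f j) (f j) = (\<Sum>i<8. g (e i) (f j) * h (e i) (f j))" for j
  proof -
    have lin: "linear (\<lambda>u. h u (f j))" using assms(5) by (simp add: bilinear_def)
    have "h (f j) (f j) = h (\<Sum>i<8. g (e i) (f j) *\<^sub>R e i) (f j)"
      using orthonormal_basis_expansion[OF assms(1,3)] by simp
    then show ?thesis by (simp add: linear_sum[OF lin] linear_cmul[OF lin])
  qed
  show ?thesis
    unfolding 1 2 by (subst sum.swap) (simp add: assms(2)[of "f _"])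
qed

lemma orthonormal_basis_inner_expansion:
  assumes "bilinear g" "orthonormal_basis g e"
  shows "g u v = (\<Sum>i<8. g u (e i) * g (e i) v)"
proof -
  have lin: "linear (g u)" using assms(1) by (simp add: bilinear_def)
  have "g u v = g u (\<Sum>i<8. g (e i) v *\<^sub>R e i)"
    using orthonormal_basis_expansion[OF assms] by simp
  then show ?thesis by (simp add: linear_sum[OF lin] linear_cmul[OF lin] mult.commute)
qed

section \<open>Two-forms and torsion in one tangent space\<close>

text \<open>\<open>some_e\<close> makes \<open>e\<close> the very basis that
  \<open>hodge_star\<close> uses, so that the star is computed by components.\<close>

locale spin7_point =
  fixes g :: "E \<Rightarrow> E \<Rightarrow> real" and \<phi> :: form and e :: "nat \<Rightarrow> E"
  assumes bilinear_g: "bilinear g" and sym_g: "g u v = g v u"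
    and adapted_e: "adapted_basis g \<phi> e" and some_e: "e = (SOME e. adapted_basis g \<phi> e)"
begin

lemma orthonormal_e: "orthonormal_basis g e"
  using adapted_e by (simp add: adapted_basis_def)

lemma \<phi>_Q: "\<phi> v = Q (coords g e (v 0)) (coords g e (v 1)) (coords g e (v 2)) (coords g e (v 3))"
  using adapted_e by (simp only: adapted_basis_def model_form_Q)

lemma lessThan_8: "{..<8} = {0,1,2,3,4,5,6,7::nat}"
  by auto

lemmas coords_e = coords_basis[OF orthonormal_e]

lemmas star_eval = hodge_star_6_basis[OF some_e orthonormal_e] wedge_4_2 select_def shuffle_sign_prod
  \<phi>_Q coords_e Q_table_Suc two_form_def kron_def lessThan_8 insert_Diff_if

abbreviation comp :: "(E \<Rightarrow> E) \<Rightarrow> nat \<Rightarrow> nat \<Rightarrow> real" where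
  "comp A i j \<equiv> g (A (e i)) (e j)"

abbreviation star :: "(E \<Rightarrow> E) \<Rightarrow> E \<Rightarrow> E \<Rightarrow> real" where
  "star A u v \<equiv> hodge_star g \<phi> 6 (wedge 4 2 \<phi> (two_form g A)) (\<lambda>n. [u, v] ! n)"

text \<open>As the model form is self-dual, the star of \<phi> \<and> \<omega> is the contraction of
  \<phi> with \<omega>: the entry at a, b sums the components of \<omega> at the three pairs
  completing a, b to a term of the model form, with the sign of that term.\<close>

lemma star_wedge_table:
  "star A (e 0) (e 1) = - comp A 6 7 - comp A 4 5 + comp A 2 3"
  "star A (e 0) (e 2) = comp A 5 7 - comp A 4 6 - comp A 1 3"
  "star A (e 0) (e 3) = - comp A 5 6 - comp A 4 7 + comp A 1 2"
  "star A (e 0) (e 4) = comp A 3 7 + comp A 2 6 + comp A 1 5"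
  "star A (e 0) (e 5) = comp A 3 6 - comp A 2 7 - comp A 1 4"
  "star A (e 0) (e 6) = - comp A 3 5 - comp A 2 4 + comp A 1 7"
  "star A (e 0) (e 7) = - comp A 3 4 + comp A 2 5 - comp A 1 6"
  "star A (e 1) (e 2) = - comp A 5 6 - comp A 4 7 + comp A 0 3"
  "star A (e 1) (e 3) = - comp A 5 7 + comp A 4 6 - comp A 0 2"
  "star A (e 1) (e 4) = - comp A 3 6 + comp A 2 7 - comp A 0 5"
  "star A (e 1) (e 5) = comp A 3 7 + comp A 2 6 + comp A 0 4"
  "star A (e 1) (e 6) = comp A 3 4 - comp A 2 5 - comp A 0 7"
  "star A (e 1) (e 7) = - comp A 3 5 - comp A 2 4 + comp A 0 6"
  "star A (e 2) (e 3) = - comp A 6 7 - comp A 4 5 + comp A 0 1"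
  "star A (e 2) (e 4) = comp A 3 5 - comp A 1 7 - comp A 0 6"
  "star A (e 2) (e 5) = - comp A 3 4 - comp A 1 6 + comp A 0 7"
  "star A (e 2) (e 6) = comp A 3 7 + comp A 1 5 + comp A 0 4"
  "star A (e 2) (e 7) = - comp A 3 6 + comp A 1 4 - comp A 0 5"
  "star A (e 3) (e 4) = - comp A 2 5 + comp A 1 6 - comp A 0 7"
  "star A (e 3) (e 5) = comp A 2 4 - comp A 1 7 - comp A 0 6"
  "star A (e 3) (e 6) = - comp A 2 7 - comp A 1 4 + comp A 0 5"
  "star A (e 3) (e 7) = comp A 2 6 + comp A 1 5 + comp A 0 4"
  "star A (e 4) (e 5) = comp A 6 7 - comp A 2 3 - comp A 0 1"
  "star A (e 4) (e 6) = - comp A 5 7 + comp A 1 3 - comp A 0 2"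
  "star A (e 4) (e 7) = comp A 5 6 - comp A 1 2 - comp A 0 3"
  "star A (e 5) (e 6) = comp A 4 7 - comp A 1 2 - comp A 0 3"
  "star A (e 5) (e 7) = - comp A 4 6 - comp A 1 3 + comp A 0 2"
  "star A (e 6) (e 7) = comp A 4 5 - comp A 2 3 - comp A 0 1"
  by (simp_all add: star_eval)

abbreviation four :: "E \<Rightarrow> E \<Rightarrow> E \<Rightarrow> E \<Rightarrow> real" where
  "four u v w z \<equiv> Q (coords g e u) (coords g e v) (coords g e w) (coords g e z)"

text \<open>The derivation action of an endomorphism on \<open>\<phi>\<close>, with the affected argument moved to the front.\<close>
definition act :: "(E \<Rightarrow> E) \<Rightarrow> E \<Rightarrow> E \<Rightarrow> E \<Rightarrow> E \<Rightarrow> real" where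
  "act A u v w z = four (A u) v w z - four (A v) u w z + four (A w) u v z - four (A z) u v w"

lemma coords_A: "k < 8 \<Longrightarrow> coords g e v k = g v (e k)"
  by (simp add: coords_def sym_g)

lemma Lambda2_7_D:
  assumes "two_form g A \<in> Lambda2_7 g \<phi>"
  shows "3 * g (A u) v = star A u v"
  using assms by (simp add: Lambda2_7_def two_form_def)

lemma Lambda2_21_D:
  assumes "two_form g A \<in> Lambda2_21 g \<phi>"
  shows "- g (A u) v = star A u v"
  using assms by (simp add: Lambda2_21_def two_form_def)

lemma Lambda2_7_skew:
  assumes "two_form g A \<in> Lambda2_7 g \<phi>"
  shows "g (A u) v = - g (A v) u"
  using Lambda2_7_D[OF assms, of u v] Lambda2_7_D[OF assms, of v u] hodge_star_6_swap[of g \<phi> _ u v]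
  by simp

lemma Lambda2_21_skew:
  assumes "two_form g A \<in> Lambda2_21 g \<phi>"
  shows "g (A u) v = - g (A v) u"
  using Lambda2_21_D[OF assms, of u v] Lambda2_21_D[OF assms, of v u] hodge_star_6_swap[of g \<phi> _ u v]
  by simp

lemma Lambda2_7_skew_simps:
  assumes "two_form g A \<in> Lambda2_7 g \<phi>"
  shows "k < j \<Longrightarrow> comp A j k = - comp A k j" "comp A j j = 0"
  using Lambda2_7_skew[OF assms, of "e j" "e k"] Lambda2_7_skew[OF assms, of "e j" "e j"] by simp_all

lemma Lambda2_21_skew_simps:
  assumes "two_form g A \<in> Lambda2_21 g \<phi>"
  shows "k < j \<Longrightarrow> comp A j k = - comp A k j" "comp A j j = 0"
  using Lambda2_21_skew[OF assms, of "e j" "e k"] Lambda2_21_skew[OF assms, of "e j" "e j"] by simp_all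

text \<open>The 28 pairs fall into seven groups of four. Within a group, eigenvalue 3 says that
  three times each component is a signed sum of the other three, which makes all four equal up to
  sign. So the seven components \<open>comp A 0 k\<close> are coordinates on
  \<open>Lambda2_7\<close>.\<close>

lemma Lambda2_7_components:
  assumes "two_form g A \<in> Lambda2_7 g \<phi>"
  shows
  "comp A 1 2 = comp A 0 3" "comp A 1 3 = - comp A 0 2" "comp A 1 4 = - comp A 0 5" "comp A 1 5 = comp A 0 4" "comp A 1 6 = - comp A 0 7" "comp A 1 7 = comp A 0 6"
  "comp A 2 3 = comp A 0 1" "comp A 2 4 = - comp A 0 6" "comp A 2 5 = comp A 0 7" "comp A 2 6 = comp A 0 4" "comp A 2 7 = - comp A 0 5"
  "comp A 3 4 = - comp A 0 7" "comp A 3 5 = - comp A 0 6" "comp A 3 6 = comp A 0 5" "comp A 3 7 = comp A 0 4"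
  "comp A 4 5 = - comp A 0 1" "comp A 4 6 = - comp A 0 2" "comp A 4 7 = - comp A 0 3"
  "comp A 5 6 = - comp A 0 3" "comp A 5 7 = comp A 0 2"
  "comp A 6 7 = - comp A 0 1"
  by (insert star_wedge_table[of A, folded Lambda2_7_D[OF assms]], linarith+)

lemmas Lambda2_7_simps = Lambda2_7_components[unfolded One_nat_def] Lambda2_7_skew_simps

text \<open>For eigenvalue -1 the four equations of a group coincide and leave one linear relation,
  seven in all.\<close>

lemma Lambda2_21_components:
  assumes "two_form g A \<in> Lambda2_21 g \<phi>"
  shows
  "comp A 0 1 = comp A 6 7 + comp A 4 5 - comp A 2 3"
  "comp A 0 2 = - comp A 5 7 + comp A 4 6 + comp A 1 3"
  "comp A 0 3 = comp A 5 6 + comp A 4 7 - comp A 1 2"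
  "comp A 0 4 = - comp A 3 7 - comp A 2 6 - comp A 1 5"
  "comp A 0 5 = - comp A 3 6 + comp A 2 7 + comp A 1 4"
  "comp A 0 6 = comp A 3 5 + comp A 2 4 - comp A 1 7"
  "comp A 0 7 = comp A 3 4 - comp A 2 5 + comp A 1 6"
  by (insert star_wedge_table[of A, folded Lambda2_21_D[OF assms]], linarith+)

lemmas Lambda2_21_simps = Lambda2_21_components[unfolded One_nat_def] Lambda2_21_skew_simps

lemma all_less_numeral:
  "(\<forall>i<numeral n. P i) \<longleftrightarrow> P (pred_numeral n) \<and> (\<forall>i<pred_numeral n. P i)"
  by (simp add: numeral_eq_Suc All_less_Suc)

lemmas act_eval = act_def coords_e coords_A Q_table_Suc kron_def

text \<open>\<open>Lambda2_21\<close> is spin(7), the stabilizer algebra of the model form. On each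
  increasing quadruple of basis vectors the action is zero by the seven linear relations.\<close>

lemma Lambda2_21_act:
  assumes "two_form g A \<in> Lambda2_21 g \<phi>"
  shows "\<forall>d<8. \<forall>c<d. \<forall>b<c. \<forall>a<b. act A (e a) (e b) (e c) (e d) = 0"
  by (simp add: all_less_numeral All_less_Suc act_eval Lambda2_21_simps[OF assms])

text \<open>The equation \<open>d\<Phi> = t \<and> \<Phi>\<close> in terms of the torsion \<open>\<xi>\<close>, on the basis of 5-vectors.\<close>
definition torsion_equations :: "(E \<Rightarrow> E \<Rightarrow> E) \<Rightarrow> (nat \<Rightarrow> real) \<Rightarrow> bool" where
  "torsion_equations \<xi> t \<longleftrightarrow> (\<forall>f<8. \<forall>d<f. \<forall>c<d. \<forall>b<c. \<forall>a<b.
      act (\<xi> (e a)) (e b) (e c) (e d) (e f) - act (\<xi> (e b)) (e a) (e c) (e d) (e f)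
      + act (\<xi> (e c)) (e a) (e b) (e d) (e f) - act (\<xi> (e d)) (e a) (e b) (e c) (e f)
      + act (\<xi> (e f)) (e a) (e b) (e c) (e d) =
      t a * four (e b) (e c) (e d) (e f) - t b * four (e a) (e c) (e d) (e f)
      + t c * four (e a) (e b) (e d) (e f) - t d * four (e a) (e b) (e c) (e f)
      + t f * four (e a) (e b) (e c) (e d))"

text \<open>The 56 equations for 56 unknowns decouple into 8 systems of size 7, as \<open>\<phi>\<close> has a component with
  the indices \<open>a, b, c, d\<close> only if their bitwise exclusive or is 0.\<close>
lemma torsion_components:
  assumes L: "\<And>u. two_form g (\<xi> u) \<in> Lambda2_7 g \<phi>" and H: "torsion_equations \<xi> t"
  shows
  "comp (\<xi> (e 0)) 0 1 = t 1 / 16" "comp (\<xi> (e 0)) 0 2 = t 2 / 16" "comp (\<xi> (e 0)) 0 3 = t 3 / 16" "comp (\<xi> (e 0)) 0 4 = t 4 / 16"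
  "comp (\<xi> (e 0)) 0 5 = t 5 / 16" "comp (\<xi> (e 0)) 0 6 = t 6 / 16" "comp (\<xi> (e 0)) 0 7 = t 7 / 16"
  "comp (\<xi> (e 1)) 0 1 = - t 0 / 16" "comp (\<xi> (e 1)) 0 2 = - t 3 / 16" "comp (\<xi> (e 1)) 0 3 = t 2 / 16" "comp (\<xi> (e 1)) 0 4 = t 5 / 16"
  "comp (\<xi> (e 1)) 0 5 = - t 4 / 16" "comp (\<xi> (e 1)) 0 6 = t 7 / 16" "comp (\<xi> (e 1)) 0 7 = - t 6 / 16"
  "comp (\<xi> (e 2)) 0 1 = t 3 / 16" "comp (\<xi> (e 2)) 0 2 = - t 0 / 16" "comp (\<xi> (e 2)) 0 3 = - t 1 / 16" "comp (\<xi> (e 2)) 0 4 = t 6 / 16"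
  "comp (\<xi> (e 2)) 0 5 = - t 7 / 16" "comp (\<xi> (e 2)) 0 6 = - t 4 / 16" "comp (\<xi> (e 2)) 0 7 = t 5 / 16"
  "comp (\<xi> (e 3)) 0 1 = - t 2 / 16" "comp (\<xi> (e 3)) 0 2 = t 1 / 16" "comp (\<xi> (e 3)) 0 3 = - t 0 / 16" "comp (\<xi> (e 3)) 0 4 = t 7 / 16"
  "comp (\<xi> (e 3)) 0 5 = t 6 / 16" "comp (\<xi> (e 3)) 0 6 = - t 5 / 16" "comp (\<xi> (e 3)) 0 7 = - t 4 / 16"
  "comp (\<xi> (e 4)) 0 1 = - t 5 / 16" "comp (\<xi> (e 4)) 0 2 = - t 6 / 16" "comp (\<xi> (e 4)) 0 3 = - t 7 / 16" "comp (\<xi> (e 4)) 0 4 = - t 0 / 16"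
  "comp (\<xi> (e 4)) 0 5 = t 1 / 16" "comp (\<xi> (e 4)) 0 6 = t 2 / 16" "comp (\<xi> (e 4)) 0 7 = t 3 / 16"
  "comp (\<xi> (e 5)) 0 1 = t 4 / 16" "comp (\<xi> (e 5)) 0 2 = t 7 / 16" "comp (\<xi> (e 5)) 0 3 = - t 6 / 16" "comp (\<xi> (e 5)) 0 4 = - t 1 / 16"
  "comp (\<xi> (e 5)) 0 5 = - t 0 / 16" "comp (\<xi> (e 5)) 0 6 = t 3 / 16" "comp (\<xi> (e 5)) 0 7 = - t 2 / 16"
  "comp (\<xi> (e 6)) 0 1 = - t 7 / 16" "comp (\<xi> (e 6)) 0 2 = t 4 / 16" "comp (\<xi> (e 6)) 0 3 = t 5 / 16" "comp (\<xi> (e 6)) 0 4 = - t 2 / 16"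
  "comp (\<xi> (e 6)) 0 5 = - t 3 / 16" "comp (\<xi> (e 6)) 0 6 = - t 0 / 16" "comp (\<xi> (e 6)) 0 7 = t 1 / 16"
  "comp (\<xi> (e 7)) 0 1 = t 6 / 16" "comp (\<xi> (e 7)) 0 2 = - t 5 / 16" "comp (\<xi> (e 7)) 0 3 = t 4 / 16" "comp (\<xi> (e 7)) 0 4 = - t 3 / 16"
  "comp (\<xi> (e 7)) 0 5 = t 2 / 16" "comp (\<xi> (e 7)) 0 6 = - t 1 / 16" "comp (\<xi> (e 7)) 0 7 = - t 0 / 16"
proof -
  let ?z = "\<lambda>u k. comp (\<xi> (e u)) 0 k"
  note H = H[unfolded torsion_equations_def, rule_format]
  note [simp] = act_eval Lambda2_7_simps[OF L]
  \<comment> \<open>Of the eight blocks, numbered m = 0, ..., 7, block m contains the unknowns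
    \<open>?z u k\<close> and the 5-vectors whose indices have exclusive or m, seven of each. Its
    right-hand sides involve only \<open>t m\<close>.\<close>
  note eqs = H[of 7 6 5 4 0, simplified] H[of 7 6 3 2 0, simplified] H[of 5 4 3 2 0, simplified]
    H[of 7 5 3 1 0, simplified] H[of 6 4 3 1 0, simplified] H[of 6 5 2 1 0, simplified] H[of 7 4 2 1 0, simplified]
  show "?z 1 1 = - t 0 / 16" "?z 2 2 = - t 0 / 16" "?z 3 3 = - t 0 / 16"
    "?z 4 4 = - t 0 / 16" "?z 5 5 = - t 0 / 16" "?z 6 6 = - t 0 / 16" "?z 7 7 = - t 0 / 16"
    unfolding One_nat_def using eqs by linarith+
  note eqs = H[of 7 6 5 4 1, simplified] H[of 7 6 3 2 1, simplified] H[of 5 4 3 2 1, simplified]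
    H[of 6 5 3 1 0, simplified] H[of 7 4 3 1 0, simplified] H[of 7 5 2 1 0, simplified] H[of 6 4 2 1 0, simplified]
  show "?z 0 1 = t 1 / 16" "?z 2 3 = - t 1 / 16" "?z 3 2 = t 1 / 16"
    "?z 4 5 = t 1 / 16" "?z 5 4 = - t 1 / 16" "?z 6 7 = t 1 / 16" "?z 7 6 = - t 1 / 16"
    unfolding One_nat_def using eqs by linarith+
  note eqs = H[of 7 6 5 4 2, simplified] H[of 7 5 3 2 1, simplified] H[of 6 4 3 2 1, simplified]
    H[of 6 5 3 2 0, simplified] H[of 7 4 3 2 0, simplified] H[of 7 6 2 1 0, simplified] H[of 5 4 2 1 0, simplified]
  show "?z 0 2 = t 2 / 16" "?z 1 3 = t 2 / 16" "?z 3 1 = - t 2 / 16"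
    "?z 4 6 = t 2 / 16" "?z 5 7 = - t 2 / 16" "?z 6 4 = - t 2 / 16" "?z 7 5 = t 2 / 16"
    unfolding One_nat_def using eqs by linarith+
  note eqs = H[of 7 6 5 4 3, simplified] H[of 6 5 3 2 1, simplified] H[of 7 4 3 2 1, simplified]
    H[of 7 5 3 2 0, simplified] H[of 6 4 3 2 0, simplified] H[of 7 6 3 1 0, simplified] H[of 5 4 3 1 0, simplified]
  show "?z 0 3 = t 3 / 16" "?z 1 2 = - t 3 / 16" "?z 2 1 = t 3 / 16"
    "?z 4 7 = t 3 / 16" "?z 5 6 = t 3 / 16" "?z 6 5 = - t 3 / 16" "?z 7 4 = - t 3 / 16"
    unfolding One_nat_def using eqs by linarith+
  note eqs = H[of 7 6 4 3 2, simplified] H[of 7 5 4 3 1, simplified] H[of 6 5 4 2 1, simplified]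
    H[of 6 5 4 3 0, simplified] H[of 7 5 4 2 0, simplified] H[of 7 6 4 1 0, simplified] H[of 4 3 2 1 0, simplified]
  show "?z 0 4 = t 4 / 16" "?z 1 5 = - t 4 / 16" "?z 2 6 = - t 4 / 16" "?z 3 7 = - t 4 / 16" "?z 5 1 = t 4 / 16" "?z 6 2 = t 4 / 16" "?z 7 3 = t 4 / 16"
    unfolding One_nat_def using eqs by linarith+
  note eqs = H[of 7 6 5 3 2, simplified] H[of 6 5 4 3 1, simplified] H[of 7 5 4 2 1, simplified]
    H[of 7 5 4 3 0, simplified] H[of 6 5 4 2 0, simplified] H[of 7 6 5 1 0, simplified] H[of 5 3 2 1 0, simplified]
  show "?z 0 5 = t 5 / 16" "?z 1 4 = t 5 / 16" "?z 2 7 = t 5 / 16" "?z 3 6 = - t 5 / 16"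
    "?z 4 1 = - t 5 / 16" "?z 6 3 = t 5 / 16" "?z 7 2 = - t 5 / 16"
    unfolding One_nat_def using eqs by linarith+
  note eqs = H[of 6 5 4 3 2, simplified] H[of 7 6 5 3 1, simplified] H[of 7 6 4 2 1, simplified]
    H[of 7 6 4 3 0, simplified] H[of 7 6 5 2 0, simplified] H[of 6 5 4 1 0, simplified] H[of 6 3 2 1 0, simplified]
  show "?z 0 6 = t 6 / 16" "?z 1 7 = - t 6 / 16" "?z 2 4 = t 6 / 16" "?z 3 5 = t 6 / 16"
    "?z 4 2 = - t 6 / 16" "?z 5 3 = - t 6 / 16" "?z 7 1 = t 6 / 16"
    unfolding One_nat_def using eqs by linarith+
  note eqs = H[of 7 5 4 3 2, simplified] H[of 7 6 4 3 1, simplified] H[of 7 6 5 2 1, simplified]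
    H[of 7 6 5 3 0, simplified] H[of 7 6 4 2 0, simplified] H[of 7 5 4 1 0, simplified] H[of 7 3 2 1 0, simplified]
  show "?z 0 7 = t 7 / 16" "?z 1 6 = t 7 / 16" "?z 2 5 = - t 7 / 16" "?z 3 4 = t 7 / 16"
    "?z 4 3 = - t 7 / 16" "?z 5 2 = t 7 / 16" "?z 6 1 = - t 7 / 16"
    unfolding One_nat_def using eqs by linarith+
qed

text \<open>The left-hand side runs over ordered index pairs. Each of the seven coordinates fills a
  group of four unordered pairs, hence eight ordered ones.\<close>

lemma Lambda2_7_inner:
  assumes A: "two_form g A \<in> Lambda2_7 g \<phi>" and B: "two_form g B \<in> Lambda2_7 g \<phi>"
  shows "(\<Sum>k<8. g (A (e k)) (B (e k))) = 8 * (\<Sum>k\<in>{1..<8}. g (A (e 0)) (e k) * g (B (e 0)) (e k))"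
proof -
  have 17: "{1..<8} = {1,2,3,4,5,6,7::nat}" by auto
  show ?thesis
    unfolding 17 orthonormal_basis_inner_expansion[OF bilinear_g orthonormal_e, of "A _" "B _"] lessThan_8
    by simp (simp add: sym_g[of "e _" "B _"] Lambda2_7_simps[OF A] Lambda2_7_simps[OF B])
qed

text \<open>By \<open>Lambda2_7_inner\<close> an entry is 8 times a sum of products of two
  components, each \<open>t k / 16\<close> up to sign. On the diagonal the squares of all
  \<open>t k\<close> except \<open>t i\<close> appear.\<close>

lemma torsion_r_basis:
  assumes L: "\<And>u. two_form g (\<xi> u) \<in> Lambda2_7 g \<phi>"
    and H: "torsion_equations \<xi> t"
    and ij: "i < 8" "j < 8"
  shows "(\<Sum>k<8. g (\<xi> (e i) (e k)) (\<xi> (e j) (e k))) = ((\<Sum>k<8. t k * t k) * of_bool (i = j) - t i * t j) / 32"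
proof -
  have 17: "{1..<8} = {1,2,3,4,5,6,7::nat}" by auto
  have "\<forall>i<8. \<forall>j<8. (\<Sum>k<8. g (\<xi> (e i) (e k)) (\<xi> (e j) (e k))) =
      ((\<Sum>k<8. t k * t k) * of_bool (i = j) - t i * t j) / 32"
    unfolding Lambda2_7_inner[OF L L] unfolding 17 lessThan_8
    by (simp add: all_less_numeral All_less_Suc)
      (simp add: torsion_components[OF L H, unfolded One_nat_def] Lambda2_7_skew_simps(2)[OF L] field_simps)
  then show ?thesis using ij by blast
qed

text \<open>The summand is \<open>- t i / 16\<close> for each of the seven
  \<open>j \<noteq> i\<close>, and 0 for \<open>j = i\<close> by skewness.\<close>

lemma torsion_trace_basis:
  assumes L: "\<And>u. two_form g (\<xi> u) \<in> Lambda2_7 g \<phi>"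
    and H: "torsion_equations \<xi> t"
    and i: "i < 8"
  shows "(\<Sum>j<8. g (\<xi> (e j) (e i)) (e j)) = - 7 / 16 * t i"
proof -
  have "\<forall>i<8. (\<Sum>j<8. g (\<xi> (e j) (e i)) (e j)) = - 7 / 16 * t i"
    unfolding lessThan_8
    by (simp add: all_less_numeral All_less_Suc)
      (simp add: torsion_components[OF L H, unfolded One_nat_def] Lambda2_7_simps[OF L])
  then show ?thesis using i by blast
qed
end

section \<open>Functions with continuous derivatives\<close>

abbreviation fd :: "('a::real_normed_vector \<Rightarrow> 'b::real_normed_vector) \<Rightarrow> 'a \<Rightarrow> 'a \<Rightarrow> 'b" where
  "fd f x \<equiv> frechet_derivative f (at x)"

lemma fd_eq: "(f has_derivative f') (at x) \<Longrightarrow> fd f x = f'"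
  by (metis frechet_derivative_at)

lemma fd_works: "f differentiable (at x) \<Longrightarrow> (f has_derivative fd f x) (at x)"
  by (simp add: frechet_derivative_works)

lemma Ck_on_cong:
  assumes "open S" "\<And>x. x \<in> S \<Longrightarrow> f x = g x" "Ck_on k S f"
  shows "Ck_on k S g"
  using assms(2,3)
proof (induction k arbitrary: f g)
  case 0
  then show ?case using continuous_on_cong by force
next
  case (Suc k)
  have d: "(g has_derivative fd f x) (at x)" if "x \<in> S" for x
    using Suc.prems that assms(1)
    by (intro has_derivative_transform_within_open[OF fd_works _ that]) auto
  show ?case
    unfolding Ck_on.simps
  proof (intro conjI ballI allI)
    show "g differentiable (at x)" if "x \<in> S" for x
      using d[OF that] differentiable_def by blast
    show "Ck_on k S (\<lambda>x. fd g x v)" for v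
    proof (rule Suc.IH)
      show "Ck_on k S (\<lambda>x. fd f x v)" using Suc.prems by simp
      show "fd f x v = fd g x v" if "x \<in> S" for x
        using fd_eq[OF d[OF that]] by simp
    qed
  qed
qed

lemma Ck_on_SucI:
  assumes "open S" "\<And>x. x \<in> S \<Longrightarrow> (f has_derivative f' x) (at x)" "\<And>v. Ck_on k S (\<lambda>x. f' x v)"
  shows "Ck_on (Suc k) S f"
  unfolding Ck_on.simps
proof (intro conjI ballI allI)
  show "f differentiable (at x)" if "x \<in> S" for x
    using assms(2)[OF that] differentiable_def by blast
  show "Ck_on k S (\<lambda>x. fd f x v)" for v
    by (rule Ck_on_cong[OF assms(1) _ assms(3)]) (simp add: fd_eq[OF assms(2)])
qed

lemma Ck_on_imp_continuous: "Ck_on k S f \<Longrightarrow> continuous_on S f"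
  by (cases k) (auto intro!: continuous_at_imp_continuous_on differentiable_imp_continuous_within)

lemma Ck_on_SucD: "Ck_on (Suc k) S f \<Longrightarrow> Ck_on k S f"
proof (induction k arbitrary: f)
  case 0
  then show ?case by (simp add: Ck_on_imp_continuous[of "Suc 0"])
next
  case (Suc k)
  then show ?case by (metis Ck_on.simps(2))
qed

lemma Ck_on_subset:
  assumes "Ck_on k S f" "U \<subseteq> S"
  shows "Ck_on k U f"
  using assms(1) by (induction k arbitrary: f) (use assms(2) in \<open>auto intro: continuous_on_subset\<close>)

lemma Ck_on_has_derivative: "Ck_on (Suc k) S f \<Longrightarrow> x \<in> S \<Longrightarrow> (f has_derivative fd f x) (at x)"
  by (simp add: fd_works)

lemma Ck_on_const: "open S \<Longrightarrow> Ck_on k S (\<lambda>x. c)"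
proof (induction k arbitrary: c)
  case (Suc k)
  show ?case
    by (rule Ck_on_SucI[OF Suc.prems, where f' = "\<lambda>x v. 0"]) (auto simp: Suc)
qed auto

lemma Ck_on_add:
  assumes "open S" "Ck_on k S f" "Ck_on k S g"
  shows "Ck_on k S (\<lambda>x. f x + g x)"
  using assms(2,3)
proof (induction k arbitrary: f g)
  case (Suc k)
  show ?case
    by (rule Ck_on_SucI[OF assms(1), where f' = "\<lambda>x v. fd f x v + fd g x v"])
      (use Suc in \<open>auto intro!: has_derivative_add Ck_on_has_derivative\<close>)
qed (auto intro: continuous_on_add)

lemma Ck_on_bilinear:
  assumes "bounded_bilinear prd" "open S" "Ck_on k S f" "Ck_on k S g"
  shows "Ck_on k S (\<lambda>x. prd (f x) (g x))"
  using assms(3,4)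
proof (induction k arbitrary: f g)
  case 0
  then show ?case using bounded_bilinear.continuous_on[OF assms(1)] by simp
next
  case (Suc k)
  show ?case
  proof (rule Ck_on_SucI[OF assms(2), where f' = "\<lambda>x v. prd (f x) (fd g x v) + prd (fd f x v) (g x)"])
    show "((\<lambda>x. prd (f x) (g x)) has_derivative (\<lambda>v. prd (f x) (fd g x v) + prd (fd f x v) (g x))) (at x)"
      if "x \<in> S" for x
      using Suc.prems that by (intro bounded_bilinear.FDERIV[OF assms(1)] Ck_on_has_derivative)
    show "Ck_on k S (\<lambda>x. prd (f x) (fd g x v) + prd (fd f x v) (g x))" for v
      using Suc.prems Suc.prems[THEN Ck_on_SucD] by (intro Ck_on_add[OF assms(2)] Suc.IH) simp_all
  qed
qed

lemmas Ck_on_mult = Ck_on_bilinear[OF bounded_bilinear_mult]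
lemmas Ck_on_scaleR = Ck_on_bilinear[OF bounded_bilinear_scaleR]
lemmas Ck_on_inner = Ck_on_bilinear[OF bounded_bilinear_inner]

lemma Ck_on_sum:
  assumes "open S" "\<And>i. i \<in> I \<Longrightarrow> Ck_on k S (f i)"
  shows "Ck_on k S (\<lambda>x. \<Sum>i\<in>I. f i x)"
  using assms(2)
  by (induction I rule: infinite_finite_induct) (auto intro: Ck_on_const Ck_on_add assms(1))

lemma Ck_on_minus: "open S \<Longrightarrow> Ck_on k S f \<Longrightarrow> Ck_on k S (\<lambda>x. - f x)"
  using Ck_on_scaleR[of S k "\<lambda>_. -1" f] Ck_on_const[of S k "-1::real"] by simp

lemma Ck_on_inverse:
  fixes f :: "'a::euclidean_space \<Rightarrow> real"
  assumes "open S" "Ck_on k S f" "\<And>x. x \<in> S \<Longrightarrow> f x \<noteq> 0"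
  shows "Ck_on k S (\<lambda>x. inverse (f x))"
  using assms(2)
proof (induction k)
  case 0
  then show ?case using assms(3) by (auto intro: continuous_on_inverse)
next
  case (Suc k)
  show ?case
  proof (rule Ck_on_SucI[OF assms(1), where f' = "\<lambda>x v. - (inverse (f x) * fd f x v * inverse (f x))"])
    show "((\<lambda>x. inverse (f x)) has_derivative (\<lambda>v. - (inverse (f x) * fd f x v * inverse (f x)))) (at x)"
      if "x \<in> S" for x
      using Suc.prems that assms(3) by (intro Deriv.has_derivative_inverse Ck_on_has_derivative) auto
    show "Ck_on k S (\<lambda>x. - (inverse (f x) * fd f x v * inverse (f x)))" for v
      using Suc.prems Suc.prems[THEN Ck_on_SucD] by (intro Ck_on_minus Ck_on_mult assms(1) Suc.IH) simp_all
  qed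
qed

lemma fd_linear: "f differentiable (at x) \<Longrightarrow> linear (fd f x)"
  by (rule linear_frechet_derivative)

lemma linear_Basis_expansion:
  assumes "linear f"
  shows "f v = (\<Sum>b\<in>Basis. (v \<bullet> b) *\<^sub>R f b)"
  by (subst euclidean_representation[of v, symmetric]) (simp add: linear_sum[OF assms] linear_cmul[OF assms])

text \<open>First order suffices: this is applied to bump functions composed with transition
  maps.\<close>

lemma C1_compose:
  fixes f :: "'a::euclidean_space \<Rightarrow> 'b::euclidean_space" and h :: "'b \<Rightarrow> 'c::real_normed_vector"
  assumes "open S" "Ck_on (Suc 0) S f" "Ck_on (Suc 0) U h" "f ` S \<subseteq> U"
  shows "Ck_on (Suc 0) S (\<lambda>x. h (f x))"
proof (rule Ck_on_SucI[OF assms(1), where f' = "\<lambda>x v. fd h (f x) (fd f x v)"])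
  show "((\<lambda>x. h (f x)) has_derivative (\<lambda>v. fd h (f x) (fd f x v))) (at x)" if "x \<in> S" for x
  proof (rule has_derivative_compose[where f = f and g = h])
    show "(f has_derivative fd f x) (at x)" using assms(2) that by (rule Ck_on_has_derivative)
    show "(h has_derivative fd h (f x)) (at (f x))"
      using assms(3,4) that by (intro Ck_on_has_derivative[of 0 U]) auto
  qed
  fix v
  have cf: "continuous_on S f" using assms(2) by (rule Ck_on_imp_continuous)
  have 1: "continuous_on S (\<lambda>x. fd h (f x) b)" for b
    using continuous_on_compose2[OF _ cf assms(4), of "\<lambda>y. fd h y b"] assms(3) by simp
  \<comment> \<open>\<open>Ck_on\<close> controls the derivative of \<open>h\<close> only in fixed
    directions, so the moving direction \<open>fd f x v\<close> is expanded in the standard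
    basis.\<close>
  have "continuous_on S (\<lambda>x. \<Sum>b\<in>Basis. (fd f x v \<bullet> b) *\<^sub>R fd h (f x) b)"
    using assms(2) by (intro continuous_intros 1) auto
  then have "continuous_on S (\<lambda>x. fd h (f x) (fd f x v))"
  proof (rule continuous_on_eq)
    fix x assume "x \<in> S"
    then have "linear (fd h (f x))" using assms(3,4) by (auto intro!: fd_linear)
    then show "(\<Sum>b\<in>Basis. (fd f x v \<bullet> b) *\<^sub>R fd h (f x) b) = fd h (f x) (fd f x v)"
      by (rule linear_Basis_expansion[symmetric])
  qed
  then show "Ck_on 0 S (\<lambda>x. fd h (f x) (fd f x v))" by simp
qed

lemma smooth_on_subset: "smooth_on S f \<Longrightarrow> U \<subseteq> S \<Longrightarrow> smooth_on U f"
  by (auto simp: smooth_on_def intro: Ck_on_subset)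

lemma smooth_on_has_derivative: "smooth_on S f \<Longrightarrow> x \<in> S \<Longrightarrow> (f has_derivative fd f x) (at x)"
  unfolding smooth_on_def by (blast intro: Ck_on_has_derivative[of 0])

lemma smooth_on_differentiable: "smooth_on S f \<Longrightarrow> x \<in> S \<Longrightarrow> f differentiable (at x)"
  using smooth_on_has_derivative differentiable_def by blast

lemma smooth_on_fd: "smooth_on S f \<Longrightarrow> smooth_on S (\<lambda>x. fd f x v)"
  unfolding smooth_on_def by (metis Ck_on.simps(2))

lemma smooth_on_cong: "open S \<Longrightarrow> (\<And>x. x \<in> S \<Longrightarrow> f x = g x) \<Longrightarrow> smooth_on S f \<Longrightarrow> smooth_on S g"
  using Ck_on_cong[of S f g] unfolding smooth_on_def by blast

lemma smooth_on_const: "open S \<Longrightarrow> smooth_on S (\<lambda>x. c)"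
  by (simp add: smooth_on_def Ck_on_const)

lemma smooth_on_add: "open S \<Longrightarrow> smooth_on S f \<Longrightarrow> smooth_on S g \<Longrightarrow> smooth_on S (\<lambda>x. f x + g x)"
  by (simp add: smooth_on_def Ck_on_add)

lemma smooth_on_minus: "open S \<Longrightarrow> smooth_on S f \<Longrightarrow> smooth_on S (\<lambda>x. - f x)"
  by (simp add: smooth_on_def Ck_on_minus)

lemma smooth_on_sum: "open S \<Longrightarrow> (\<And>i. i \<in> I \<Longrightarrow> smooth_on S (f i)) \<Longrightarrow> smooth_on S (\<lambda>x. \<Sum>i\<in>I. f i x)"
  by (simp add: smooth_on_def Ck_on_sum)

lemma smooth_on_mult:
  fixes f g :: "'a::euclidean_space \<Rightarrow> real"
  shows "open S \<Longrightarrow> smooth_on S f \<Longrightarrow> smooth_on S g \<Longrightarrow> smooth_on S (\<lambda>x. f x * g x)"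
  by (simp add: smooth_on_def Ck_on_mult)

lemma smooth_on_scaleR: "open S \<Longrightarrow> smooth_on S f \<Longrightarrow> smooth_on S g \<Longrightarrow> smooth_on S (\<lambda>x. f x *\<^sub>R g x)"
  by (simp add: smooth_on_def Ck_on_scaleR)

lemma smooth_on_inner: "open S \<Longrightarrow> smooth_on S f \<Longrightarrow> smooth_on S g \<Longrightarrow> smooth_on S (\<lambda>x. f x \<bullet> g x)"
  by (simp add: smooth_on_def Ck_on_inner)

subsection \<open>Symmetry of second derivatives\<close>

text \<open>The mean value theorem is applied first along \<open>u\<close>, to the increment in
  direction \<open>v\<close>, and then along \<open>v\<close>, to the derivative in direction
  \<open>u\<close>. The second difference itself is symmetric in \<open>u\<close> and
  \<open>v\<close>.\<close>

lemma second_difference_mean_value: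
  fixes f :: "'a::euclidean_space \<Rightarrow> real"
  assumes "Ck_on 2 (ball x r) f" "s > 0" "s * (norm u + norm v) < r"
  shows "\<exists>p. dist x p \<le> s * (norm u + norm v) \<and>
    f (x + s *\<^sub>R u + s *\<^sub>R v) - f (x + s *\<^sub>R u) - f (x + s *\<^sub>R v) + f x = s * s * fd (\<lambda>y. fd f y u) p v"
proof -
  have near: "x + a *\<^sub>R u + b *\<^sub>R v \<in> ball x r \<and> dist x (x + a *\<^sub>R u + b *\<^sub>R v) \<le> s * (norm u + norm v)"
    if "0 \<le> a" "a \<le> s" "0 \<le> b" "b \<le> s" for a b
  proof -
    have "norm (a *\<^sub>R u + b *\<^sub>R v) \<le> a * norm u + b * norm v"
      using norm_triangle_ineq[of "a *\<^sub>R u" "b *\<^sub>R v"] that by simp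
    also have "\<dots> \<le> s * norm u + s * norm v"
      using that by (intro add_mono mult_right_mono) auto
    finally show ?thesis using assms(3) by (auto simp: dist_norm algebra_simps norm_minus_commute)
  qed
  have d1: "(f has_derivative fd f y) (at y)" if "y \<in> ball x r" for y
    using assms(1) that by (intro Ck_on_has_derivative[of "Suc 0" "ball x r"]) (simp_all add: numeral_2_eq_2)
  have d2: "((\<lambda>y. fd f y u) has_derivative fd (\<lambda>y. fd f y u) y) (at y)" if "y \<in> ball x r" for y
    using assms(1) that by (intro Ck_on_has_derivative[of "0" "ball x r"]) (simp_all add: numeral_2_eq_2)
  define \<phi> where "\<phi> a = f (x + a *\<^sub>R u + s *\<^sub>R v) - f (x + a *\<^sub>R u)" for a
  have d\<phi>: "DERIV \<phi> a :> fd f (x + a *\<^sub>R u + s *\<^sub>R v) u - fd f (x + a *\<^sub>R u) u" if "0 \<le> a" "a \<le> s" for a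
  proof -
    have c: "((\<lambda>a. f (x + a *\<^sub>R u + z)) has_derivative (\<lambda>h. fd f (x + a *\<^sub>R u + z) (h *\<^sub>R u))) (at a)"
      if "x + a *\<^sub>R u + z \<in> ball x r" for z
      by (rule has_derivative_compose[where f = "\<lambda>a. x + a *\<^sub>R u + z", OF _ d1[OF that]])
        (auto intro!: derivative_eq_intros)
    have "(\<phi> has_derivative (\<lambda>h. fd f (x + a *\<^sub>R u + s *\<^sub>R v) (h *\<^sub>R u) - fd f (x + a *\<^sub>R u) (h *\<^sub>R u))) (at a)"
      unfolding \<phi>_def
      using c[of "s *\<^sub>R v"] c[of 0] near[of a s] near[of a 0] that assms(2)
      by (intro has_derivative_diff) auto
    moreover have "linear (fd f (x + a *\<^sub>R u + s *\<^sub>R v))" "linear (fd f (x + a *\<^sub>R u))"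
      using d1 near[of a s] near[of a 0] that assms(2) has_derivative_linear by force+
    ultimately show ?thesis
      unfolding has_field_derivative_def
      by (rule_tac has_derivative_eq_rhs) (auto simp: linear_cmul fun_eq_iff algebra_simps)
  qed
  obtain a where a: "0 < a" "a < s" "\<phi> s - \<phi> 0 = (s - 0) * (fd f (x + a *\<^sub>R u + s *\<^sub>R v) u - fd f (x + a *\<^sub>R u) u)"
    using MVT2[OF assms(2) d\<phi>] by blast
  define \<psi> where "\<psi> b = fd f (x + a *\<^sub>R u + b *\<^sub>R v) u" for b
  have d\<psi>: "DERIV \<psi> b :> fd (\<lambda>y. fd f y u) (x + a *\<^sub>R u + b *\<^sub>R v) v" if "0 \<le> b" "b \<le> s" for b
  proof -
    have "(\<psi> has_derivative (\<lambda>h. fd (\<lambda>y. fd f y u) (x + a *\<^sub>R u + b *\<^sub>R v) (h *\<^sub>R v))) (at b)"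
      unfolding \<psi>_def
      using near[of a b] that a
      by (intro has_derivative_compose[where f = "\<lambda>b. x + a *\<^sub>R u + b *\<^sub>R v", OF _ d2])
        (auto intro!: derivative_eq_intros)
    moreover have "linear (fd (\<lambda>y. fd f y u) (x + a *\<^sub>R u + b *\<^sub>R v))"
      using d2 near[of a b] that a has_derivative_linear by force
    ultimately show ?thesis
      unfolding has_field_derivative_def
      by (rule_tac has_derivative_eq_rhs) (auto simp: linear_cmul fun_eq_iff algebra_simps)
  qed
  obtain b where b: "0 < b" "b < s" "\<psi> s - \<psi> 0 = (s - 0) * fd (\<lambda>y. fd f y u) (x + a *\<^sub>R u + b *\<^sub>R v) v"
    using MVT2[OF assms(2) d\<psi>] by blast
  show ?thesis
    using a b near[of a b] unfolding \<phi>_def \<psi>_def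
    by (intro exI[of _ "x + a *\<^sub>R u + b *\<^sub>R v"]) (auto simp: algebra_simps)
qed

text \<open>Both mixed derivatives equal the same second difference quotient at points arbitrarily
  near \<open>x\<close>; if they differed at \<open>x\<close>, continuity would separate
  them.\<close>

lemma second_derivative_symmetric_real:
  fixes f :: "'a::euclidean_space \<Rightarrow> real"
  assumes "open S" "x \<in> S" "Ck_on 2 S f"
  shows "fd (\<lambda>y. fd f y u) x v = fd (\<lambda>y. fd f y v) x u"
proof (rule ccontr)
  let ?P = "\<lambda>y. fd (\<lambda>y. fd f y u) y v" and ?R = "\<lambda>y. fd (\<lambda>y. fd f y v) y u"
  assume "?P x \<noteq> ?R x"
  define \<epsilon> where "\<epsilon> = \<bar>?P x - ?R x\<bar> / 2"
  have \<epsilon>: "\<epsilon> > 0" using \<open>?P x \<noteq> ?R x\<close> by (simp add: \<epsilon>_def)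
  have cont: "continuous (at x) ?P" "continuous (at x) ?R"
    using assms by (auto simp: numeral_2_eq_2 continuous_on_eq_continuous_at)
  obtain d1 where d1: "d1 > 0" "\<And>y. dist y x < d1 \<Longrightarrow> dist (?P y) (?P x) < \<epsilon>"
    using cont(1) \<epsilon> unfolding continuous_at_eps_delta by blast
  obtain d2 where d2: "d2 > 0" "\<And>y. dist y x < d2 \<Longrightarrow> dist (?R y) (?R x) < \<epsilon>"
    using cont(2) \<epsilon> unfolding continuous_at_eps_delta by blast
  obtain r where r: "r > 0" "ball x r \<subseteq> S" using assms(1,2) openE by blast
  define m where "m = min r (min d1 d2)"
  have m: "m > 0" "m \<le> r" "m \<le> d1" "m \<le> d2" using r d1 d2 by (auto simp: m_def)
  define s where "s = m / (norm u + norm v + 1)"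
  have pos: "norm u + norm v + 1 > 0" by (smt (verit) norm_ge_zero)
  have s: "s > 0" "s * (norm u + norm v) < m"
    using m(1) pos by (auto simp: s_def divide_simps algebra_simps)
  have C: "Ck_on 2 (ball x r) f" using assms(3) r(2) by (rule Ck_on_subset)
  obtain p where p: "dist x p \<le> s * (norm u + norm v)"
    "f (x + s *\<^sub>R u + s *\<^sub>R v) - f (x + s *\<^sub>R u) - f (x + s *\<^sub>R v) + f x = s * s * ?P p"
    using second_difference_mean_value[OF C s(1), of u v] s(2) m(2) by auto
  obtain q where q: "dist x q \<le> s * (norm v + norm u)"
    "f (x + s *\<^sub>R v + s *\<^sub>R u) - f (x + s *\<^sub>R v) - f (x + s *\<^sub>R u) + f x = s * s * ?R q"
    using second_difference_mean_value[OF C s(1), of v u] s(2) m(2) by (auto simp: add.commute)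
  have "f (x + s *\<^sub>R v + s *\<^sub>R u) = f (x + s *\<^sub>R u + s *\<^sub>R v)" by (simp add: ac_simps)
  then have "s * s * ?P p = s * s * ?R q" using p(2) q(2) by linarith
  then have "?P p = ?R q" using s(1) by simp
  moreover have "dist (?P p) (?P x) < \<epsilon>" "dist (?R q) (?R x) < \<epsilon>"
    using p(1) q(1) s(2) m by (auto intro!: d1(2) d2(2) simp: dist_commute add.commute)
  moreover have "False" if "a = b" "\<bar>a - y\<bar> < \<bar>y - z\<bar> / 2" "\<bar>b - z\<bar> < \<bar>y - z\<bar> / 2" for a b y z :: real
    using that by (auto simp: abs_if split: if_splits)
  ultimately show False unfolding \<epsilon>_def dist_real_def by blast
qed

lemma second_derivative_symmetric:
  fixes f :: "'a::euclidean_space \<Rightarrow> 'b::euclidean_space"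
  assumes "open S" "x \<in> S" "smooth_on S f"
  shows "fd (\<lambda>y. fd f y u) x v = fd (\<lambda>y. fd f y v) x u"
proof (rule euclidean_eqI)
  fix b :: 'b
  let ?f = "\<lambda>y. f y \<bullet> b"
  have d: "fd ?f y = (\<lambda>w. fd f y w \<bullet> b)" if "y \<in> S" for y
    using smooth_on_has_derivative[OF assms(3) that] by (intro fd_eq) (auto intro!: derivative_eq_intros)
  have "fd (\<lambda>y. fd ?f y w) x z = fd (\<lambda>y. fd f y w) x z \<bullet> b" for w z
  proof -
    have "((\<lambda>y. fd f y w \<bullet> b) has_derivative (\<lambda>z. fd (\<lambda>y. fd f y w) x z \<bullet> b)) (at x)"
      using smooth_on_has_derivative[OF smooth_on_fd[OF assms(3)] assms(2)]
      by (auto intro!: derivative_eq_intros)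
    then have "((\<lambda>y. fd ?f y w) has_derivative (\<lambda>z. fd (\<lambda>y. fd f y w) x z \<bullet> b)) (at x)"
      by (rule has_derivative_transform_within_open[OF _ assms(1,2)]) (simp add: d)
    then show ?thesis by (simp add: fd_eq)
  qed
  moreover have "Ck_on 2 S ?f"
    using smooth_on_inner[OF assms(1,3) smooth_on_const[OF assms(1)]] by (simp add: smooth_on_def)
  ultimately show "fd (\<lambda>y. fd f y u) x v \<bullet> b = fd (\<lambda>y. fd f y v) x u \<bullet> b"
    using second_derivative_symmetric_real[OF assms(1,2), of ?f u v] by simp
qed

subsection \<open>Derivatives of multilinear expressions\<close>

text \<open>The product rule differentiates one row factor at a time. Reindexing by the column
  \<open>m = \<sigma> a\<close> turns this into differentiating one argument of the multilinear form
  at a time.\<close>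

lemma minor_has_derivative:
  assumes "\<And>i m. i \<in> set I \<Longrightarrow> m < length I \<Longrightarrow> ((\<lambda>x. M x i m) has_derivative M' i m) (at x)"
  shows "((\<lambda>x. minor I (M x)) has_derivative
    (\<lambda>h. \<Sum>m<length I. minor I (\<lambda>i n. if n = m then M' i n h else M x i n))) (at x)"
proof -
  let ?n = "length I"
  have "((\<lambda>x. minor I (M x)) has_derivative (\<lambda>h. \<Sum>\<sigma> | \<sigma> permutes {..<?n}. of_int (sign \<sigma>) *
      (\<Sum>a<?n. M' (I ! a) (\<sigma> a) h * (\<Prod>b\<in>{..<?n} - {a}. M x (I ! b) (\<sigma> b))))) (at x)"
    unfolding minor_def
  proof (intro has_derivative_sum has_derivative_mult_right has_derivative_prod assms)
    fix \<sigma> a assume "\<sigma> \<in> {\<sigma>. \<sigma> permutes {..<?n}}" "a \<in> {..<?n}"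
    then show "\<sigma> a < ?n" using permutes_in_image[of \<sigma> "{..<?n}" a] by auto
  qed auto
  moreover have "(\<Sum>a<?n. M' (I ! a) (\<sigma> a) h * (\<Prod>b\<in>{..<?n} - {a}. M x (I ! b) (\<sigma> b))) =
      (\<Sum>m<?n. \<Prod>a<?n. if \<sigma> a = m then M' (I ! a) (\<sigma> a) h else M x (I ! a) (\<sigma> a))"
    if "\<sigma> permutes {..<?n}" for \<sigma> h
  proof -
    have "(\<Sum>m<?n. \<Prod>a<?n. if \<sigma> a = m then M' (I ! a) (\<sigma> a) h else M x (I ! a) (\<sigma> a)) =
        (\<Sum>b<?n. \<Prod>a<?n. if \<sigma> a = \<sigma> b then M' (I ! a) (\<sigma> a) h else M x (I ! a) (\<sigma> a))"
      by (rule sum.permute[OF that, unfolded o_def])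
    also have "\<dots> = (\<Sum>b<?n. M' (I ! b) (\<sigma> b) h * (\<Prod>a\<in>{..<?n} - {b}. M x (I ! a) (\<sigma> a)))"
    proof (rule sum.cong)
      fix b assume b: "b \<in> {..<?n}"
      have inj: "\<sigma> a = \<sigma> b \<longleftrightarrow> a = b" for a using permutes_inj[OF that] by (auto dest: injD)
      show "(\<Prod>a<?n. if \<sigma> a = \<sigma> b then M' (I ! a) (\<sigma> a) h else M x (I ! a) (\<sigma> a)) =
          M' (I ! b) (\<sigma> b) h * (\<Prod>a\<in>{..<?n} - {b}. M x (I ! a) (\<sigma> a))"
        unfolding inj prod.remove[OF finite_lessThan b] by simp
    qed simp
    finally show ?thesis by simp
  qed
  ultimately have "((\<lambda>x. minor I (M x)) has_derivative (\<lambda>h. \<Sum>\<sigma> | \<sigma> permutes {..<?n}. of_int (sign \<sigma>) *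
      (\<Sum>m<?n. \<Prod>a<?n. if \<sigma> a = m then M' (I ! a) (\<sigma> a) h else M x (I ! a) (\<sigma> a)))) (at x)"
    by simp
  then show ?thesis
    by (rule has_derivative_eq_rhs)
      (simp add: minor_def sum_distrib_left fun_eq_iff sum.swap[of _ "{..<?n}"])
qed

lemma model_poly_has_derivative:
  assumes "\<And>i m. i < 8 \<Longrightarrow> m < 4 \<Longrightarrow> ((\<lambda>x. M x i m) has_derivative M' i m) (at x)"
  shows "((\<lambda>x. model_poly (M x)) has_derivative
    (\<lambda>h. \<Sum>m<4. model_poly (\<lambda>i n. if n = m then M' i n h else M x i n))) (at x)"
proof -
  have *: "((\<lambda>x. minor [p,q,r,s] (M x)) has_derivative
      (\<lambda>h. \<Sum>m<4. minor [p,q,r,s] (\<lambda>i n. if n = m then M' i n h else M x i n))) (at x)"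
    if "p < 8" "q < 8" "r < 8" "s < 8" for p q r s
  proof -
    have l: "length [p,q,r,s] = 4" by simp
    show ?thesis
      using minor_has_derivative[of "[p,q,r,s]" M M' x, unfolded l] assms that by fastforce
  qed
  show ?thesis
    unfolding model_poly_def sum.distrib sum_subtractf sum_negf
    by (intro has_derivative_add has_derivative_diff *) simp_all
qed

lemma Q_has_derivative:
  assumes "\<And>i. i < 8 \<Longrightarrow> ((\<lambda>x. a x i) has_derivative (\<lambda>h. a' h i)) (at x)"
    and "\<And>i. i < 8 \<Longrightarrow> ((\<lambda>x. b x i) has_derivative (\<lambda>h. b' h i)) (at x)"
    and "\<And>i. i < 8 \<Longrightarrow> ((\<lambda>x. c x i) has_derivative (\<lambda>h. c' h i)) (at x)"
    and "\<And>i. i < 8 \<Longrightarrow> ((\<lambda>x. d x i) has_derivative (\<lambda>h. d' h i)) (at x)"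
  shows "((\<lambda>x. Q (a x) (b x) (c x) (d x)) has_derivative
    (\<lambda>h. Q (a' h) (b x) (c x) (d x) + Q (a x) (b' h) (c x) (d x) +
      Q (a x) (b x) (c' h) (d x) + Q (a x) (b x) (c x) (d' h))) (at x)"
proof -
  have 4: "m = 0 \<or> m = 1 \<or> m = 2 \<or> m = 3" if "m < 4" for m :: nat
    using that by linarith
  have s4: "{..<4} = {0,1,2,3::nat}" by auto
  have "((\<lambda>x. Q (a x) (b x) (c x) (d x)) has_derivative (\<lambda>h. \<Sum>m<4.
      model_poly (\<lambda>i n. if n = m then ([a' h, b' h, c' h, d' h] ! n) i else ([a x, b x, c x, d x] ! n) i))) (at x)"
    unfolding Q_def
    by (rule model_poly_has_derivative) (use assms in \<open>auto dest!: 4\<close>)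
  moreover have
    "model_poly (\<lambda>i n. if n = 0 then ([a' h, b' h, c' h, d' h] ! n) i else ([a x, b x, c x, d x] ! n) i) =
      Q (a' h) (b x) (c x) (d x)"
    "model_poly (\<lambda>i n. if n = 1 then ([a' h, b' h, c' h, d' h] ! n) i else ([a x, b x, c x, d x] ! n) i) =
      Q (a x) (b' h) (c x) (d x)"
    "model_poly (\<lambda>i n. if n = 2 then ([a' h, b' h, c' h, d' h] ! n) i else ([a x, b x, c x, d x] ! n) i) =
      Q (a x) (b x) (c' h) (d x)"
    "model_poly (\<lambda>i n. if n = 3 then ([a' h, b' h, c' h, d' h] ! n) i else ([a x, b x, c x, d x] ! n) i) =
      Q (a x) (b x) (c x) (d' h)" for h
    unfolding Q_def by (rule model_poly_cong; auto dest!: 4)+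
  ultimately show ?thesis
    by (simp only: s4) (simp add: add.assoc)
qed

lemma bilinear_Basis_expansion:
  fixes G :: "'a::euclidean_space \<Rightarrow> 'b::euclidean_space \<Rightarrow> real"
  assumes "bilinear G"
  shows "G u v = (\<Sum>i\<in>Basis. \<Sum>j\<in>Basis. (u \<bullet> i) * (v \<bullet> j) * G i j)"
proof -
  have 1: "linear (\<lambda>u. G u v)" "linear (G u)" for u v using assms by (auto simp: bilinear_def)
  have "G u v = (\<Sum>i\<in>Basis. (u \<bullet> i) *\<^sub>R G i v)" by (rule linear_Basis_expansion[OF 1(1)])
  also have "\<dots> = (\<Sum>i\<in>Basis. (u \<bullet> i) *\<^sub>R (\<Sum>j\<in>Basis. (v \<bullet> j) *\<^sub>R G i j))"
    using linear_Basis_expansion[OF 1(2)] by metis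
  finally show ?thesis by (simp add: sum_distrib_left mult.assoc)
qed

text \<open>A product rule when \<open>G\<close> is known to be differentiable only at fixed
  arguments: expand in the standard bases.\<close>

lemma has_derivative_bilinear_field:
  fixes G :: "'z::real_normed_vector \<Rightarrow> 'a::euclidean_space \<Rightarrow> 'b::euclidean_space \<Rightarrow> real"
  assumes "open S" "x \<in> S" "\<And>y. y \<in> S \<Longrightarrow> bilinear (G y)"
    and "\<And>u v. ((\<lambda>y. G y u v) has_derivative (\<lambda>h. G' h u v)) (at x)"
    and "(a has_derivative a') (at x)" "(b has_derivative b') (at x)"
  shows "((\<lambda>y. G y (a y) (b y)) has_derivative
    (\<lambda>h. G' h (a x) (b x) + G x (a' h) (b x) + G x (a x) (b' h))) (at x)"
proof -
  have d: "((\<lambda>y. \<Sum>i\<in>Basis. \<Sum>j\<in>Basis. (a y \<bullet> i) * (b y \<bullet> j) * G y i j) has_derivative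
      (\<lambda>h. \<Sum>i\<in>Basis. \<Sum>j\<in>Basis. (a x \<bullet> i) * (b x \<bullet> j) * G' h i j +
        ((a x \<bullet> i) * (b' h \<bullet> j) + (a' h \<bullet> i) * (b x \<bullet> j)) * G x i j)) (at x)"
    by (intro has_derivative_sum has_derivative_mult assms has_derivative_inner_left)
  \<comment> \<open>The derivative inherits bilinearity from \<open>G\<close>, by uniqueness of
    derivatives.\<close>
  have G': "G' h u v = (\<Sum>i\<in>Basis. \<Sum>j\<in>Basis. (u \<bullet> i) * (v \<bullet> j) * G' h i j)" for h u v
  proof -
    have "((\<lambda>y. \<Sum>i\<in>Basis. \<Sum>j\<in>Basis. (u \<bullet> i) * (v \<bullet> j) * G y i j) has_derivative
        (\<lambda>h. \<Sum>i\<in>Basis. \<Sum>j\<in>Basis. (u \<bullet> i) * (v \<bullet> j) * G' h i j)) (at x)"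
      by (intro has_derivative_sum has_derivative_mult_right assms)
    then have "((\<lambda>y. G y u v) has_derivative
        (\<lambda>h. \<Sum>i\<in>Basis. \<Sum>j\<in>Basis. (u \<bullet> i) * (v \<bullet> j) * G' h i j)) (at x)"
      by (rule has_derivative_transform_within_open[OF _ assms(1,2)])
        (rule bilinear_Basis_expansion[OF assms(3), symmetric])
    from has_derivative_unique[OF this assms(4)] show ?thesis by (simp add: fun_eq_iff)
  qed
  have "((\<lambda>y. G y (a y) (b y)) has_derivative
      (\<lambda>h. \<Sum>i\<in>Basis. \<Sum>j\<in>Basis. (a x \<bullet> i) * (b x \<bullet> j) * G' h i j +
        ((a x \<bullet> i) * (b' h \<bullet> j) + (a' h \<bullet> i) * (b x \<bullet> j)) * G x i j)) (at x)"
    by (rule has_derivative_transform_within_open[OF d assms(1,2)])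
      (rule bilinear_Basis_expansion[OF assms(3), symmetric])
  moreover have "(\<Sum>i\<in>Basis. \<Sum>j\<in>Basis. (a x \<bullet> i) * (b x \<bullet> j) * G' h i j +
        ((a x \<bullet> i) * (b' h \<bullet> j) + (a' h \<bullet> i) * (b x \<bullet> j)) * G x i j) =
      G' h (a x) (b x) + G x (a' h) (b x) + G x (a x) (b' h)" for h
    unfolding bilinear_Basis_expansion[OF assms(3)[OF assms(2)], of "a' h" "b x"]
      bilinear_Basis_expansion[OF assms(3)[OF assms(2)], of "a x" "b' h"]
      G'[of h "a x" "b x"]
    by (simp add: sum.distrib[symmetric] algebra_simps)
  ultimately show ?thesis by (simp add: fun_eq_iff)
qed

lemma smooth_on_bilinear_field:
  fixes G :: "'z::euclidean_space \<Rightarrow> 'a::euclidean_space \<Rightarrow> 'b::euclidean_space \<Rightarrow> real"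
  assumes "open S" "\<And>y. y \<in> S \<Longrightarrow> bilinear (G y)" "\<And>u v. smooth_on S (\<lambda>y. G y u v)"
    and "smooth_on S a" "smooth_on S b"
  shows "smooth_on S (\<lambda>y. G y (a y) (b y))"
proof (rule smooth_on_cong[OF assms(1)])
  show "smooth_on S (\<lambda>y. \<Sum>i\<in>Basis. \<Sum>j\<in>Basis. (a y \<bullet> i) * (b y \<bullet> j) * G y i j)"
    by (intro smooth_on_sum smooth_on_mult smooth_on_inner smooth_on_const assms)
  show "(\<Sum>i\<in>Basis. \<Sum>j\<in>Basis. (a y \<bullet> i) * (b y \<bullet> j) * G y i j) = G y (a y) (b y)" if "y \<in> S" for y
    by (rule bilinear_Basis_expansion[OF assms(2)[OF that], symmetric])
qed

lemma det_has_derivative: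
  fixes A :: "'z::real_normed_vector \<Rightarrow> real^'n^'n"
  assumes "\<And>i j. ((\<lambda>x. A x $ i $ j) has_derivative (\<lambda>h. A' h $ i $ j)) (at x)"
  shows "((\<lambda>x. det (A x)) has_derivative (\<lambda>h. \<Sum>k\<in>UNIV. det (\<chi> i. if i = k then row k (A' h) else row i (A x)))) (at x)"
proof -
  have "((\<lambda>x. det (A x)) has_derivative (\<lambda>h. \<Sum>p | p permutes (UNIV :: 'n set). of_int (sign p) *
      (\<Sum>k\<in>UNIV. A' h $ k $ p k * (\<Prod>i\<in>UNIV - {k}. A x $ i $ p i)))) (at x)"
    unfolding det_def
    by (intro has_derivative_sum has_derivative_mult_right has_derivative_prod assms)
  moreover have "det (\<chi> i. if i = k then row k (A' h) else row i (A x)) = (\<Sum>p | p permutes (UNIV :: 'n set).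
      of_int (sign p) * (A' h $ k $ p k * (\<Prod>i\<in>UNIV - {k}. A x $ i $ p i)))" for k h
    unfolding det_def by (intro sum.cong refl arg_cong2[where f = "(*)"])
      (subst prod.remove[of UNIV k], auto simp: row_def intro!: prod.cong)
  ultimately show ?thesis
    by (simp add: sum_distrib_left sum.swap[of _ UNIV])
qed

text \<open>Jacobi's formula, for a derivative given as \<open>P h ** A x\<close>. Row
  \<open>k\<close> of this product is a combination of the rows of \<open>A x\<close>, of which only
  the \<open>k\<close>-th contributes when it replaces row \<open>k\<close> in the
  determinant.\<close>

lemma det_has_derivative_trace:
  fixes A :: "'z::real_normed_vector \<Rightarrow> real^'n^'n"
  assumes "\<And>i j. ((\<lambda>x. A x $ i $ j) has_derivative (\<lambda>h. (P h ** A x) $ i $ j)) (at x)"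
  shows "((\<lambda>x. det (A x)) has_derivative (\<lambda>h. trace (P h) * det (A x))) (at x)"
proof (rule has_derivative_eq_rhs[OF det_has_derivative[OF assms]])
  have "row k (P h ** A x) = (\<Sum>i\<in>UNIV. row k (P h) $ i *s row i (A x))" for k h
    by (simp add: vec_eq_iff row_def matrix_matrix_mult_def sum_component)
  then have "det (\<chi> i. if i = k then row k (P h ** A x) else row i (A x)) = row k (P h) $ k * det (A x)" for k h
    by (simp only: cramer_lemma_transpose)
  then show "(\<lambda>h. \<Sum>k\<in>UNIV. det (\<chi> i. if i = k then row k (P h ** A x) else row i (A x))) =
      (\<lambda>h. trace (P h) * det (A x))"
    by (simp add: trace_def row_def sum_distrib_right)
qed

subsection \<open>Integrals of compactly supported functions\<close>

lemma integrable_compact_support: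
  fixes F :: "'a::euclidean_space \<Rightarrow> real"
  assumes "continuous_on K F" "compact K" "\<And>x. x \<notin> K \<Longrightarrow> F x = 0"
  shows "integrable lborel F"
proof -
  have "(\<lambda>x. indicator K x *\<^sub>R F x) = F" using assms(3) by (auto simp: indicator_def fun_eq_iff)
  then show ?thesis using borel_integrable_compact[OF assms(2,1)] by simp
qed

lemma absolutely_integrable_compact_support:
  fixes F :: "'a::euclidean_space \<Rightarrow> real"
  assumes "continuous_on K F" "compact K" "K \<subseteq> S" "\<And>x. x \<in> S \<Longrightarrow> x \<notin> K \<Longrightarrow> F x = 0"
  shows "F absolutely_integrable_on S"
proof -
  have i: "integrable lborel (\<lambda>x. indicator K x *\<^sub>R F x)"
    by (rule borel_integrable_compact[OF assms(2,1)])
  then have "integrable lebesgue (\<lambda>x. indicator K x *\<^sub>R F x)"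
    by (subst integrable_completion) (auto dest: borel_measurable_integrable)
  moreover have "(\<lambda>x. indicator K x *\<^sub>R F x) = (\<lambda>x. indicator S x *\<^sub>R F x)"
    using assms(3,4) by (auto simp: indicator_def fun_eq_iff)
  ultimately show ?thesis by (simp add: set_integrable_def)
qed

lemma lborel_integral_translate:
  fixes F :: "'a::euclidean_space \<Rightarrow> real"
  assumes "integrable lborel F"
  shows "integrable lborel (\<lambda>x. F (c + x))" "(\<integral>x. F (c + x) \<partial>lborel) = (\<integral>x. F x \<partial>lborel)"
proof -
  have m: "(+) c \<in> measurable lborel borel" "F \<in> borel_measurable borel" using assms by auto
  show "integrable lborel (\<lambda>x. F (c + x))"
    using integrable_distr[OF m(1), of F] assms by (simp add: lborel_distr_plus)
  show "(\<integral>x. F (c + x) \<partial>lborel) = (\<integral>x. F x \<partial>lborel)"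
    using integral_distr[OF m] by (simp add: lborel_distr_plus)
qed

text \<open>Difference quotients in direction \<open>v\<close> have integral 0 by translation
  invariance, and they converge to the derivative under a common integrable bound.\<close>

lemma integral_fd_compact_support:
  fixes F :: "'a::euclidean_space \<Rightarrow> real"
  assumes "Ck_on (Suc 0) UNIV F" "compact K" "\<And>x. x \<notin> K \<Longrightarrow> F x = 0"
  shows "integrable lborel (\<lambda>x. fd F x v)" "(\<integral>x. fd F x v \<partial>lborel) = 0"
proof -
  have contF: "continuous_on UNIV F" using assms(1) by (rule Ck_on_imp_continuous)
  have contD: "continuous_on UNIV (\<lambda>x. fd F x v)" using assms(1) by simp
  have d: "(F has_derivative fd F x) (at x)" for x
    using assms(1) by (rule Ck_on_has_derivative) simp
  have D0: "fd F x v = 0" if "x \<notin> K" for x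
  proof -
    have "open (- K)" using assms(2) compact_imp_closed by blast
    then have "(F has_derivative (\<lambda>h. 0)) (at x)"
      using that assms(3)
      by (intro has_derivative_transform_within_open[of "\<lambda>x. 0" _ x UNIV "- K" F]) auto
    then show ?thesis by (simp add: fd_eq)
  qed
  show intD: "integrable lborel (\<lambda>x. fd F x v)"
    by (rule integrable_compact_support[OF continuous_on_subset[OF contD] assms(2) D0]) auto
  have "compact ((\<lambda>x. fd F x v) ` K)"
    by (rule compact_continuous_image[OF continuous_on_subset[OF contD] assms(2)]) auto
  then obtain B0 where B0: "\<And>x. x \<in> K \<Longrightarrow> \<bar>fd F x v\<bar> \<le> B0"
    by (meson bounded_real compact_imp_bounded imageI)
  define B where "B = max B0 0"
  have B: "\<bar>fd F x v\<bar> \<le> B" "B \<ge> 0" for x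
    using B0[of x] D0[of x] by (cases "x \<in> K"; auto simp: B_def)+
  \<comment> \<open>The region swept out by \<open>K\<close> when moved back along \<open>v\<close>
    for time at most 1. Off \<open>K'\<close>, both terms of every difference quotient with step in
    (0, 1] vanish, so the indicator of \<open>K'\<close> can serve in the bound.\<close>
  define K' where "K' = (\<lambda>(x, t). x - t *\<^sub>R v) ` (K \<times> {0..1::real})"
  have K': "compact K'"
    unfolding K'_def by (intro compact_continuous_image compact_Times assms(2) compact_Icc)
      (auto simp: case_prod_unfold intro!: continuous_intros)
  have D: "DERIV (\<lambda>t. F (t *\<^sub>R v + x)) t :> fd F (t *\<^sub>R v + x) v" for x t
  proof -
    have "((\<lambda>t. F (t *\<^sub>R v + x)) has_derivative (\<lambda>s. fd F (t *\<^sub>R v + x) (s *\<^sub>R v))) (at t)"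
      by (rule has_derivative_compose[where f = "\<lambda>t. t *\<^sub>R v + x", OF _ d])
        (auto intro!: derivative_eq_intros)
    then show ?thesis
      unfolding has_field_derivative_def
      by (rule has_derivative_eq_rhs) (simp add: linear_cmul[OF has_derivative_linear[OF d]] fun_eq_iff)
  qed
  have bound: "\<bar>F (h *\<^sub>R v + x) - F x\<bar> \<le> h * (B * indicator K' x)" if h: "0 < h" "h \<le> 1" for h x
  proof (cases "x \<in> K'")
    case True
    obtain t where "F (h *\<^sub>R v + x) - F (0 *\<^sub>R v + x) = (h - 0) * fd F (t *\<^sub>R v + x) v"
      using MVT2[OF h(1) D] by blast
    then show ?thesis using True h B(1)[of "t *\<^sub>R v + x"] by (simp add: abs_mult)
  next
    case False
    have "x \<notin> K" using False by (force simp: K'_def image_iff)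
    moreover have "h *\<^sub>R v + x \<notin> K"
    proof
      assume "h *\<^sub>R v + x \<in> K"
      then have "(h *\<^sub>R v + x, h) \<in> K \<times> {0..1}" using h by auto
      then show False using False unfolding K'_def by (force simp: image_iff)
    qed
    ultimately show ?thesis using assms(3) False by simp
  qed
  have intF: "integrable lborel F"
    by (rule integrable_compact_support[OF continuous_on_subset[OF contF] assms(2,3)]) auto
  define s where "s n x = (F ((1 / real (Suc n)) *\<^sub>R v + x) - F x) * real (Suc n)" for n x
  have "(\<lambda>n. \<integral>x. s n x \<partial>lborel) \<longlonglongrightarrow> (\<integral>x. fd F x v \<partial>lborel)"
  proof (rule integral_dominated_convergence[where w = "\<lambda>x. B * indicator K' x"])
    show "(\<lambda>x. fd F x v) \<in> borel_measurable lborel" using intD by auto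
    show "s n \<in> borel_measurable lborel" for n
      unfolding s_def using lborel_integral_translate(1)[OF intF] intF by measurable
    show "integrable lborel (\<lambda>x. B * indicator K' x)"
      using K' by (intro integrable_mult_right integrable_real_indicator emeasure_compact_finite)
        (auto intro: borel_closed compact_imp_closed)
    show "AE x in lborel. (\<lambda>n. s n x) \<longlonglongrightarrow> fd F x v"
    proof (rule AE_I2)
      fix x
      have D0: "DERIV (\<lambda>t. F (t *\<^sub>R v + x)) 0 :> fd F x v" using D[of x 0] by simp
      have "(\<lambda>n. (F ((0 + 1 / real (Suc n)) *\<^sub>R v + x) - F (0 *\<^sub>R v + x)) / (1 / real (Suc n))) \<longlonglongrightarrow> fd F x v"
        by (rule filterlim_compose[OF D0[unfolded DERIV_def]])
          (auto simp: filterlim_at simp del: of_nat_Suc intro!: LIMSEQ_inverse_real_of_nat[unfolded inverse_eq_divide])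
      then show "(\<lambda>n. s n x) \<longlonglongrightarrow> fd F x v" by (simp add: s_def)
    qed
    show "AE x in lborel. norm (s n x) \<le> B * indicator K' x" for n
    proof (rule AE_I2)
      fix x
      have "\<bar>F ((1 / real (Suc n)) *\<^sub>R v + x) - F x\<bar> \<le> 1 / real (Suc n) * (B * indicator K' x)"
        by (rule bound) auto
      from mult_right_mono[OF this, of "real (Suc n)"]
      show "norm (s n x) \<le> B * indicator K' x"
        by (simp add: s_def abs_mult del: of_nat_Suc)
    qed
  qed
  moreover have "(\<integral>x. s n x \<partial>lborel) = 0" for n
    unfolding s_def using lborel_integral_translate[OF intF] intF by simp
  ultimately show "(\<integral>x. fd F x v \<partial>lborel) = 0" by (simp add: LIMSEQ_const_iff)
qed

text \<open>The formula for functions with values in \<open>real^1\<close>, read off in the single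
  component.\<close>

lemma integral_change_of_variables_real_valued:
  fixes f :: "real^'m::{finite,wellorder} \<Rightarrow> real" and g :: "real^'m::_ \<Rightarrow> real^'m::_"
  assumes "S \<in> sets lebesgue" "\<And>x. x \<in> S \<Longrightarrow> (g has_derivative g' x) (at x within S)" "inj_on g S"
    and f: "f absolutely_integrable_on (g ` S)"
  shows "integral (g ` S) f = integral S (\<lambda>x. \<bar>det (matrix (g' x))\<bar> * f (g x))"
proof -
  let ?F = "\<lambda>y. f y *\<^sub>R (1 :: real^1)"
  have F: "?F absolutely_integrable_on (g ` S)"
    using f by (rule absolutely_integrable_scaleR_right)
  have "integral (g ` S) ?F = integral S (\<lambda>x. \<bar>det (matrix (g' x))\<bar> *\<^sub>R ?F (g x))"
    using F by (intro integral_change_of_variables assms(1-3)) auto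
  moreover have "(\<lambda>x. \<bar>det (matrix (g' x))\<bar> *\<^sub>R ?F (g x)) absolutely_integrable_on S"
    by (rule absolutely_integrable_change_of_variables[THEN iffD1, OF assms(1) _ assms(3) F]) (rule assms(2))
  ultimately have "integral (g ` S) (\<lambda>y. ?F y $ 1) = integral S (\<lambda>x. (\<bar>det (matrix (g' x))\<bar> *\<^sub>R ?F (g x)) $ 1)"
    using F by (simp only: integral_component_eq_cart absolutely_integrable_on_def)
  then show ?thesis by simp
qed

section \<open>The exterior derivative of the fundamental form in a chart\<close>

abbreviation form4 :: "form \<Rightarrow> E \<Rightarrow> E \<Rightarrow> E \<Rightarrow> E \<Rightarrow> real" where
  "form4 \<phi> a b c d \<equiv> \<phi> (\<lambda>n. [a, b, c, d] ! n)"

text \<open>Here every argument stays in its place, whereas \<open>act\<close> moves the affected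
  one to the front; \<open>act_act4\<close> identifies the two.\<close>

definition act4 :: "form \<Rightarrow> (E \<Rightarrow> E) \<Rightarrow> E \<Rightarrow> E \<Rightarrow> E \<Rightarrow> E \<Rightarrow> real" where
  "act4 \<phi> A a b c d = form4 \<phi> (A a) b c d + form4 \<phi> a (A b) c d + form4 \<phi> a b (A c) d + form4 \<phi> a b c (A d)"

text \<open>The exterior derivative alternates a directional derivative. If the derivative in
  direction \<open>w\<close> acts on the form through the endomorphism \<open>F w\<close>, this is
  its value on five vectors. Frame, connection and torsion terms all enter through \<open>F\<close>,
  additively.\<close>

definition alt5 :: "form \<Rightarrow> (E \<Rightarrow> E \<Rightarrow> E) \<Rightarrow> E \<Rightarrow> E \<Rightarrow> E \<Rightarrow> E \<Rightarrow> E \<Rightarrow> real" where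
  "alt5 \<phi> F a b c d f = act4 \<phi> (F a) b c d f - act4 \<phi> (F b) a c d f + act4 \<phi> (F c) a b d f
     - act4 \<phi> (F d) a b c f + act4 \<phi> (F f) a b c d"

lemma form4_Q:
  assumes "adapted_basis g \<phi> e"
  shows "form4 \<phi> a b c d = Q (coords g e a) (coords g e b) (coords g e c) (coords g e d)"
  using assms by (simp add: adapted_basis_def model_form_Q)

lemma adapted_form_form4:
  assumes "adapted_basis g \<phi> e"
  shows "\<phi> v = form4 \<phi> (v 0) (v 1) (v 2) (v 3)"
  using assms by (simp add: adapted_basis_def model_form_Q)

lemma Q_adds:
  "Q (\<lambda>i. a i + a' i) b c d = Q a b c d + Q a' b c d"
  "Q b (\<lambda>i. a i + a' i) c d = Q b a c d + Q b a' c d"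
  "Q b c (\<lambda>i. a i + a' i) d = Q b c a d + Q b c a' d"
  "Q b c d (\<lambda>i. a i + a' i) = Q b c d a + Q b c d a'"
proof -
  have 2: "Q x y c d = - Q y x c d" for x y c d by (rule Q_swap)
  have 3: "Q b x y d = - Q b y x d" for b x y d by (rule Q_swap)
  have 4: "Q b c x y = - Q b c y x" for b c x y by (rule Q_swap)
  show 1: "Q (\<lambda>i. a i + a' i) b c d = Q a b c d + Q a' b c d" for a a' b c d by (rule Q_add)
  show 22: "Q b (\<lambda>i. a i + a' i) c d = Q b a c d + Q b a' c d" for a a' b c d
    unfolding 2[of b] 1 by simp
  show 33: "Q b c (\<lambda>i. a i + a' i) d = Q b c a d + Q b c a' d" for a a' b c d
    unfolding 3[of b c] 22 by simp
  show "Q b c d (\<lambda>i. a i + a' i) = Q b c d a + Q b c d a'"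
    unfolding 4[of b c d] 33 by simp
qed

lemma coords_add:
  assumes "bilinear g"
  shows "coords g e (u + v) = (\<lambda>i. coords g e u i + coords g e v i)"
  using assms by (auto simp: coords_def fun_eq_iff bilinear_radd)

lemma act4_add:
  assumes "adapted_basis g \<phi> e" "bilinear g"
  shows "act4 \<phi> (\<lambda>u. A u + B u) a b c d = act4 \<phi> A a b c d + act4 \<phi> B a b c d"
  unfolding act4_def form4_Q[OF assms(1)] coords_add[OF assms(2)] Q_adds by simp

lemma alt5_add:
  assumes "adapted_basis g \<phi> e" "bilinear g"
  shows "alt5 \<phi> (\<lambda>w u. F w u + G w u) a b c d f = alt5 \<phi> F a b c d f + alt5 \<phi> G a b c d f"
  unfolding alt5_def act4_add[OF assms] by simp

lemma form4_swap:
  assumes "adapted_basis g \<phi> e"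
  shows "form4 \<phi> b a c d = - form4 \<phi> a b c d" "form4 \<phi> a c b d = - form4 \<phi> a b c d"
    "form4 \<phi> a b d c = - form4 \<phi> a b c d"
  unfolding form4_Q[OF assms] by (rule Q_swap)+

text \<open>The term containing \<open>F a b\<close> cancels against the one containing
  \<open>F b a\<close>. This removes the second derivatives of a transition map and, later, the
  torsion-free connection.\<close>

lemma alt5_symmetric:
  assumes "adapted_basis g \<phi> e" "\<And>u v. F u v = F v u"
  shows "alt5 \<phi> F a b c d f = 0"
proof -
  have 2: "form4 \<phi> x (F u v) y z = - form4 \<phi> (F u v) x y z" for x y z u v
    by (rule form4_swap[OF assms(1)])
  have 3: "form4 \<phi> x y (F u v) z = form4 \<phi> (F u v) x y z" for x y z u v
    unfolding form4_swap(2)[OF assms(1), where a = x and b = "F u v" and c = y and d = z] 2 by simp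
  have 4: "form4 \<phi> x y z (F u v) = - form4 \<phi> (F u v) x y z" for x y z u v
    unfolding form4_swap(3)[OF assms(1), where a = x and b = y and c = "F u v" and d = z] 3 by simp
  show ?thesis
    unfolding alt5_def act4_def 2 3 4
    by (simp add: assms(2)[of b a] assms(2)[of c a] assms(2)[of d a] assms(2)[of f a]
      assms(2)[of c b] assms(2)[of d b] assms(2)[of f b] assms(2)[of d c] assms(2)[of f c] assms(2)[of f d])
qed

section \<open>Derivatives of the fundamental form in a chart\<close>

locale spin7_chart =
  fixes S :: "E set" and g :: loc_metric and \<Phi> :: loc_form
  assumes open_S: "open S"
    and bilinear_g: "\<And>x. x \<in> S \<Longrightarrow> bilinear (g x)"
    and sym_g: "\<And>x u v. x \<in> S \<Longrightarrow> g x u v = g x v u"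
    and pos_g: "\<And>x u. x \<in> S \<Longrightarrow> u \<noteq> 0 \<Longrightarrow> g x u u > 0"
    and smooth_g: "\<And>u v. smooth_on S (\<lambda>x. g x u v)"
    and frames: "\<And>x. x \<in> S \<Longrightarrow> \<exists>V e. open V \<and> x \<in> V \<and> V \<subseteq> S \<and> adapted_frame_on V g \<Phi> e"
begin

text \<open>The choice that \<open>hodge_star\<close> makes. Nothing is known about how it varies
  with \<open>x\<close>, so it serves pointwise algebra only; differentiation uses the smooth local
  frames.\<close>

definition basis :: "E \<Rightarrow> nat \<Rightarrow> E" where
  "basis x = (SOME e. adapted_basis (g x) (\<Phi> x) e)"

lemma adapted_basis_basis:
  assumes "x \<in> S"
  shows "adapted_basis (g x) (\<Phi> x) (basis x)"
proof -
  obtain e where "adapted_basis (g x) (\<Phi> x) (e x)"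
    using frames[OF assms] by (auto simp: adapted_frame_on_def)
  then show ?thesis unfolding basis_def by (rule someI[where P = "adapted_basis (g x) (\<Phi> x)"])
qed

lemma orthonormal_basis_basis: "x \<in> S \<Longrightarrow> orthonormal_basis (g x) (basis x)"
  using adapted_basis_basis by (simp add: adapted_basis_def)

lemma linear_g: "x \<in> S \<Longrightarrow> linear (g x u)" "x \<in> S \<Longrightarrow> linear (\<lambda>u. g x u v)"
  using bilinear_g by (auto simp: bilinear_def)

lemma g_has_derivative:
  "x \<in> S \<Longrightarrow> ((\<lambda>y. g y u v) has_derivative fd (\<lambda>y. g y u v) x) (at x)"
  by (rule smooth_on_has_derivative[OF smooth_g])

lemma fd_frame_coframe:
  assumes "adapted_frame_on V g \<Phi> e" "open V" "V \<subseteq> S" "x \<in> V" "i < 8"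
  shows "((\<lambda>y. g y (e y i) v) has_derivative
    (\<lambda>h. fd (\<lambda>y. g y (e x i) v) x h + g x (fd (\<lambda>y. e y i) x h) v)) (at x)"
proof -
  have "x \<in> S" using assms by auto
  have e: "((\<lambda>y. e y i) has_derivative fd (\<lambda>y. e y i) x) (at x)"
    using assms by (intro smooth_on_has_derivative[of V]) (auto simp: adapted_frame_on_def)
  have "((\<lambda>y. g y (e y i) v) has_derivative
    (\<lambda>h. fd (\<lambda>y. g y (e x i) v) x h + g x (fd (\<lambda>y. e y i) x h) v + g x (e x i) 0)) (at x)"
    by (rule has_derivative_bilinear_field[OF open_S \<open>x \<in> S\<close> bilinear_g, where G' = "\<lambda>h u v. fd (\<lambda>y. g y u v) x h"])
      (auto intro!: g_has_derivative \<open>x \<in> S\<close> e)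
  then show ?thesis by (simp add: bilinear_rzero[OF bilinear_g[OF \<open>x \<in> S\<close>]])
qed

text \<open>\<open>frame_deriv e x w v\<close> is the vector whose \<open>i\<close>-th component is the derivative of the coframe
  coefficient \<open>\<epsilon>\<^sub>i v\<close> in direction \<open>w\<close>, for constant \<open>v\<close>.\<close>
definition frame_deriv :: "(E \<Rightarrow> nat \<Rightarrow> E) \<Rightarrow> E \<Rightarrow> E \<Rightarrow> E \<Rightarrow> E" where
  "frame_deriv e x w v = (\<Sum>i<8. fd (\<lambda>y. g y (e y i) v) x w *\<^sub>R e x i)"

lemma frame_deriv_coords:
  assumes "adapted_frame_on V g \<Phi> e" "V \<subseteq> S" "x \<in> V" "k < 8"
  shows "g x (e x k) (frame_deriv e x w v) = fd (\<lambda>y. g y (e y k) v) x w"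
proof -
  have "x \<in> S" using assms by auto
  have on: "orthonormal_basis (g x) (e x)"
    using assms by (simp add: adapted_frame_on_def adapted_basis_def)
  have "g x (e x k) (frame_deriv e x w v) = (\<Sum>i<8. fd (\<lambda>y. g y (e y i) v) x w * g x (e x k) (e x i))"
    unfolding frame_deriv_def
    by (simp add: linear_sum[OF linear_g(1)[OF \<open>x \<in> S\<close>]] linear_cmul[OF linear_g(1)[OF \<open>x \<in> S\<close>]])
  also have "\<dots> = (\<Sum>i<8. if i = k then fd (\<lambda>y. g y (e y i) v) x w else 0)"
    using on assms(4) by (intro sum.cong) (auto simp: orthonormal_basis_def)
  finally show ?thesis using assms(4) by simp
qed

text \<open>In an adapted frame the form has constant coefficients, so all of its variation is that
  of the coframe, and this has the effect of adding \<open>frame_deriv\<close> to each argument. The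
  map \<tau> is the identity for the plain derivative and a transition map for the pullback.\<close>

lemma form4_has_derivative:
  fixes \<tau> :: "E \<Rightarrow> E"
  assumes fr: "adapted_frame_on V g \<Phi> e" "open V" "V \<subseteq> S"
    and \<tau>: "open U" "z \<in> U" "continuous_on U \<tau>" "\<tau> z \<in> V" "(\<tau> has_derivative \<tau>') (at z)"
    and d: "(a has_derivative a') (at z)" "(b has_derivative b') (at z)"
      "(c has_derivative c') (at z)" "(d has_derivative d') (at z)"
  shows "((\<lambda>z. form4 (\<Phi> (\<tau> z)) (a z) (b z) (c z) (d z)) has_derivative (\<lambda>h.
      form4 (\<Phi> (\<tau> z)) (frame_deriv e (\<tau> z) (\<tau>' h) (a z) + a' h) (b z) (c z) (d z) +
      form4 (\<Phi> (\<tau> z)) (a z) (frame_deriv e (\<tau> z) (\<tau>' h) (b z) + b' h) (c z) (d z) +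
      form4 (\<Phi> (\<tau> z)) (a z) (b z) (frame_deriv e (\<tau> z) (\<tau>' h) (c z) + c' h) (d z) +
      form4 (\<Phi> (\<tau> z)) (a z) (b z) (c z) (frame_deriv e (\<tau> z) (\<tau>' h) (d z) + d' h))) (at z)"
proof -
  let ?x = "\<tau> z"
  have xS: "?x \<in> S" using fr \<tau> by auto
  define W where "W = U \<inter> \<tau> -` V"
  have W: "open W" "z \<in> W" "\<And>y. y \<in> W \<Longrightarrow> \<tau> y \<in> V"
    using continuous_open_preimage[OF \<tau>(3,1) fr(2)] \<tau> by (auto simp: W_def)
  have ad: "adapted_basis (g y) (\<Phi> y) (e y)" if "y \<in> V" for y
    using fr that by (simp add: adapted_frame_on_def)
  have co: "((\<lambda>y. coords (g (\<tau> y)) (e (\<tau> y)) (s y) i) has_derivative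
      (\<lambda>h. coords (g ?x) (e ?x) (frame_deriv e ?x (\<tau>' h) (s z) + s' h) i)) (at z)"
    if s: "(s has_derivative s') (at z)" and i: "i < 8" for s s' i
  proof -
    have e: "((\<lambda>y. e (\<tau> y) i) has_derivative (\<lambda>h. fd (\<lambda>y. e y i) ?x (\<tau>' h))) (at z)"
      using fr \<tau> i by (intro has_derivative_compose[OF \<tau>(5)] smooth_on_has_derivative[of V])
        (auto simp: adapted_frame_on_def)
    have "((\<lambda>y. g (\<tau> y) (e (\<tau> y) i) (s y)) has_derivative
        (\<lambda>h. fd (\<lambda>y. g y (e ?x i) (s z)) ?x (\<tau>' h) + g ?x (fd (\<lambda>y. e y i) ?x (\<tau>' h)) (s z) +
          g ?x (e ?x i) (s' h))) (at z)"
      by (rule has_derivative_bilinear_field[OF W(1,2) _ _ e s,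
            where G = "\<lambda>y. g (\<tau> y)" and G' = "\<lambda>h u v. fd (\<lambda>y. g y u v) ?x (\<tau>' h)"])
        (use W fr in \<open>auto intro!: bilinear_g has_derivative_compose[OF \<tau>(5)] g_has_derivative xS\<close>)
    moreover have "g ?x (e ?x i) (frame_deriv e ?x (\<tau>' h) (s z)) =
        fd (\<lambda>y. g y (e ?x i) (s z)) ?x (\<tau>' h) + g ?x (fd (\<lambda>y. e y i) ?x (\<tau>' h)) (s z)" for h
      unfolding frame_deriv_coords[OF fr(1,3) \<tau>(4) i]
      using fd_eq[OF fd_frame_coframe[OF fr \<tau>(4) i]] by simp
    ultimately show ?thesis
      using i by (simp add: coords_def bilinear_radd[OF bilinear_g[OF xS]])
  qed
  have "((\<lambda>y. Q (coords (g (\<tau> y)) (e (\<tau> y)) (a y)) (coords (g (\<tau> y)) (e (\<tau> y)) (b y))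
        (coords (g (\<tau> y)) (e (\<tau> y)) (c y)) (coords (g (\<tau> y)) (e (\<tau> y)) (d y))) has_derivative (\<lambda>h.
      form4 (\<Phi> ?x) (frame_deriv e ?x (\<tau>' h) (a z) + a' h) (b z) (c z) (d z) +
      form4 (\<Phi> ?x) (a z) (frame_deriv e ?x (\<tau>' h) (b z) + b' h) (c z) (d z) +
      form4 (\<Phi> ?x) (a z) (b z) (frame_deriv e ?x (\<tau>' h) (c z) + c' h) (d z) +
      form4 (\<Phi> ?x) (a z) (b z) (c z) (frame_deriv e ?x (\<tau>' h) (d z) + d' h))) (at z)"
    unfolding form4_Q[OF ad[OF \<tau>(4)]]
    by (rule Q_has_derivative) (use d co in auto)
  then show ?thesis
    by (rule has_derivative_transform_within_open[OF _ W(1,2)]) (simp add: form4_Q[OF ad[OF W(3)]])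
qed

lemma fd_form4:
  assumes "adapted_frame_on V g \<Phi> e" "open V" "V \<subseteq> S" "x \<in> V"
  shows "((\<lambda>y. form4 (\<Phi> y) a b c d) has_derivative (\<lambda>h. act4 (\<Phi> x) (frame_deriv e x h) a b c d)) (at x)"
  using form4_has_derivative[OF assms(1-3,2,4) continuous_on_id assms(4) has_derivative_ident
      has_derivative_const has_derivative_const has_derivative_const has_derivative_const, of a b c d]
  by (simp add: act4_def)

lemma ext_deriv_4_eq:
  assumes "x \<in> S" "\<And>a b c d. ((\<lambda>y. form4 (\<Phi> y) a b c d) has_derivative (\<lambda>h. A h a b c d)) (at x)"
  shows "ext_deriv 4 \<Phi> x v = A (v 0) (v 1) (v 2) (v 3) (v 4) - A (v 1) (v 0) (v 2) (v 3) (v 4)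
    + A (v 2) (v 0) (v 1) (v 3) (v 4) - A (v 3) (v 0) (v 1) (v 2) (v 4) + A (v 4) (v 0) (v 1) (v 2) (v 3)"
proof -
  have s: "{..4} = {0,1,2,3,4::nat}" by auto
  have "((\<lambda>y. \<Phi> y w) has_derivative (\<lambda>h. A h (w 0) (w 1) (w 2) (w 3))) (at x)" for w
    by (rule has_derivative_transform_within_open[OF assms(2) open_S assms(1)])
      (rule adapted_form_form4[OF adapted_basis_basis, symmetric])
  note fd = fd_eq[OF this]
  show ?thesis
    unfolding ext_deriv_def fd s by (simp add: eval_nat_numeral)
qed

lemma ext_deriv_4_frame:
  assumes "adapted_frame_on V g \<Phi> e" "open V" "V \<subseteq> S" "x \<in> V"
  shows "ext_deriv 4 \<Phi> x v = alt5 (\<Phi> x) (frame_deriv e x) (v 0) (v 1) (v 2) (v 3) (v 4)"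
  unfolding alt5_def by (rule ext_deriv_4_eq) (use assms fd_form4[OF assms] in auto)

end

text \<open>Differentiating the pulled-back form also differentiates \<open>fd \<tau>\<close> in
  each argument. These second derivatives are symmetric, so \<open>alt5_symmetric\<close> removes
  them.\<close>

lemma ext_deriv_4_pullback:
  assumes c: "spin7_chart S g \<Phi>" and c': "spin7_chart S' g' \<Phi>'"
    and U: "open U" "U \<subseteq> S" "\<tau> ` U \<subseteq> S'" "smooth_on U \<tau>" "x \<in> U"
    and pull: "\<And>x v. x \<in> U \<Longrightarrow> \<Phi> x v = \<Phi>' (\<tau> x) (fd \<tau> x \<circ> v)"
    and inv: "\<And>u. \<sigma> (fd \<tau> x u) = u"
  shows "ext_deriv 4 \<Phi> x v = ext_deriv 4 \<Phi>' (\<tau> x) (fd \<tau> x \<circ> v)"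
proof -
  interpret c: spin7_chart S g \<Phi> by (rule c)
  interpret c': spin7_chart S' g' \<Phi>' by (rule c')
  let ?T = "fd \<tau> x" and ?y = "\<tau> x"
  have xS: "x \<in> S" and yS: "?y \<in> S'" using U by auto
  obtain V e where V: "open V" "?y \<in> V" "V \<subseteq> S'" "adapted_frame_on V g' \<Phi>' e"
    using c'.frames[OF yS] by blast
  have sm: "smooth_on U (\<lambda>x. fd \<tau> x u)" for u by (rule smooth_on_fd[OF U(4)])
  have "Ck_on 0 U \<tau>" using U(4) unfolding smooth_on_def by blast
  then have c\<tau>: "continuous_on U \<tau>" by simp
  define T2 where "T2 w u = fd (\<lambda>z. fd \<tau> z u) x w" for w u
  have T2: "T2 w u = T2 u w" for u w
    unfolding T2_def by (rule second_derivative_symmetric[OF U(1,5,4)])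
  \<comment> \<open>\<open>T2\<close> takes vectors at \<open>x\<close>, while \<open>alt5\<close>
    feeds \<open>F\<close> with vectors at \<open>\<tau> x\<close>; the left inverse \<sigma>
    carries them back.\<close>
  define F where "F w u = c'.frame_deriv e ?y w u + T2 (\<sigma> w) (\<sigma> u)" for w u
  have ad: "adapted_basis (g' ?y) (\<Phi>' ?y) (c'.basis ?y)" by (rule c'.adapted_basis_basis[OF yS])
  have d2: "((\<lambda>z. fd \<tau> z u) has_derivative (\<lambda>h. T2 h u)) (at x)" for u
    unfolding T2_def using smooth_on_has_derivative[OF sm U(5)] by simp
  have "((\<lambda>z. form4 (\<Phi> z) a b k d) has_derivative
      (\<lambda>h. act4 (\<Phi>' ?y) (F (?T h)) (?T a) (?T b) (?T k) (?T d))) (at x)" for a b k d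
  proof -
    have "((\<lambda>z. form4 (\<Phi>' (\<tau> z)) (fd \<tau> z a) (fd \<tau> z b) (fd \<tau> z k) (fd \<tau> z d)) has_derivative
      (\<lambda>h. act4 (\<Phi>' ?y) (F (?T h)) (?T a) (?T b) (?T k) (?T d))) (at x)"
      unfolding act4_def F_def inv
      by (rule c'.form4_has_derivative[OF V(4,1,3) U(1,5) c\<tau> V(2) smooth_on_has_derivative[OF U(4,5)] d2 d2 d2 d2])
    moreover have "form4 (\<Phi>' (\<tau> z)) (fd \<tau> z a) (fd \<tau> z b) (fd \<tau> z k) (fd \<tau> z d) = form4 (\<Phi> z) a b k d"
      if "z \<in> U" for z
    proof -
      have "\<tau> z \<in> S'" using that U by auto
      show ?thesis
        unfolding pull[OF that]
        using adapted_form_form4[OF c'.adapted_basis_basis[OF \<open>\<tau> z \<in> S'\<close>],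
          of "fd \<tau> z \<circ> (\<lambda>n. [a, b, k, d] ! n)"] by simp
    qed
    ultimately show ?thesis
      by (rule has_derivative_transform_within_open[OF _ U(1,5)])
  qed
  then have "ext_deriv 4 \<Phi> x v = alt5 (\<Phi>' ?y) F (?T (v 0)) (?T (v 1)) (?T (v 2)) (?T (v 3)) (?T (v 4))"
    unfolding alt5_def by (rule c.ext_deriv_4_eq[OF xS])
  also have "\<dots> = alt5 (\<Phi>' ?y) (c'.frame_deriv e ?y) (?T (v 0)) (?T (v 1)) (?T (v 2)) (?T (v 3)) (?T (v 4))"
    unfolding F_def alt5_add[OF ad c'.bilinear_g[OF yS]]
    by (simp add: alt5_symmetric[OF ad] T2)
  also have "\<dots> = ext_deriv 4 \<Phi>' ?y (?T \<circ> v)"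
    unfolding c'.ext_deriv_4_frame[OF V(4,1,3,2)] by simp
  finally show ?thesis .
qed

section \<open>The Lee form in a chart\<close>

text \<open>Whatever the argument, the star is a combination of the 1-forms dual to the chosen
  basis. This alone makes the Lee form linear.\<close>

lemma hodge_star_7:
  "\<exists>c q. \<forall>v. hodge_star g \<phi> 7 \<beta> v =
    (\<Sum>I | I \<subseteq> {..<8::nat} \<and> card I = 7. c I * g ((SOME e. adapted_basis g \<phi> e) (q I)) (v 0))"
proof -
  let ?e = "SOME e. adapted_basis g \<phi> e"
  have "hodge_star g \<phi> 7 \<beta> v = (\<Sum>I | I \<subseteq> {..<8} \<and> card I = 7.
      (shuffle_sign I ({..<8} - I) * \<beta> (select ?e I)) * g (?e (hd (sorted_list_of_set ({..<8} - I)))) (v 0))" for v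
    unfolding hodge_star_def Let_def
  proof (intro sum.cong refl)
    fix I :: "nat set" assume "I \<in> {I. I \<subseteq> {..<8} \<and> card I = 7}"
    then have "length (sorted_list_of_set ({..<8} - I)) = 1"
      by (auto simp: card_Diff_subset finite_subset)
    then obtain p where p: "sorted_list_of_set ({..<8} - I) = [p]"
      by (auto simp: length_Suc_conv simp del: length_sorted_list_of_set)
    show "shuffle_sign I ({..<8} - I) * \<beta> (select ?e I) *
        coframe_wedge (coframe g ?e) (sorted_list_of_set ({..<8} - I)) v =
      shuffle_sign I ({..<8} - I) * \<beta> (select ?e I) * g (?e (hd (sorted_list_of_set ({..<8} - I)))) (v 0)"
      by (simp add: p coframe_wedge_minor minor_1 coframe_def)
  qed
  then show ?thesis by (intro exI allI)
qed

definition wedge14 :: "(E \<Rightarrow> real) \<Rightarrow> form \<Rightarrow> E \<Rightarrow> E \<Rightarrow> E \<Rightarrow> E \<Rightarrow> E \<Rightarrow> real" where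
  "wedge14 t \<phi> a b c d f = t a * form4 \<phi> b c d f - t b * form4 \<phi> a c d f + t c * form4 \<phi> a b d f
     - t d * form4 \<phi> a b c f + t f * form4 \<phi> a b c d"

text \<open>The index quadruples 0123 and 4567 are complementary terms of the model form with sign
  +. Adding an index from the other half gives a 5-vector on which every other term vanishes, as no
  term has exactly three indices in one half.\<close>

lemma wedge14_basis:
  assumes "adapted_basis g \<phi> e"
  shows "i < 4 \<Longrightarrow> wedge14 t \<phi> (e i) (e 4) (e 5) (e 6) (e 7) = t (e i)"
    and "4 \<le> i \<Longrightarrow> i < 8 \<Longrightarrow> wedge14 t \<phi> (e 0) (e 1) (e 2) (e 3) (e i) = t (e i)"
proof -
  have on: "orthonormal_basis g e" using assms by (simp add: adapted_basis_def)
  note eval = wedge14_def form4_Q[OF assms] coords_basis[OF on] Q_table_Suc kron_def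
  show "wedge14 t \<phi> (e i) (e 4) (e 5) (e 6) (e 7) = t (e i)" if "i < 4"
  proof -
    have "i = 0 \<or> i = 1 \<or> i = 2 \<or> i = 3" using that by linarith
    then show ?thesis by (elim disjE) (simp_all add: eval)
  qed
  show "wedge14 t \<phi> (e 0) (e 1) (e 2) (e 3) (e i) = t (e i)" if "4 \<le> i" "i < 8"
  proof -
    have "i = 4 \<or> i = 5 \<or> i = 6 \<or> i = 7" using that by linarith
    then show ?thesis by (elim disjE) (simp_all add: eval)
  qed
qed

text \<open>Wedging 1-forms with the fundamental form is injective, so the Lee form is determined by
  the exterior derivative.\<close>

lemma wedge14_inject:
  assumes "adapted_basis g \<phi> e" "bilinear g" "linear t" "linear t'"
    and "\<And>a b c d f. wedge14 t \<phi> a b c d f = wedge14 t' \<phi> a b c d f"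
  shows "t v = t' v"
proof -
  have on: "orthonormal_basis g e" using assms by (simp add: adapted_basis_def)
  have "t (e i) = t' (e i)" if "i < 8" for i
    using wedge14_basis[OF assms(1), of i t] wedge14_basis[OF assms(1), of i t'] assms(5) that
    by (cases "i < 4") auto
  then have "t (\<Sum>i<8. g (e i) v *\<^sub>R e i) = t' (\<Sum>i<8. g (e i) v *\<^sub>R e i)"
    by (simp add: linear_sum[OF assms(3)] linear_sum[OF assms(4)] linear_cmul[OF assms(3)] linear_cmul[OF assms(4)])
  then show ?thesis using orthonormal_basis_expansion[OF assms(2) on, of v] by simp
qed

lemma smooth_on_diff:
  fixes f g :: "'a::euclidean_space \<Rightarrow> real"
  shows "open S \<Longrightarrow> smooth_on S f \<Longrightarrow> smooth_on S g \<Longrightarrow> smooth_on S (\<lambda>x. f x - g x)"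
  using smooth_on_add[OF _ _ smooth_on_minus, of S f g] by simp

lemma smooth_on_Q:
  assumes "open V" "\<And>i. i < 8 \<Longrightarrow> smooth_on V (\<lambda>x. a x i)" "\<And>i. i < 8 \<Longrightarrow> smooth_on V (\<lambda>x. b x i)"
    "\<And>i. i < 8 \<Longrightarrow> smooth_on V (\<lambda>x. c x i)" "\<And>i. i < 8 \<Longrightarrow> smooth_on V (\<lambda>x. d x i)"
  shows "smooth_on V (\<lambda>x. Q (a x) (b x) (c x) (d x))"
proof -
  have 4: "smooth_on V (\<lambda>x. minor [p,q,r,s] (\<lambda>i m. ([a x, b x, c x, d x] ! m) i))"
    if "p < 8" "q < 8" "r < 8" "s < 8" for p q r s
    unfolding minor_4
    by (simp, intro smooth_on_add smooth_on_diff smooth_on_mult assms that)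
  show ?thesis
    unfolding Q_def model_poly_def
    by (intro smooth_on_add smooth_on_diff 4 assms(1)) simp_all
qed

lemma Ck_on_local:
  assumes "\<And>x. x \<in> S \<Longrightarrow> \<exists>V. open V \<and> x \<in> V \<and> Ck_on k V f"
  shows "Ck_on k S f"
  using assms
proof (induction k arbitrary: f)
  case 0
  then show ?case
    by (force intro!: continuous_at_imp_continuous_on simp: continuous_on_eq_continuous_at)
next
  case (Suc k)
  show ?case
    unfolding Ck_on.simps
  proof (intro conjI ballI allI)
    show "f differentiable (at x)" if "x \<in> S" for x
      using Suc.prems[OF that] by auto
    show "Ck_on k S (\<lambda>x. fd f x v)" for v
      using Suc.prems by (intro Suc.IH) fastforce
  qed
qed

context spin7_chart
begin

definition lee :: "E \<Rightarrow> E \<Rightarrow> real" where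
  "lee x v = lee_form g \<Phi> x (\<lambda>_. v)"

lemma lee_form_eq:
  shows "lee_form g \<Phi> x v = lee x (v 0)" and lee_linear: "x \<in> S \<Longrightarrow> linear (lee x)"
proof -
  obtain c q where *: "\<And>v. hodge_star (g x) (\<Phi> x) 7 (wedge 3 4 (codiff g \<Phi> x) (\<Phi> x)) v =
    (\<Sum>I | I \<subseteq> {..<8::nat} \<and> card I = 7. c I * g x ((SOME e. adapted_basis (g x) (\<Phi> x) e) (q I)) (v 0))"
    using hodge_star_7[of "g x" "\<Phi> x" "wedge 3 4 (codiff g \<Phi> x) (\<Phi> x)"] by auto
  show "lee_form g \<Phi> x v = lee x (v 0)"
    unfolding lee_def lee_form_def * by simp
  show "linear (lee x)" if "x \<in> S"
    unfolding lee_def[abs_def] lee_form_def *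
    by (rule linearI) (simp_all add: linear_add[OF linear_g(1)[OF that]] linear_cmul[OF linear_g(1)[OF that]]
      sum.distrib sum_distrib_left algebra_simps)
qed

lemma wedge_lee:
  assumes "x \<in> S"
  shows "wedge 1 4 (lee_form g \<Phi> x) (\<Phi> x) v = wedge14 (lee x) (\<Phi> x) (v 0) (v 1) (v 2) (v 3) (v 4)"
proof -
  note f4 = adapted_form_form4[OF adapted_basis_basis[OF assms]]
  have "\<Phi> x (select v {1,2,3,4}) = form4 (\<Phi> x) (v 1) (v 2) (v 3) (v 4)"
    "\<Phi> x (select v {0,2,3,4}) = form4 (\<Phi> x) (v 0) (v 2) (v 3) (v 4)"
    "\<Phi> x (select v {0,1,3,4}) = form4 (\<Phi> x) (v 0) (v 1) (v 3) (v 4)"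
    "\<Phi> x (select v {0,1,2,4}) = form4 (\<Phi> x) (v 0) (v 1) (v 2) (v 4)"
    "\<Phi> x (select v {0,1,2,3}) = form4 (\<Phi> x) (v 0) (v 1) (v 2) (v 3)"
    by (subst f4, simp add: select_def)+
  then show ?thesis
    unfolding wedge_1_4 wedge14_def lee_form_eq by (simp add: select_def)
qed

definition X :: "E \<Rightarrow> E" where
  "X x = (\<Sum>i<8. lee x (basis x i) *\<^sub>R basis x i)"

lemma g_lee_sum:
  assumes "x \<in> S" "orthonormal_basis (g x) e"
  shows "g x (\<Sum>i<8. lee x (e i) *\<^sub>R e i) v = lee x v"
proof -
  have "lee x v = lee x (\<Sum>i<8. g x (e i) v *\<^sub>R e i)"
    using orthonormal_basis_expansion[OF bilinear_g[OF assms(1)] assms(2)] by simp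
  then show ?thesis
    by (simp add: linear_sum[OF linear_g(2)[OF assms(1)]] linear_cmul[OF linear_g(2)[OF assms(1)]]
      linear_sum[OF lee_linear[OF assms(1)]] linear_cmul[OF lee_linear[OF assms(1)]] mult.commute)
qed

lemma g_X: "x \<in> S \<Longrightarrow> g x (X x) v = lee x v"
  unfolding X_def by (rule g_lee_sum[OF _ orthonormal_basis_basis])

lemma g_nondegenerate:
  assumes "x \<in> S" "\<And>v. g x u v = g x w v"
  shows "u = w"
proof (rule ccontr)
  assume "u \<noteq> w"
  then have "g x (u - w) (u - w) > 0" using assms(1) by (intro pos_g) auto
  then show False using assms by (simp add: bilinear_lsub[OF bilinear_g[OF assms(1)]])
qed

lemma X_frame:
  assumes "x \<in> S" "orthonormal_basis (g x) e"
  shows "X x = (\<Sum>i<8. lee x (e i) *\<^sub>R e i)"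
  by (rule g_nondegenerate[OF assms(1)]) (simp add: g_X g_lee_sum assms)

text \<open>Differentiate \<open>g (e k) (e q)\<close>, which is constant: the coframe moves
  opposite to the frame. The right-hand side is visibly smooth in \<open>x\<close>.\<close>

lemma frame_deriv_frame:
  assumes fr: "adapted_frame_on V g \<Phi> e" "open V" "V \<subseteq> S" "x \<in> V" and q: "q < 8"
  shows "frame_deriv e x w (e x q) = - fd (\<lambda>y. e y q) x w"
proof -
  have xS: "x \<in> S" using fr by auto
  have on: "orthonormal_basis (g y) (e y)" if "y \<in> V" for y
    using fr that by (simp add: adapted_frame_on_def adapted_basis_def)
  have e: "((\<lambda>y. e y i) has_derivative fd (\<lambda>y. e y i) x) (at x)" if "i < 8" for i
    using fr that by (intro smooth_on_has_derivative[of V]) (auto simp: adapted_frame_on_def)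
  have "g x (e x k) (frame_deriv e x w (e x q) + fd (\<lambda>y. e y q) x w) = 0" if k: "k < 8" for k
  proof -
    have "((\<lambda>y. g y (e y k) (e y q)) has_derivative (\<lambda>h. fd (\<lambda>y. g y (e x k) (e x q)) x h +
        g x (fd (\<lambda>y. e y k) x h) (e x q) + g x (e x k) (fd (\<lambda>y. e y q) x h))) (at x)"
      by (rule has_derivative_bilinear_field[OF open_S xS bilinear_g, where G' = "\<lambda>h u v. fd (\<lambda>y. g y u v) x h"])
        (auto intro!: g_has_derivative xS e k q)
    moreover have "((\<lambda>y. g y (e y k) (e y q)) has_derivative (\<lambda>h. 0)) (at x)"
    proof (rule has_derivative_transform_within_open[OF has_derivative_const fr(2,4)])
      show "(if k = q then 1 else 0) = g y (e y k) (e y q)" if "y \<in> V" for y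
        using on[OF that] k q by (simp add: orthonormal_basis_def)
    qed
    ultimately have "(\<lambda>h. fd (\<lambda>y. g y (e x k) (e x q)) x h +
        g x (fd (\<lambda>y. e y k) x h) (e x q) + g x (e x k) (fd (\<lambda>y. e y q) x h)) = (\<lambda>h. 0)"
      by (rule has_derivative_unique)
    then show ?thesis
      unfolding bilinear_radd[OF bilinear_g[OF xS]] frame_deriv_coords[OF fr(1,3,4) k]
        fd_eq[OF fd_frame_coframe[OF fr k]] by (simp add: fun_eq_iff)
  qed
  then have "frame_deriv e x w (e x q) + fd (\<lambda>y. e y q) x w = 0"
    using orthonormal_basis_expansion[OF bilinear_g[OF xS] on[OF fr(4)], of "frame_deriv e x w (e x q) + fd (\<lambda>y. e y q) x w"]
    by simp
  then show ?thesis by (simp add: eq_neg_iff_add_eq_0)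
qed

lemma smooth_on_form4:
  assumes fr: "adapted_frame_on V g \<Phi> e" "open V" "V \<subseteq> S"
    and "smooth_on V a" "smooth_on V b" "smooth_on V c" "smooth_on V d"
  shows "smooth_on V (\<lambda>x. form4 (\<Phi> x) (a x) (b x) (c x) (d x))"
proof (rule smooth_on_cong[OF fr(2)])
  have "smooth_on V (\<lambda>x. coords (g x) (e x) (z x) i)" if "smooth_on V z" "i < 8" for z i
  proof -
    have e: "smooth_on V (\<lambda>x. e x i)" using fr that by (simp add: adapted_frame_on_def)
    have "smooth_on V (\<lambda>x. g x (e x i) (z x))"
      by (rule smooth_on_bilinear_field[OF fr(2) bilinear_g smooth_on_subset[OF smooth_g fr(3)] e that(1)])
        (use fr(3) in auto)
    then show ?thesis using that(2) by (simp add: coords_def)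
  qed
  then show "smooth_on V (\<lambda>x. Q (coords (g x) (e x) (a x)) (coords (g x) (e x) (b x))
      (coords (g x) (e x) (c x)) (coords (g x) (e x) (d x)))"
    using assms by (intro smooth_on_Q) auto
  show "Q (coords (g x) (e x) (a x)) (coords (g x) (e x) (b x)) (coords (g x) (e x) (c x)) (coords (g x) (e x) (d x)) =
      form4 (\<Phi> x) (a x) (b x) (c x) (d x)" if "x \<in> V" for x
    using fr(1) that by (intro form4_Q[symmetric]) (simp add: adapted_frame_on_def)
qed

end

section \<open>Smoothness and invariance of the Lee form\<close>

locale lcp_chart = spin7_chart +
  assumes lcp: "\<And>x. x \<in> S \<Longrightarrow> ext_deriv 4 \<Phi> x = wedge 1 4 (lee_form g \<Phi> x) (\<Phi> x)"
begin

lemma ext_deriv_lee: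
  "x \<in> S \<Longrightarrow> ext_deriv 4 \<Phi> x v = wedge14 (lee x) (\<Phi> x) (v 0) (v 1) (v 2) (v 3) (v 4)"
  by (simp only: lcp wedge_lee)

text \<open>By \<open>wedge14_basis\<close>, each component of the Lee form is one component of the
  exterior derivative in a smooth frame.\<close>

lemma smooth_on_lee_frame:
  assumes fr: "adapted_frame_on V g \<Phi> e" "open V" "V \<subseteq> S" and "i < 8"
  shows "smooth_on V (\<lambda>x. lee x (e x i))"
proof -
  have se: "smooth_on V (\<lambda>x. e x p)" if "p < 8" for p
    using fr that by (simp add: adapted_frame_on_def)
  have fd: "smooth_on V (\<lambda>x. frame_deriv e x (e x p) (e x q))" if "p < 8" "q < 8" for p q
  proof (rule smooth_on_cong[OF fr(2)])
    show "smooth_on V (\<lambda>x. - (\<Sum>b\<in>Basis. (e x p \<bullet> b) *\<^sub>R fd (\<lambda>y. e y q) x b))"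
      by (intro smooth_on_minus smooth_on_sum smooth_on_scaleR smooth_on_inner smooth_on_const smooth_on_fd se that fr(2))
    show "- (\<Sum>b\<in>Basis. (e x p \<bullet> b) *\<^sub>R fd (\<lambda>y. e y q) x b) = frame_deriv e x (e x p) (e x q)" if "x \<in> V" for x
      unfolding frame_deriv_frame[OF fr that \<open>q < 8\<close>]
      using linear_Basis_expansion[OF fd_linear[OF smooth_on_differentiable[OF se[OF \<open>q < 8\<close>] that]], of "e x p"]
      by simp
  qed
  have alt: "smooth_on V (\<lambda>x. alt5 (\<Phi> x) (frame_deriv e x) (e x a) (e x b) (e x c) (e x d) (e x k))"
    if "a < 8" "b < 8" "c < 8" "d < 8" "k < 8" for a b c d k
    unfolding alt5_def act4_def
    by (intro smooth_on_add smooth_on_diff smooth_on_form4[OF fr] fd se that fr(2))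
  have eq: "alt5 (\<Phi> x) (frame_deriv e x) (e x a) (e x b) (e x c) (e x d) (e x k) =
      wedge14 (lee x) (\<Phi> x) (e x a) (e x b) (e x c) (e x d) (e x k)" if "x \<in> V" for x a b c d k
    using ext_deriv_lee[of x "\<lambda>n. [e x a, e x b, e x c, e x d, e x k] ! n"]
      ext_deriv_4_frame[OF fr that, of "\<lambda>n. [e x a, e x b, e x c, e x d, e x k] ! n"] that fr(3) by auto
  have ad: "adapted_basis (g x) (\<Phi> x) (e x)" if "x \<in> V" for x
    using fr that by (simp add: adapted_frame_on_def)
  show ?thesis
  proof (cases "i < 4")
    case True
    have "smooth_on V (\<lambda>x. alt5 (\<Phi> x) (frame_deriv e x) (e x i) (e x 4) (e x 5) (e x 6) (e x 7))"
      using assms by (intro alt) auto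
    then show ?thesis
      by (rule smooth_on_cong[OF fr(2), rotated]) (simp add: eq wedge14_basis(1)[OF ad True])
  next
    case False
    have "smooth_on V (\<lambda>x. alt5 (\<Phi> x) (frame_deriv e x) (e x 0) (e x 1) (e x 2) (e x 3) (e x i))"
      using assms by (intro alt) auto
    then show ?thesis
      by (rule smooth_on_cong[OF fr(2), rotated])
        (use False assms(4) wedge14_basis(2)[OF ad, of _ i] in \<open>simp add: eq\<close>)
  qed
qed

lemma smooth_on_X: "smooth_on S X"
proof -
  have "\<exists>V. open V \<and> x \<in> V \<and> smooth_on V X" if xS: "x \<in> S" for x
  proof -
    obtain V e where V: "open V" "x \<in> V" "V \<subseteq> S" "adapted_frame_on V g \<Phi> e"
      using frames[OF xS] by blast
    have "smooth_on V (\<lambda>x. \<Sum>i<8. lee x (e x i) *\<^sub>R e x i)"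
      using V(4) by (intro smooth_on_sum smooth_on_scaleR smooth_on_lee_frame[OF V(4,1,3)] V(1))
        (auto simp: adapted_frame_on_def)
    then have "smooth_on V X"
    proof (rule smooth_on_cong[OF V(1), rotated])
      fix y assume "y \<in> V"
      then show "(\<Sum>i<8. lee y (e y i) *\<^sub>R e y i) = X y"
        using V by (intro X_frame[symmetric]) (auto simp: adapted_frame_on_def adapted_basis_def)
    qed
    then show ?thesis using V by blast
  qed
  then show ?thesis
    unfolding smooth_on_def by (intro allI Ck_on_local) blast
qed

end

text \<open>The exterior derivative commutes with the pullback, and by \<open>wedge14_inject\<close>
  the Lee form can be cancelled out of its wedge product with the fundamental form.\<close>

lemma lee_pullback:
  assumes c: "lcp_chart S g \<Phi>" and c': "lcp_chart S' g' \<Phi>'"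
    and U: "open U" "U \<subseteq> S" "\<tau> ` U \<subseteq> S'" "smooth_on U \<tau>" "x \<in> U"
    and pull: "\<And>x v. x \<in> U \<Longrightarrow> \<Phi> x v = \<Phi>' (\<tau> x) (fd \<tau> x \<circ> v)"
    and inv: "\<And>u. \<sigma> (fd \<tau> x u) = u"
  shows "spin7_chart.lee g \<Phi> x u = spin7_chart.lee g' \<Phi>' (\<tau> x) (fd \<tau> x u)"
proof -
  interpret c: lcp_chart S g \<Phi> by (rule c)
  interpret c': lcp_chart S' g' \<Phi>' by (rule c')
  let ?T = "fd \<tau> x" and ?y = "\<tau> x"
  have xS: "x \<in> S" and yS: "?y \<in> S'" using U by auto
  have linT: "linear ?T" using smooth_on_differentiable[OF U(4,5)] by (rule fd_linear)
  have f4: "form4 (\<Phi>' ?y) (?T a) (?T b) (?T k) (?T d) = form4 (\<Phi> x) a b k d" for a b k d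
    unfolding pull[OF U(5)]
    using adapted_form_form4[OF c'.adapted_basis_basis[OF yS], of "?T \<circ> (\<lambda>n. [a, b, k, d] ! n)"] by simp
  have "wedge14 (c.lee x) (\<Phi> x) a b k d f = wedge14 (\<lambda>u. c'.lee ?y (?T u)) (\<Phi> x) a b k d f" for a b k d f
  proof -
    let ?v = "\<lambda>n. [a, b, k, d, f] ! n"
    have "wedge14 (c.lee x) (\<Phi> x) a b k d f = ext_deriv 4 \<Phi> x ?v"
      using c.ext_deriv_lee[OF xS, of ?v] by simp
    also have "\<dots> = ext_deriv 4 \<Phi>' ?y (?T \<circ> ?v)"
      by (rule ext_deriv_4_pullback[OF c.spin7_chart_axioms c'.spin7_chart_axioms U pull inv])
    also have "\<dots> = wedge14 (c'.lee ?y) (\<Phi>' ?y) (?T a) (?T b) (?T k) (?T d) (?T f)"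
      using c'.ext_deriv_lee[OF yS, of "?T \<circ> ?v"] by simp
    also have "\<dots> = wedge14 (\<lambda>u. c'.lee ?y (?T u)) (\<Phi> x) a b k d f"
      by (simp add: wedge14_def f4)
    finally show ?thesis .
  qed
  then show ?thesis
    by (rule wedge14_inject[OF c.adapted_basis_basis[OF xS] c.bilinear_g[OF xS] c.lee_linear[OF xS]
          linear_compose[OF linT c'.lee_linear[OF yS], unfolded o_def]])
qed

section \<open>Second order nearly parallel structures in a chart\<close>

lemma sum_Basis_axis:
  fixes h :: "real^'n \<Rightarrow> 'b::comm_monoid_add"
  shows "(\<Sum>b\<in>Basis. h b) = (\<Sum>i\<in>UNIV. h (axis i 1))"
proof (rule sum.reindex_bij_betw[symmetric])
  show "bij_betw (\<lambda>i::'n. axis i (1::real)) UNIV Basis"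
    by (auto simp: bij_betw_def Basis_vec_def inj_on_def axis_eq_axis)
qed

lemma bilinear_eq_orthonormal_basis:
  fixes h k :: "E \<Rightarrow> E \<Rightarrow> real"
  assumes "bilinear g" "orthonormal_basis g e" "bilinear h" "bilinear k"
    and "\<And>i j. i < 8 \<Longrightarrow> j < 8 \<Longrightarrow> h (e i) (e j) = k (e i) (e j)"
  shows "h u v = k u v"
proof -
  have exp: "b u v = (\<Sum>i<8. \<Sum>j<8. g (e i) u * (g (e j) v * b (e i) (e j)))"
    if "bilinear b" for b :: "E \<Rightarrow> E \<Rightarrow> real"
  proof -
    have lin: "linear (b u)" "linear (\<lambda>u. b u v)" for u v using that by (auto simp: bilinear_def)
    have "b u v = b (\<Sum>i<8. g (e i) u *\<^sub>R e i) (\<Sum>j<8. g (e j) v *\<^sub>R e j)"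
      using orthonormal_basis_expansion[OF assms(1,2)] by simp
    also have "\<dots> = (\<Sum>i<8. g (e i) u * b (e i) (\<Sum>j<8. g (e j) v *\<^sub>R e j))"
      by (simp add: linear_sum[OF lin(2)] linear_cmul[OF lin(2)])
    finally show ?thesis by (simp add: linear_sum[OF lin(1)] linear_cmul[OF lin(1)] sum_distrib_left)
  qed
  show ?thesis unfolding exp[OF assms(3)] exp[OF assms(4)] using assms(5) by simp
qed

lemma (in spin7_point) act_act4: "act A u v w z = act4 \<phi> A u v w z"
proof -
  note sw = form4_swap[OF adapted_e]
  have 1: "form4 \<phi> u (A v) w z = - form4 \<phi> (A v) u w z" by (rule sw)
  have "form4 \<phi> u v (A w) z = - form4 \<phi> u (A w) v z" by (rule sw)
  then have 2: "form4 \<phi> u v (A w) z = form4 \<phi> (A w) u v z" using sw(1)[of u "A w" v z] by simp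
  have "form4 \<phi> u v w (A z) = - form4 \<phi> u v (A z) w" by (rule sw)
  moreover have "form4 \<phi> u v (A z) w = - form4 \<phi> u (A z) v w" by (rule sw)
  ultimately have 3: "form4 \<phi> u v w (A z) = - form4 \<phi> (A z) u v w" using sw(1)[of u "A z" v w] by simp
  show ?thesis unfolding act_def act4_def unfolding 1 2 3 unfolding form4_Q[OF adapted_e] by simp
qed

locale nearly_parallel_chart = lcp_chart +
  fixes \<Gamma> D :: loc_connection
  assumes LC: "levi_civita_on S g \<Gamma>" and spin7: "spin7_component_on S g \<Phi> \<Gamma> D"
    and parallel: "\<And>x u v w. x \<in> S \<Longrightarrow>
      covariant_deriv_tensor2 D (r_tensor g (\<lambda>x u v. D x u v - \<Gamma> x u v)) x u v w = 0"
begin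

text \<open>The negative of the intrinsic torsion.\<close>
definition \<eta> :: "E \<Rightarrow> E \<Rightarrow> E \<Rightarrow> E" where
  "\<eta> x w v = \<Gamma> x w v - D x w v"

lemma bilinear_\<Gamma>: "x \<in> S \<Longrightarrow> bilinear (\<Gamma> x)" and sym_\<Gamma>: "x \<in> S \<Longrightarrow> \<Gamma> x u v = \<Gamma> x v u"
  and metric_\<Gamma>: "x \<in> S \<Longrightarrow> fd (\<lambda>y. g y v w) x u = g x (\<Gamma> x u v) w + g x v (\<Gamma> x u w)"
proof -
  assume "x \<in> S"
  then show "bilinear (\<Gamma> x)" "\<Gamma> x u v = \<Gamma> x v u" using LC by (auto simp: levi_civita_on_def)
  from \<open>x \<in> S\<close> have "covariant_deriv_tensor2 \<Gamma> g x u v w = 0" using LC unfolding levi_civita_on_def by blast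
  then show "fd (\<lambda>y. g y v w) x u = g x (\<Gamma> x u v) w + g x v (\<Gamma> x u w)"
    by (simp add: covariant_deriv_tensor2_def)
qed

lemma bilinear_D: "x \<in> S \<Longrightarrow> bilinear (D x)"
  using spin7 by (simp add: spin7_component_on_def)

lemma linear_\<Gamma>: "x \<in> S \<Longrightarrow> linear (\<Gamma> x u)" "x \<in> S \<Longrightarrow> linear (\<lambda>u. \<Gamma> x u v)"
  using bilinear_\<Gamma> by (auto simp: bilinear_def)

lemma linear_D: "x \<in> S \<Longrightarrow> linear (D x u)" "x \<in> S \<Longrightarrow> linear (\<lambda>u. D x u v)"
  using bilinear_D by (auto simp: bilinear_def)

lemma linear_\<eta>: "x \<in> S \<Longrightarrow> linear (\<eta> x u)" "x \<in> S \<Longrightarrow> linear (\<lambda>u. \<eta> x u v)"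
  unfolding \<eta>_def by (intro linear_compose_sub linear_\<Gamma> linear_D; assumption)+

lemma connection_form_diff:
  assumes "adapted_frame_on V g \<Phi> e" "V \<subseteq> S" "x \<in> V"
  shows "connection_form g \<Gamma> e x w v - connection_form g D e x w v = \<eta> x w v"
proof -
  have xS: "x \<in> S" using assms by auto
  have on: "orthonormal_basis (g x) (e x)" using assms by (simp add: adapted_frame_on_def adapted_basis_def)
  have "connection_form g \<Gamma> e x w v - connection_form g D e x w v = (\<Sum>j<8. g x (e x j) v *\<^sub>R \<eta> x w (e x j))"
    unfolding connection_form_def coframe_def covariant_deriv_def \<eta>_def sum_subtractf[symmetric]
    by (simp add: algebra_simps)
  also have "\<dots> = \<eta> x w (\<Sum>j<8. g x (e x j) v *\<^sub>R e x j)"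
    by (simp add: linear_sum[OF linear_\<eta>(1)[OF xS]] linear_cmul[OF linear_\<eta>(1)[OF xS]])
  finally show ?thesis using orthonormal_basis_expansion[OF bilinear_g[OF xS] on] by simp
qed

lemma spin7_point_basis: "x \<in> S \<Longrightarrow> spin7_point (g x) (\<Phi> x) (basis x)"
  by unfold_locales ((auto simp: bilinear_g sym_g adapted_basis_basis)[3], rule basis_def)

lemma frame_components:
  assumes "adapted_frame_on V g \<Phi> e" "open V" "V \<subseteq> S" "x \<in> V"
  shows "two_form (g x) (connection_form g D e x w) \<in> Lambda2_21 (g x) (\<Phi> x)"
    and "two_form (g x) (\<eta> x w) \<in> Lambda2_7 (g x) (\<Phi> x)"
proof -
  have "two_form (g x) (connection_form g D e x w) \<in> Lambda2_21 (g x) (\<Phi> x) \<and>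
      two_form (g x) (\<lambda>v. connection_form g \<Gamma> e x w v - connection_form g D e x w v) \<in> Lambda2_7 (g x) (\<Phi> x)"
    using spin7 assms unfolding spin7_component_on_def by blast
  then show "two_form (g x) (connection_form g D e x w) \<in> Lambda2_21 (g x) (\<Phi> x)"
    "two_form (g x) (\<eta> x w) \<in> Lambda2_7 (g x) (\<Phi> x)"
    unfolding connection_form_diff[OF assms(1,3,4)] by auto
qed

lemma \<eta>_Lambda2_7: "x \<in> S \<Longrightarrow> two_form (g x) (\<eta> x w) \<in> Lambda2_7 (g x) (\<Phi> x)"
  using frames[of x] frame_components(2) by blast

lemma \<eta>_skew: "x \<in> S \<Longrightarrow> g x (\<eta> x w u) v = - g x (\<eta> x w v) u"
  using spin7_point.Lambda2_7_skew[OF spin7_point_basis \<eta>_Lambda2_7] by blast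

lemma metric_D:
  assumes "x \<in> S"
  shows "fd (\<lambda>y. g y v w) x u = g x (D x u v) w + g x v (D x u w)"
proof -
  have "\<Gamma> x u z = D x u z + \<eta> x u z" for z by (simp add: \<eta>_def)
  then show ?thesis
    unfolding metric_\<Gamma>[OF assms]
    using \<eta>_skew[OF assms, of u v w]
    by (simp add: bilinear_radd[OF bilinear_g[OF assms]] bilinear_ladd[OF bilinear_g[OF assms]] sym_g[OF assms, of v "\<eta> x u w"])
qed

text \<open>The connection form of \<Gamma> is its spin(7)-part plus \<eta>. By metric
  compatibility, adding the derivative of the coframe turns it back into the coefficients \<Gamma>
  of the chart.\<close>

lemma frame_deriv_connection:
  assumes fr: "adapted_frame_on V g \<Phi> e" "open V" "V \<subseteq> S" "x \<in> V"
  shows "frame_deriv e x w v + (connection_form g D e x w v + \<eta> x w v) = \<Gamma> x w v"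
proof -
  have xS: "x \<in> S" using fr by auto
  note bil = bilinear_g[OF xS]
  have on: "orthonormal_basis (g x) (e x)" using fr by (simp add: adapted_frame_on_def adapted_basis_def)
  let ?c = "connection_form g \<Gamma> e x w" and ?d = "connection_form g D e x w"
  have cd: "?c z = ?d z + \<eta> x w z" for z
    using connection_form_diff[OF fr(1,3,4), of w z] by (simp add: algebra_simps)
  have d_skew: "g x (?d u) z = - g x (?d z) u" for u z
    by (rule spin7_point.Lambda2_21_skew[OF spin7_point_basis[OF xS] frame_components(1)[OF fr]])
  have c_skew: "g x (?c u) z = - g x (?c z) u" for u z
    unfolding cd bilinear_ladd[OF bil] using d_skew[of u z] \<eta>_skew[OF xS, of w u z] by simp
  have c_e: "?c (e x k) = covariant_deriv \<Gamma> (\<lambda>y. e y k) x w" if "k < 8" for k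
  proof -
    have "?c (e x k) = (\<Sum>j<8. if j = k then covariant_deriv \<Gamma> (\<lambda>y. e y j) x w else 0)"
      unfolding connection_form_def coframe_def using on that
      by (intro sum.cong) (auto simp: orthonormal_basis_def)
    then show ?thesis using that by simp
  qed
  have "g x (e x k) (frame_deriv e x w v + ?c v - \<Gamma> x w v) = 0" if k: "k < 8" for k
  proof -
    have "g x (e x k) (frame_deriv e x w v) = g x (\<Gamma> x w (e x k)) v + g x (e x k) (\<Gamma> x w v) + g x (fd (\<lambda>y. e y k) x w) v"
      unfolding frame_deriv_coords[OF fr(1,3,4) k] fd_eq[OF fd_frame_coframe[OF fr k]] metric_\<Gamma>[OF xS] by simp
    also have "\<dots> = g x (?c (e x k)) v + g x (e x k) (\<Gamma> x w v)"
      unfolding c_e[OF k] covariant_deriv_def bilinear_ladd[OF bil] by simp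
    also have "g x (?c (e x k)) v = - g x (e x k) (?c v)"
      using c_skew[of "e x k" v] sym_g[OF xS] by simp
    finally show ?thesis by (simp add: bilinear_radd[OF bil] bilinear_rsub[OF bil])
  qed
  then have "frame_deriv e x w v + ?c v - \<Gamma> x w v = 0"
    using orthonormal_basis_expansion[OF bil on, of "frame_deriv e x w v + ?c v - \<Gamma> x w v"] by simp
  then show ?thesis by (simp add: cd)
qed

text \<open>Alternate the splitting of \<Gamma>: the whole is symmetric and drops out, the
  spin(7)-part annihilates the form, and the frame derivative gives the exterior derivative, which
  is the wedge product with the Lee form.\<close>

lemma alt5_\<eta>:
  assumes xS: "x \<in> S" and lt: "a < b" "b < c" "c < d" "d < f" "f < 8"
  shows "alt5 (\<Phi> x) (\<eta> x) (basis x a) (basis x b) (basis x c) (basis x d) (basis x f) =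
    - wedge14 (lee x) (\<Phi> x) (basis x a) (basis x b) (basis x c) (basis x d) (basis x f)"
proof -
  interpret p: spin7_point "g x" "\<Phi> x" "basis x" by (rule spin7_point_basis[OF xS])
  note ad = p.adapted_e and bil = p.bilinear_g
  obtain V e where V: "open V" "x \<in> V" "V \<subseteq> S" "adapted_frame_on V g \<Phi> e"
    using frames[OF xS] by blast
  note fr = V(4,1,3,2)
  let ?a = "\<lambda>F. alt5 (\<Phi> x) F (basis x a) (basis x b) (basis x c) (basis x d) (basis x f)"
  have "?a (\<Gamma> x) = 0" by (rule alt5_symmetric[OF ad]) (rule sym_\<Gamma>[OF xS])
  moreover have "?a (\<Gamma> x) = ?a (frame_deriv e x) + (?a (connection_form g D e x) + ?a (\<eta> x))"
    using alt5_add[OF ad bil, of "frame_deriv e x" "\<lambda>w v. connection_form g D e x w v + \<eta> x w v"]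
      alt5_add[OF ad bil, of "connection_form g D e x" "\<eta> x"]
    by (simp add: frame_deriv_connection[OF fr])
  moreover have "?a (connection_form g D e x) = 0"
  proof -
    have "act4 (\<Phi> x) (connection_form g D e x w) (basis x i) (basis x j) (basis x k) (basis x l) = 0"
      if "i < j" "j < k" "k < l" "l < 8" for w i j k l
      using p.Lambda2_21_act[OF frame_components(1)[OF fr]] that unfolding p.act_act4 by blast
    then show ?thesis using lt by (simp add: alt5_def)
  qed
  moreover have "?a (frame_deriv e x) =
      wedge14 (lee x) (\<Phi> x) (basis x a) (basis x b) (basis x c) (basis x d) (basis x f)"
    using ext_deriv_lee[OF xS, of "\<lambda>n. [basis x a, basis x b, basis x c, basis x d, basis x f] ! n"]
      ext_deriv_4_frame[OF fr, of "\<lambda>n. [basis x a, basis x b, basis x c, basis x d, basis x f] ! n"]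
    by simp
  ultimately show ?thesis by simp
qed

text \<open>Because \<eta> is minus the intrinsic torsion, the pointwise lemmas apply with minus the
  Lee form.\<close>

lemma \<eta>_equations:
  assumes xS: "x \<in> S"
  shows "spin7_point.torsion_equations (g x) (basis x) (\<eta> x) (\<lambda>i. - lee x (basis x i))"
proof -
  interpret p: spin7_point "g x" "\<Phi> x" "basis x" by (rule spin7_point_basis[OF xS])
  show ?thesis
    unfolding p.torsion_equations_def p.act_act4 form4_Q[OF p.adapted_e, symmetric]
  proof (intro allI impI, goal_cases)
    case (1 f d c b a)
    then show ?case
      using alt5_\<eta>[OF xS, of a b c d f] by (simp add: alt5_def wedge14_def)
  qed
qed

section \<open>The tensor r and the consequences of its being parallel\<close>

definition lee_sq :: "E \<Rightarrow> real" where
  "lee_sq x = g x (X x) (X x)"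

lemma lee_sq_basis: "x \<in> S \<Longrightarrow> lee_sq x = (\<Sum>k<8. lee x (basis x k) * lee x (basis x k))"
  unfolding lee_sq_def g_X by (subst X_def) (simp add: linear_sum[OF lee_linear] linear_cmul[OF lee_linear])

text \<open>The sign of \<eta> cancels in products. Once the orthonormal basis is exchanged for the
  adapted one, both sides are bilinear and are compared on it by
  \<open>torsion_r_basis\<close>.\<close>

lemma r_tensor_eq:
  assumes xS: "x \<in> S"
  shows "r_tensor g (\<lambda>x u v. D x u v - \<Gamma> x u v) x v w = (lee_sq x * g x v w - lee x v * lee x w) / 32"
proof -
  interpret p: spin7_point "g x" "\<Phi> x" "basis x" by (rule spin7_point_basis[OF xS])
  note bil = p.bilinear_g and lg = linear_g[OF xS]
  let ?e = "SOME e. orthonormal_basis (g x) e" and ?b = "basis x"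
  have on: "orthonormal_basis (g x) ?e"
    by (rule someI[where P = "orthonormal_basis (g x)", OF p.orthonormal_e])
  have minus: "D x u z - \<Gamma> x u z = - \<eta> x u z" for u z by (simp add: \<eta>_def)
  have "r_tensor g (\<lambda>x u v. D x u v - \<Gamma> x u v) x v w = (\<Sum>i<8. g x (\<eta> x v (?e i)) (\<eta> x w (?e i)))"
    unfolding r_tensor_def Let_def minus
    by (simp add: linear_neg[OF lg(1)] linear_neg[OF lg(2)])
  also have "\<dots> = (\<Sum>i<8. g x (\<eta> x v (?b i)) (\<eta> x w (?b i)))"
    by (rule orthonormal_basis_sum_invariant[OF bil sym_g[OF xS] on p.orthonormal_e,
          where h = "\<lambda>a b. g x (\<eta> x v a) (\<eta> x w b)"])
      (auto simp: bilinear_def intro!: linear_compose[OF linear_\<eta>(1)[OF xS] lg(1), unfolded o_def]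
        linear_compose[OF linear_\<eta>(1)[OF xS] lg(2), unfolded o_def])
  also have "\<dots> = (lee_sq x * g x v w - lee x v * lee x w) / 32"
  proof (rule bilinear_eq_orthonormal_basis[OF bil p.orthonormal_e,
        where h = "\<lambda>v w. \<Sum>i<8. g x (\<eta> x v (?b i)) (\<eta> x w (?b i))"
          and k = "\<lambda>v w. (lee_sq x * g x v w - lee x v * lee x w) / 32"])
    show "bilinear (\<lambda>v w. \<Sum>i<8. g x (\<eta> x v (?b i)) (\<eta> x w (?b i)))"
      unfolding bilinear_def
      by (auto intro!: linear_compose_sum linear_compose[OF linear_\<eta>(2)[OF xS] lg(1), unfolded o_def]
        linear_compose[OF linear_\<eta>(2)[OF xS] lg(2), unfolded o_def])
    show "bilinear (\<lambda>v w. (lee_sq x * g x v w - lee x v * lee x w) / 32)"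
      unfolding bilinear_def
      by (auto intro!: linearI simp: linear_add[OF lg(1)] linear_add[OF lg(2)] linear_cmul[OF lg(1)] linear_cmul[OF lg(2)]
        linear_add[OF lee_linear[OF xS]] linear_cmul[OF lee_linear[OF xS]] field_simps)
    fix i j :: nat assume ij: "i < 8" "j < 8"
    have "(\<Sum>k<8. g x (\<eta> x (?b i) (?b k)) (\<eta> x (?b j) (?b k))) =
        ((\<Sum>k<8. (- lee x (?b k)) * (- lee x (?b k))) * of_bool (i = j) - (- lee x (?b i)) * (- lee x (?b j))) / 32"
      by (rule p.torsion_r_basis[of "\<eta> x" "\<lambda>k. - lee x (?b k)", OF \<eta>_Lambda2_7[OF xS] \<eta>_equations[OF xS] ij])
    then show "(\<Sum>k<8. g x (\<eta> x (?b i) (?b k)) (\<eta> x (?b j) (?b k))) =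
        (lee_sq x * g x (?b i) (?b j) - lee x (?b i) * lee x (?b j)) / 32"
      using p.orthonormal_e ij by (simp add: lee_sq_basis[OF xS] orthonormal_basis_def)
  qed
  finally show ?thesis .
qed

lemma trace_\<eta>_X:
  assumes xS: "x \<in> S"
  shows "(\<Sum>b\<in>Basis. \<eta> x b (X x) \<bullet> b) = 7 / 16 * lee_sq x"
proof -
  interpret p: spin7_point "g x" "\<Phi> x" "basis x" by (rule spin7_point_basis[OF xS])
  let ?b = "basis x"
  note lg = linear_g[OF xS] and le = linear_\<eta>[OF xS]
  have "(\<Sum>b\<in>Basis. \<eta> x b (X x) \<bullet> b) = (\<Sum>j<8. g x (?b j) (\<eta> x (?b j) (X x)))"
    by (rule linear_trace_orthonormal[OF p.bilinear_g p.orthonormal_e le(2), symmetric])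
  also have "\<dots> = (\<Sum>j<8. \<Sum>i<8. lee x (?b i) * g x (?b j) (\<eta> x (?b j) (?b i)))"
    unfolding X_def by (simp add: linear_sum[OF le(1)] linear_cmul[OF le(1)] linear_sum[OF lg(1)] linear_cmul[OF lg(1)])
  also have "\<dots> = (\<Sum>i<8. lee x (?b i) * (\<Sum>j<8. g x (\<eta> x (?b j) (?b i)) (?b j)))"
    by (subst sum.swap) (simp add: sum_distrib_left sym_g[OF xS])
  also have "\<dots> = (\<Sum>i<8. lee x (?b i) * (7 / 16 * lee x (?b i)))"
  proof (intro sum.cong refl)
    fix i assume "i \<in> {..<8::nat}"
    then have "(\<Sum>j<8. g x (\<eta> x (?b j) (?b i)) (?b j)) = - 7 / 16 * (- lee x (?b i))"
      by (intro p.torsion_trace_basis[of "\<eta> x" "\<lambda>k. - lee x (?b k)", OF \<eta>_Lambda2_7[OF xS] \<eta>_equations[OF xS]]) auto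
    then show "lee x (?b i) * (\<Sum>j<8. g x (\<eta> x (?b j) (?b i)) (?b j)) = lee x (?b i) * (7 / 16 * lee x (?b i))"
      by simp
  qed
  finally show ?thesis by (simp add: lee_sq_basis[OF xS] sum_distrib_left algebra_simps)
qed

lemma lee_sq_pos: "x \<in> S \<Longrightarrow> X x \<noteq> 0 \<Longrightarrow> lee_sq x > 0"
  unfolding lee_sq_def by (rule pos_g)

lemma smooth_on_lee_sq: "smooth_on S lee_sq"
  unfolding lee_sq_def[abs_def]
  by (rule smooth_on_bilinear_field[OF open_S bilinear_g smooth_g smooth_on_X smooth_on_X])

lemma X_has_derivative: "x \<in> S \<Longrightarrow> (X has_derivative fd X x) (at x)"
  by (rule smooth_on_has_derivative[OF smooth_on_X])

text \<open>Since \<open>D\<close> is metric, its derivative of the Lee form is dual to its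
  derivative of the vector field \<open>X\<close>.\<close>

lemma lee_has_derivative:
  assumes xS: "x \<in> S"
  shows "((\<lambda>y. lee y v) has_derivative
    (\<lambda>h. g x (fd X x h + D x h (X x)) v + lee x (D x h v))) (at x)"
proof -
  have "((\<lambda>y. g y (X y) v) has_derivative
      (\<lambda>h. fd (\<lambda>y. g y (X x) v) x h + g x (fd X x h) v + g x (X x) 0)) (at x)"
    by (rule has_derivative_bilinear_field[OF open_S xS bilinear_g, where G' = "\<lambda>h u v. fd (\<lambda>y. g y u v) x h"])
      (auto intro!: g_has_derivative xS X_has_derivative)
  then have "((\<lambda>y. g y (X y) v) has_derivative (\<lambda>h. g x (fd X x h + D x h (X x)) v + lee x (D x h v))) (at x)"
    by (rule has_derivative_eq_rhs)
      (simp add: metric_D[OF xS] g_X[OF xS, symmetric] bilinear_ladd[OF bilinear_g[OF xS]]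
        bilinear_rzero[OF bilinear_g[OF xS]] fun_eq_iff)
  then show ?thesis
    by (rule has_derivative_transform_within_open[OF _ open_S xS]) (rule g_X)
qed

text \<open>What \<open>D r = 0\<close> says about the Lee form, as \<open>r = (|\<theta>|\<^sup>2 g - \<theta> \<otimes> \<theta>) / 32\<close>.\<close>
lemma parallel_lee:
  assumes xS: "x \<in> S"
  shows "fd lee_sq x u * g x v w =
    g x (fd X x u + D x u (X x)) v * lee x w + lee x v * g x (fd X x u + D x u (X x)) w"
proof -
  let ?r = "r_tensor g (\<lambda>x u v. D x u v - \<Gamma> x u v)" and ?P = "\<lambda>h. fd X x h + D x h (X x)"
  have "((\<lambda>y. (lee_sq y * g y v w - lee y v * lee y w) * (1 / 32)) has_derivative
      (\<lambda>h. ((lee_sq x * fd (\<lambda>y. g y v w) x h + fd lee_sq x h * g x v w) -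
        (lee x v * (g x (?P h) w + lee x (D x h w)) + (g x (?P h) v + lee x (D x h v)) * lee x w)) * (1 / 32))) (at x)"
    by (intro has_derivative_mult_left has_derivative_diff has_derivative_mult lee_has_derivative[OF xS]
      g_has_derivative[OF xS] smooth_on_has_derivative[OF smooth_on_lee_sq xS])
  then have "((\<lambda>y. ?r y v w) has_derivative
      (\<lambda>h. ((lee_sq x * fd (\<lambda>y. g y v w) x h + fd lee_sq x h * g x v w) -
        (lee x v * (g x (?P h) w + lee x (D x h w)) + (g x (?P h) v + lee x (D x h v)) * lee x w)) * (1 / 32))) (at x)"
    by (rule has_derivative_transform_within_open[OF _ open_S xS]) (simp add: r_tensor_eq)
  from fd_eq[OF this] parallel[OF xS, of u v w] show ?thesis
    unfolding covariant_deriv_tensor2_def r_tensor_eq[OF xS] metric_D[OF xS]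
    by (simp add: field_simps)
qed

text \<open>Evaluate \<open>parallel_lee\<close> at \<open>v, v\<close> for a nonzero
  \<open>v\<close> annihilated by the Lee form: the right-hand side vanishes while
  \<open>g x v v > 0\<close>.\<close>

lemma fd_lee_sq_eq_0:
  assumes xS: "x \<in> S"
  shows "fd lee_sq x u = 0"
proof -
  let ?a = "lee x (basis x 0)" and ?b = "lee x (basis x 1)"
  \<comment> \<open>Two basis vectors already span a plane on which the linear form has a nontrivial
    kernel; the case split keeps \<open>v\<close> nonzero.\<close>
  define v where "v = (if ?a = 0 then basis x 0 else ?a *\<^sub>R basis x 1 - ?b *\<^sub>R basis x 0)"
  have on: "orthonormal_basis (g x) (basis x)" by (rule orthonormal_basis_basis[OF xS])
  have "lee x v = 0"
    by (simp add: v_def linear_diff[OF lee_linear[OF xS]] linear_cmul[OF lee_linear[OF xS]])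
  moreover have "v \<noteq> 0"
  proof
    assume "v = 0"
    then have "g x (basis x (if ?a = 0 then 0 else 1)) v = 0"
      by (simp add: bilinear_rzero[OF bilinear_g[OF xS]])
    then show False
      using on by (auto simp: v_def orthonormal_basis_def linear_diff[OF linear_g(1)[OF xS]]
        linear_cmul[OF linear_g(1)[OF xS]] split: if_splits)
  qed
  ultimately show ?thesis
    using parallel_lee[OF xS, of u v v] pos_g[OF xS, of v] by simp
qed

text \<open>The symmetric product of the 1-form dual to \<open>?P\<close> with the Lee form
  vanishes. Inserting \<open>X\<close> twice gives \<open>g x ?P (X x) = 0\<close>, inserting it
  once then gives \<open>?P = 0\<close>, as long as \<open>lee_sq x\<close> is not 0.\<close>

lemma lee_sq_D_X:
  assumes xS: "x \<in> S"
  shows "lee_sq x *\<^sub>R (fd X x u + D x u (X x)) = 0"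
proof -
  let ?P = "fd X x u + D x u (X x)"
  have 0: "g x ?P v * lee x w + lee x v * g x ?P w = 0" for v w
    using parallel_lee[OF xS, of u v w] by (simp add: fd_lee_sq_eq_0[OF xS])
  have s: "lee x (X x) = lee_sq x" by (simp add: lee_sq_def g_X[OF xS])
  show ?thesis
  proof (cases "lee_sq x = 0")
    case False
    have "g x ?P (X x) = 0" using 0[of "X x" "X x"] False by (simp add: s)
    then have "g x ?P v = g x 0 v" for v
      using 0[of v "X x"] False by (simp add: s bilinear_lzero[OF bilinear_g[OF xS]])
    then show ?thesis using g_nondegenerate[OF xS] by simp
  qed simp
qed

end

section \<open>The Riemannian density\<close>

definition gram :: "(E \<Rightarrow> E \<Rightarrow> real) \<Rightarrow> real^8^8" where
  "gram h = (\<chi> i j. h (axis i 1) (axis j 1))"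

text \<open>With the absolute value, positivity needs only a nonzero determinant, and a change of
  chart contributes the absolute Jacobian that the integral transformation expects.\<close>

definition vol_density :: "(E \<Rightarrow> E \<Rightarrow> real) \<Rightarrow> real" where
  "vol_density h = sqrt \<bar>det (gram h)\<bar>"

lemma bilinear_gram:
  assumes "bilinear h"
  shows "h u v = (\<Sum>i\<in>UNIV. \<Sum>j\<in>UNIV. u $ i * v $ j * gram h $ i $ j)"
  unfolding gram_def using bilinear_Basis_expansion[OF assms, of u v]
  by (simp add: sum_Basis_axis inner_axis)

text \<open>A vector \<open>w\<close> in the kernel of the Gram matrix would satisfy
  \<open>h w w = 0\<close>.\<close>

lemma det_gram_nonzero:
  assumes "bilinear h" "\<And>u. u \<noteq> 0 \<Longrightarrow> h u u > 0"
  shows "det (gram h) \<noteq> 0"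
proof
  assume "det (gram h) = 0"
  then have "\<not> (\<exists>B. B ** gram h = mat 1)"
    using invertible_det_nz invertible_left_inverse by blast
  then obtain w where w: "gram h *v w = 0" "w \<noteq> 0"
    unfolding matrix_left_invertible_ker by blast
  have "h w w = (\<Sum>i\<in>UNIV. w $ i * (gram h *v w) $ i)"
    unfolding bilinear_gram[OF assms(1), of w w] matrix_vector_mult_def
    by (simp add: sum_distrib_left algebra_simps)
  then show False using w assms(2)[of w] by simp
qed

lemma vol_density_pos:
  assumes "bilinear h" "\<And>u. u \<noteq> 0 \<Longrightarrow> h u u > 0"
  shows "vol_density h > 0"
  using det_gram_nonzero[OF assms] by (simp add: vol_density_def)

lemma vol_density_pullback:
  assumes "bilinear h" "linear T"
  shows "vol_density (\<lambda>u v. h (T u) (T v)) = vol_density h * \<bar>det (matrix T)\<bar>"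
proof -
  have "gram (\<lambda>u v. h (T u) (T v)) = transpose (matrix T) ** gram h ** matrix T"
  proof -
    have "gram (\<lambda>u v. h (T u) (T v)) $ a $ b = (transpose (matrix T) ** gram h ** matrix T) $ a $ b" for a b
    proof -
      have "gram (\<lambda>u v. h (T u) (T v)) $ a $ b = h (T (axis a 1)) (T (axis b 1))"
        by (simp add: gram_def)
      also have "\<dots> = (\<Sum>i\<in>UNIV. \<Sum>j\<in>UNIV. T (axis a 1) $ i * T (axis b 1) $ j * gram h $ i $ j)"
        by (rule bilinear_gram[OF assms(1)])
      also have "\<dots> = (\<Sum>j\<in>UNIV. \<Sum>i\<in>UNIV. T (axis a 1) $ i * gram h $ i $ j * T (axis b 1) $ j)"
        by (subst sum.swap) (simp add: algebra_simps)
      finally show ?thesis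
        by (simp add: matrix_matrix_mult_def transpose_def matrix_def sum_distrib_right)
    qed
    then show ?thesis by (simp add: vec_eq_iff)
  qed
  then have "det (gram (\<lambda>u v. h (T u) (T v))) = det (gram h) * (det (matrix T))\<^sup>2"
    by (simp add: det_mul det_transpose power2_eq_square)
  then show ?thesis by (simp add: vol_density_def abs_mult real_sqrt_mult)
qed

lemma DERIV_sqrt_abs:
  fixes t :: real
  assumes "t \<noteq> 0"
  shows "((\<lambda>t. sqrt \<bar>t\<bar>) has_real_derivative (inverse (sqrt \<bar>t\<bar>) / 2 * sgn t)) (at t)"
proof -
  have "(abs has_real_derivative sgn t) (at t)"
  proof (cases "t > 0")
    case True
    have "((\<lambda>t. t) has_real_derivative 1) (at t)" by (rule DERIV_ident)
    then have "(abs has_real_derivative 1) (at t)"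
      by (rule has_field_derivative_transform_within_open[where S = "{0<..}"]) (use True in auto)
    then show ?thesis using True by simp
  next
    case False
    have "(uminus has_real_derivative - 1) (at t)" by (auto intro!: derivative_eq_intros)
    then have "(abs has_real_derivative - 1) (at t)"
      by (rule has_field_derivative_transform_within_open[where S = "{..<0}"]) (use False assms in auto)
    then show ?thesis using False assms by simp
  qed
  from DERIV_chain2[OF DERIV_real_sqrt this] assms show ?thesis by simp
qed

lemma smooth_on_prod:
  fixes f :: "'i \<Rightarrow> 'a::euclidean_space \<Rightarrow> real"
  assumes "open S" "\<And>i. i \<in> I \<Longrightarrow> smooth_on S (f i)"
  shows "smooth_on S (\<lambda>x. \<Prod>i\<in>I. f i x)"
  using assms(2)
  by (induction I rule: infinite_finite_induct) (auto intro: smooth_on_const smooth_on_mult assms(1))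

lemma (in spin7_chart) C1_vol_density: "Ck_on (Suc 0) S (\<lambda>x. vol_density (g x))"
proof -
  have sm: "smooth_on S (\<lambda>x. det (gram (g x)))"
    unfolding det_def gram_def
    by (simp, intro smooth_on_sum smooth_on_mult smooth_on_prod smooth_on_const open_S smooth_g)
  have nz: "det (gram (g x)) \<noteq> 0" if "x \<in> S" for x
    by (rule det_gram_nonzero[OF bilinear_g pos_g]) (use that in auto)
  have cd: "continuous_on S (\<lambda>x. det (gram (g x)))" "\<And>v. continuous_on S (\<lambda>x. fd (\<lambda>y. det (gram (g y))) x v)"
    using sm smooth_on_fd[OF sm] unfolding smooth_on_def by (metis Ck_on.simps(1))+
  show ?thesis
    unfolding vol_density_def
  proof (rule Ck_on_SucI[OF open_S])
    show "((\<lambda>x. sqrt \<bar>det (gram (g x))\<bar>) has_derivative (\<lambda>h. inverse (sqrt \<bar>det (gram (g x))\<bar>) / 2 *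
        sgn (det (gram (g x))) * fd (\<lambda>y. det (gram (g y))) x h)) (at x)" if "x \<in> S" for x
      by (rule has_derivative_compose[OF smooth_on_has_derivative[OF sm that]
            DERIV_sqrt_abs[OF nz[OF that], unfolded has_field_derivative_def]])
    show "Ck_on 0 S (\<lambda>x. inverse (sqrt \<bar>det (gram (g x))\<bar>) / 2 *
        sgn (det (gram (g x))) * fd (\<lambda>y. det (gram (g y))) x v)" for v
      unfolding Ck_on.simps(1) by (intro continuous_intros cd) (use nz in auto)
  qed
qed

context nearly_parallel_chart
begin

text \<open>The logarithmic derivative of the density is the trace of the connection coefficients,
  that is, half the trace of the logarithmic derivative of the Gram matrix.\<close>

lemma vol_density_has_derivative:
  assumes xS: "x \<in> S"
  shows "((\<lambda>y. vol_density (g y)) has_derivative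
    (\<lambda>h. (\<Sum>b\<in>Basis. \<Gamma> x h b \<bullet> b) * vol_density (g x))) (at x)"
proof -
  let ?G = "gram (g x)"
  have nz: "det ?G \<noteq> 0" by (rule det_gram_nonzero[OF bilinear_g pos_g]) (use xS in auto)
  then obtain B where B: "B ** ?G = mat 1" "?G ** B = mat 1"
    using invertible_det_nz unfolding invertible_def by blast
  define P where "P h = (\<chi> i k. \<Gamma> x h (axis i 1) $ k)" for h :: E
  \<comment> \<open>Metric compatibility gives the derivative of \<open>?G\<close> as
    \<open>P h ** ?G + ?G ** transpose (P h)\<close>. This is \<open>M h ** ?G\<close>, the form
    required by Jacobi's formula, and both summands of \<open>M h\<close> have the trace of
    \<open>P h\<close>.\<close>
  define M where "M h = P h + ?G ** transpose (P h) ** B" for h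
  have gr: "g x u (axis j 1) = (\<Sum>k\<in>UNIV. u $ k * ?G $ k $ j)" "g x (axis i 1) u = (\<Sum>k\<in>UNIV. ?G $ i $ k * u $ k)"
    for u i j
  proof -
    have ax: "c * (axis j 1 $ k) * d = (if k = j then c * d else 0)"
      "(axis j 1 $ k) * c * d = (if k = j then c * d else 0)" for c d :: real and j k :: 8
      by (simp_all add: axis_def)
    show "g x u (axis j 1) = (\<Sum>k\<in>UNIV. u $ k * ?G $ k $ j)"
      unfolding bilinear_gram[OF bilinear_g[OF xS], of u] ax by simp
    show "g x (axis i 1) u = (\<Sum>k\<in>UNIV. ?G $ i $ k * u $ k)"
      unfolding bilinear_gram[OF bilinear_g[OF xS], of _ u] ax
      by (subst sum.swap) (simp add: mult.commute)
  qed
  have MG: "M h ** ?G = P h ** ?G + ?G ** transpose (P h)" for h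
  proof -
    have "(K + L) ** ?G = K ** ?G + L ** ?G" for K L :: "real^8^8"
      by (simp add: vec_eq_iff matrix_matrix_mult_def sum.distrib algebra_simps)
    then show ?thesis unfolding M_def by (simp add: matrix_mul_assoc[symmetric] B)
  qed
  have "((\<lambda>y. gram (g y) $ i $ j) has_derivative (\<lambda>h. (M h ** ?G) $ i $ j)) (at x)" for i j
  proof -
    have "((\<lambda>y. g y (axis i 1) (axis j 1)) has_derivative
        (\<lambda>h. g x (\<Gamma> x h (axis i 1)) (axis j 1) + g x (axis i 1) (\<Gamma> x h (axis j 1)))) (at x)"
      by (rule has_derivative_eq_rhs[OF g_has_derivative[OF xS]]) (simp add: metric_\<Gamma>[OF xS] fun_eq_iff)
    then show ?thesis
      unfolding MG gr by (simp add: gram_def P_def matrix_matrix_mult_def transpose_def)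
  qed
  then have d: "((\<lambda>y. det (gram (g y))) has_derivative (\<lambda>h. trace (M h) * det ?G)) (at x)"
    by (rule det_has_derivative_trace)
  have "trace (?G ** transpose (P h) ** B) = trace (P h)" for h
  proof -
    have "trace (?G ** transpose (P h) ** B) = trace (B ** (?G ** transpose (P h)))" by (rule trace_mul_sym)
    also have "\<dots> = trace (transpose (P h))" by (simp add: matrix_mul_assoc B)
    finally show ?thesis by (simp add: trace_def transpose_def)
  qed
  then have tr: "trace (M h) = 2 * (\<Sum>b\<in>Basis. \<Gamma> x h b \<bullet> b)" for h
    by (simp add: M_def trace_add) (simp add: trace_def P_def sum_Basis_axis inner_axis)
  have "((\<lambda>y. sqrt \<bar>det (gram (g y))\<bar>) has_derivative
      (\<lambda>h. inverse (sqrt \<bar>det ?G\<bar>) / 2 * (trace (M h) * det ?G * sgn (det ?G)))) (at x)"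
  proof -
    from has_derivative_compose[OF d DERIV_sqrt_abs[OF nz, unfolded has_field_derivative_def]]
    show ?thesis by (rule has_derivative_eq_rhs) (simp add: fun_eq_iff algebra_simps)
  qed
  then show ?thesis
    unfolding vol_density_def
  proof (rule has_derivative_eq_rhs)
    have "inverse (sqrt \<bar>det ?G\<bar>) * \<bar>det ?G\<bar> = sqrt \<bar>det ?G\<bar>"
      using nz by (simp add: field_simps)
    then show "(\<lambda>h. inverse (sqrt \<bar>det ?G\<bar>) / 2 * (trace (M h) * det ?G * sgn (det ?G))) =
        (\<lambda>h. (\<Sum>b\<in>Basis. \<Gamma> x h b \<bullet> b) * sqrt \<bar>det ?G\<bar>)"
      by (auto simp: tr fun_eq_iff abs_sgn algebra_simps)
  qed
qed

text \<open>The divergence of \<open>\<rho> |\<theta>|\<^sup>2 \<theta>\<^sup>\<sharp>\<close>.\<close>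
lemma divergence_formula:
  assumes xS: "x \<in> S" and \<rho>: "\<rho> differentiable (at x)"
  shows "(\<Sum>b\<in>Basis. fd (\<lambda>y. \<rho> y * vol_density (g y) * (lee_sq y * (X y \<bullet> b))) x b) =
    vol_density (g x) * (fd \<rho> x (lee_sq x *\<^sub>R X x) + 7 / 16 * \<rho> x * (lee_sq x)\<^sup>2)"
proof -
  let ?m = "vol_density (g x)" and ?f = "lee_sq x" and ?t = "\<lambda>h. \<Sum>b\<in>Basis. \<Gamma> x h b \<bullet> b"
  have "((\<lambda>y. \<rho> y * vol_density (g y) * (lee_sq y * (X y \<bullet> b))) has_derivative
      (\<lambda>h. \<rho> x * ?m * (?f * (fd X x h \<bullet> b) + fd lee_sq x h * (X x \<bullet> b)) +
        (\<rho> x * (?t h * ?m) + fd \<rho> x h * ?m) * (?f * (X x \<bullet> b)))) (at x)" for b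
    by (intro has_derivative_mult fd_works[OF \<rho>] vol_density_has_derivative[OF xS] has_derivative_inner_left
      X_has_derivative[OF xS] smooth_on_has_derivative[OF smooth_on_lee_sq xS])
  note fd_eq[OF this]
  moreover have "?f * (fd X x h \<bullet> b) = - (?f * (D x h (X x) \<bullet> b))" for h b
  proof -
    have "(?f *\<^sub>R (fd X x h + D x h (X x))) \<bullet> b = 0" by (simp add: lee_sq_D_X[OF xS])
    then show ?thesis by (simp add: inner_left_distrib algebra_simps)
  qed
  moreover have "(\<Sum>b\<in>Basis. ?t b * (X x \<bullet> b)) = ?t (X x)"
  proof -
    have lin: "linear ?t"
      by (rule linearI) (simp_all add: linear_add[OF linear_\<Gamma>(2)[OF xS]] linear_cmul[OF linear_\<Gamma>(2)[OF xS]]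
        inner_left_distrib sum.distrib sum_distrib_left)
    show ?thesis using linear_Basis_expansion[OF lin, of "X x"] by (simp add: mult.commute)
  qed
  moreover have "(\<Sum>b\<in>Basis. fd \<rho> x b * (X x \<bullet> b)) = fd \<rho> x (X x)"
    using linear_Basis_expansion[OF fd_linear[OF \<rho>], of "X x"] by (simp add: mult.commute)
  ultimately have "(\<Sum>b\<in>Basis. fd (\<lambda>y. \<rho> y * vol_density (g y) * (lee_sq y * (X y \<bullet> b))) x b) =
      - \<rho> x * ?m * ?f * (\<Sum>b\<in>Basis. D x b (X x) \<bullet> b) + \<rho> x * ?m * ?f * ?t (X x) + ?m * ?f * fd \<rho> x (X x)"
    by (simp add: fd_lee_sq_eq_0[OF xS] sum.distrib sum_subtractf sum_negf sum_distrib_left[symmetric]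
      algebra_simps flip: sum_distrib_left)
  \<comment> \<open>By symmetry of \<Gamma>, the term from the density is the trace of
    \<open>b \<mapsto> \<Gamma> x b (X x)\<close>. Subtracting the trace with \<open>D\<close>
    leaves the one with \<eta>.\<close>
  also have "\<dots> = \<rho> x * ?m * ?f * (\<Sum>b\<in>Basis. \<eta> x b (X x) \<bullet> b) + ?m * ?f * fd \<rho> x (X x)"
    by (simp add: \<eta>_def inner_diff_left sum_subtractf sym_\<Gamma>[OF xS, of "X x"] algebra_simps)
  finally show ?thesis
    by (simp add: trace_\<eta>_X[OF xS] linear_cmul[OF fd_linear[OF \<rho>]] power2_eq_square algebra_simps)
qed

end

section \<open>Transitions between charts\<close>

definition chart_inv :: "'m chart \<Rightarrow> E \<Rightarrow> 'm" where
  "chart_inv c = inv_into (fst c) (snd c)"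

locale compact_nearly_parallel =
  fixes A :: "'m::{t2_space, second_countable_topology} chart set" and g \<Phi> LC D
  assumes compact: "compact (UNIV :: 'm set)" and spin7: "spin7_structure A g \<Phi>"
    and lcp: "locally_conformal_parallel A g \<Phi>"
    and LC: "\<And>c. c \<in> A \<Longrightarrow> levi_civita_on (chart_image c) (g c) (LC c)"
    and D: "\<And>c. c \<in> A \<Longrightarrow> spin7_component_on (chart_image c) (g c) (\<Phi> c) (LC c) (D c)"
    and parallel: "\<And>c x u v w. c \<in> A \<Longrightarrow> x \<in> chart_image c \<Longrightarrow>
      covariant_deriv_tensor2 (D c) (r_tensor (g c) (\<lambda>x u v. D c x u v - LC c x u v)) x u v w = 0"
begin

lemma chart_homeomorphism:
  assumes "c \<in> A"
  shows "open (fst c)" "open (chart_image c)"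
    "homeomorphism (fst c) (chart_image c) (snd c) (chart_inv c)"
  using spin7 assms by (auto simp: spin7_structure_def smooth_atlas_def chart_inv_def)

lemma charts_cover: "\<exists>c\<in>A. p \<in> fst c"
  using spin7 by (auto simp: spin7_structure_def smooth_atlas_def)

lemma chart_inv_simps:
  assumes "c \<in> A"
  shows "p \<in> fst c \<Longrightarrow> chart_inv c (snd c p) = p"
    "x \<in> chart_image c \<Longrightarrow> snd c (chart_inv c x) = x" "x \<in> chart_image c \<Longrightarrow> chart_inv c x \<in> fst c"
  using chart_homeomorphism(3)[OF assms] by (auto simp: homeomorphism_def)

lemma continuous_on_chart:
  assumes "c \<in> A"
  shows "continuous_on (fst c) (snd c)" "continuous_on (chart_image c) (chart_inv c)"
  using chart_homeomorphism(3)[OF assms] by (auto simp: homeomorphism_def)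

lemma chart: "c \<in> A \<Longrightarrow> nearly_parallel_chart (chart_image c) (g c) (\<Phi> c) (LC c) (D c)"
proof -
  assume c: "c \<in> A"
  have rm: "riemannian_metric A g" using spin7 by (simp add: spin7_structure_def)
  show ?thesis
  proof
    show "open (chart_image c)" by (rule chart_homeomorphism(2)[OF c])
    show "bilinear (g c x)" "g c x u v = g c x v u" if "x \<in> chart_image c" for x u v
      using rm c that by (auto simp: riemannian_metric_def)
    show "g c x u u > 0" if "x \<in> chart_image c" "u \<noteq> 0" for x u
      using rm c that by (auto simp: riemannian_metric_def)
    show "smooth_on (chart_image c) (\<lambda>x. g c x u v)" for u v
      using rm c by (auto simp: riemannian_metric_def)
    show "\<exists>V e. open V \<and> x \<in> V \<and> V \<subseteq> chart_image c \<and> adapted_frame_on V (g c) (\<Phi> c) e"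
      if "x \<in> chart_image c" for x
      using spin7 c that by (auto simp: spin7_structure_def)
    show "ext_deriv 4 (\<Phi> c) x = wedge 1 4 (lee_form (g c) (\<Phi> c) x) (\<Phi> c x)" if "x \<in> chart_image c" for x
      using lcp c that by (auto simp: locally_conformal_parallel_def)
  qed (use c LC D parallel in auto)
qed

lemma transition_eq: "transition c c' x = snd c' (chart_inv c x)"
  by (simp add: transition_def chart_inv_def)

lemma transition_domain_iff:
  assumes "c \<in> A"
  shows "x \<in> transition_domain c c' \<longleftrightarrow> x \<in> chart_image c \<and> chart_inv c x \<in> fst c'"
  using chart_inv_simps[OF assms] by (force simp: transition_domain_def)

lemma open_chart_image:
  assumes "c \<in> A" "open W" "W \<subseteq> fst c"
  shows "open (snd c ` W)"
proof -
  have "openin (top_of_set (chart_image c)) (snd c ` W)"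
    by (rule homeomorphism_imp_open_map[OF chart_homeomorphism(3)[OF assms(1)]])
      (use assms in \<open>auto simp: openin_open\<close>)
  then show ?thesis using chart_homeomorphism(2)[OF assms(1)] openin_open_trans by blast
qed

lemma open_transition_domain: "c \<in> A \<Longrightarrow> c' \<in> A \<Longrightarrow> open (transition_domain c c')"
  unfolding transition_domain_def
  by (rule open_chart_image) (auto intro: open_Int chart_homeomorphism)

lemma smooth_transition: "c \<in> A \<Longrightarrow> c' \<in> A \<Longrightarrow> smooth_on (transition_domain c c') (transition c c')"
  using spin7 by (auto simp: spin7_structure_def smooth_atlas_def)

lemma transition_simps:
  assumes "c \<in> A" "c' \<in> A" "x \<in> transition_domain c c'"
  shows "transition c c' x \<in> transition_domain c' c" "chart_inv c' (transition c c' x) = chart_inv c x"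
    "transition c' c (transition c c' x) = x" "x \<in> chart_image c" "transition c c' x \<in> chart_image c'"
  using assms chart_inv_simps[OF assms(1)] chart_inv_simps[OF assms(2)]
  by (auto simp: transition_domain_iff transition_eq)

lemma fd_transition_inverse:
  assumes "c \<in> A" "c' \<in> A" "x \<in> transition_domain c c'"
  shows "fd (transition c' c) (transition c c' x) (fd (transition c c') x u) = u"
proof -
  have "((\<lambda>y. transition c' c (transition c c' y)) has_derivative
      (\<lambda>u. fd (transition c' c) (transition c c' x) (fd (transition c c') x u))) (at x)"
    by (rule has_derivative_compose[where f = "transition c c'" and g = "transition c' c"])
      (use smooth_on_has_derivative[OF smooth_transition] assms transition_simps in auto)
  moreover have "((\<lambda>y. transition c' c (transition c c' y)) has_derivative (\<lambda>u. u)) (at x)"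
    by (rule has_derivative_transform_within_open[OF has_derivative_ident open_transition_domain[OF assms(1,2)] assms(3)])
      (use transition_simps(3)[OF assms(1,2)] in simp)
  ultimately show ?thesis using has_derivative_unique by (fastforce dest: fun_cong)
qed

lemma metric_transition:
  assumes "c \<in> A" "c' \<in> A" "x \<in> transition_domain c c'"
  shows "g c x u v = g c' (transition c c' x) (fd (transition c c') x u) (fd (transition c c') x v)"
  using spin7 assms unfolding spin7_structure_def riemannian_metric_def Let_def by blast

lemma form_transition:
  assumes "c \<in> A" "c' \<in> A" "x \<in> transition_domain c c'"
  shows "\<Phi> c x v = \<Phi> c' (transition c c' x) (fd (transition c c') x \<circ> v)"
  using spin7 assms unfolding spin7_structure_def by blast

abbreviation X where "X c \<equiv> spin7_chart.X (g c) (\<Phi> c)"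
abbreviation lee where "lee c \<equiv> spin7_chart.lee (g c) (\<Phi> c)"
abbreviation lee_sq where "lee_sq c \<equiv> nearly_parallel_chart.lee_sq (g c) (\<Phi> c)"

lemma lcp_chart: "c \<in> A \<Longrightarrow> lcp_chart (chart_image c) (g c) (\<Phi> c)"
  using chart nearly_parallel_chart.axioms(1) by blast

lemma spin7_chart: "c \<in> A \<Longrightarrow> spin7_chart (chart_image c) (g c) (\<Phi> c)"
  using lcp_chart lcp_chart.axioms(1) by blast

context
  fixes c c' x
  assumes c: "c \<in> A" "c' \<in> A" and x: "x \<in> transition_domain c c'"
begin

interpretation c: nearly_parallel_chart "chart_image c" "g c" "\<Phi> c" "LC c" "D c"
  by (rule chart[OF c(1)])
interpretation c': nearly_parallel_chart "chart_image c'" "g c'" "\<Phi> c'" "LC c'" "D c'"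
  by (rule chart[OF c(2)])

lemma lee_transition: "lee c x u = lee c' (transition c c' x) (fd (transition c c') x u)"
proof (rule lee_pullback[OF lcp_chart lcp_chart open_transition_domain _ _ smooth_transition x
      form_transition fd_transition_inverse])
  show "transition_domain c c' \<subseteq> chart_image c" "transition c c' ` transition_domain c c' \<subseteq> chart_image c'"
    using transition_simps[OF c] by auto
qed (use c x in auto)

lemma X_transition: "X c' (transition c c' x) = fd (transition c c') x (X c x)"
proof -
  let ?y = "transition c c' x" and ?T = "fd (transition c c') x"
  note s = transition_simps[OF c x]
  show ?thesis
  proof (rule c'.g_nondegenerate[OF s(5)])
    fix v
    \<comment> \<open>Invariance of the metric and the Lee form is known only for test vectors
      \<open>?T w\<close>; every \<open>v\<close> has this form.\<close>
    have v: "?T (fd (transition c' c) ?y v) = v"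
      using fd_transition_inverse[OF c(2,1) s(1), of v] s(3) by simp
    have "g c' ?y (?T (X c x)) (?T w) = g c' ?y (X c' ?y) (?T w)" for w
      using metric_transition[OF c x, of "X c x" w] c.g_X[OF s(4), of w] c'.g_X[OF s(5)] lee_transition[of w]
      by simp
    from this[of "fd (transition c' c) ?y v"]
    show "g c' ?y (X c' ?y) v = g c' ?y (?T (X c x)) v" by (simp add: v)
  qed
qed

lemma lee_sq_transition: "lee_sq c' (transition c c' x) = lee_sq c x"
  unfolding c.lee_sq_def c'.lee_sq_def X_transition metric_transition[OF c x] ..

lemma vol_density_transition:
  "vol_density (g c x) = vol_density (g c' (transition c c' x)) * \<bar>det (matrix (fd (transition c c') x))\<bar>"
proof -
  note s = transition_simps[OF c x]
  have "g c x = (\<lambda>u v. g c' (transition c c' x) (fd (transition c c') x u) (fd (transition c c') x v))"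
    by (intro ext metric_transition c x)
  then show ?thesis
    using vol_density_pullback[OF c'.bilinear_g[OF s(5)] fd_linear[OF smooth_on_differentiable[OF smooth_transition[OF c] x]]]
    by simp
qed

end

section \<open>Integration over the manifold\<close>

definition C1_function :: "('m \<Rightarrow> real) \<Rightarrow> bool" where
  "C1_function h \<longleftrightarrow> (\<forall>c\<in>A. Ck_on (Suc 0) (chart_image c) (\<lambda>x. h (chart_inv c x)))"

text \<open>An arbitrary chart at each point turns chart-wise quantities into functions on the
  manifold; \<open>norm_sq_chart\<close> and \<open>lie_chart\<close> show that every chart gives
  the same value.\<close>

definition chart_at :: "'m \<Rightarrow> 'm chart" where
  "chart_at p = (SOME c. c \<in> A \<and> p \<in> fst c)"

lemma chart_at: "chart_at p \<in> A" "p \<in> fst (chart_at p)"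
proof -
  have "\<exists>c. c \<in> A \<and> p \<in> fst c" using charts_cover by blast
  from someI_ex[OF this] show "chart_at p \<in> A" "p \<in> fst (chart_at p)" by (auto simp: chart_at_def)
qed

definition norm_sq :: "'m \<Rightarrow> real" where
  "norm_sq p = lee_sq (chart_at p) (snd (chart_at p) p)"

text \<open>The derivative of \<open>h\<close> in direction \<open>|\<theta>|\<^sup>2 \<theta>\<^sup>\<sharp>\<close>.\<close>
definition lie :: "('m \<Rightarrow> real) \<Rightarrow> 'm \<Rightarrow> real" where
  "lie h p = (let c = chart_at p; x = snd c p in fd (\<lambda>x. h (chart_inv c x)) x (lee_sq c x *\<^sub>R X c x))"

lemma norm_sq_chart:
  assumes "c \<in> A" "x \<in> chart_image c"
  shows "norm_sq (chart_inv c x) = lee_sq c x"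
proof -
  let ?p = "chart_inv c x"
  have "x \<in> transition_domain c (chart_at ?p)"
    using assms chart_at by (simp add: transition_domain_iff)
  from lee_sq_transition[OF assms(1) chart_at(1) this] show ?thesis
    by (simp add: norm_sq_def transition_eq)
qed

text \<open>By the chain rule and the transformation laws of \<open>X\<close> and
  \<open>lee_sq\<close>, the derivative along this field is the same in all charts.\<close>

lemma lie_chart:
  assumes "C1_function h" "c \<in> A" "x \<in> chart_image c"
  shows "lie h (chart_inv c x) = fd (\<lambda>x. h (chart_inv c x)) x (lee_sq c x *\<^sub>R X c x)"
proof -
  let ?p = "chart_inv c x" and ?c = "chart_at (chart_inv c x)"
  let ?\<tau> = "transition c ?c"
  have c': "?c \<in> A" by (rule chart_at)
  have U: "x \<in> transition_domain c ?c"
    using assms chart_at by (simp add: transition_domain_iff)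
  note s = transition_simps[OF assms(2) c' U]
  have "((\<lambda>y. h (chart_inv ?c (?\<tau> y))) has_derivative (\<lambda>u. fd (\<lambda>x. h (chart_inv ?c x)) (?\<tau> x) (fd ?\<tau> x u))) (at x)"
  proof (rule has_derivative_compose[where f = ?\<tau>])
    show "(?\<tau> has_derivative fd ?\<tau> x) (at x)"
      by (rule smooth_on_has_derivative[OF smooth_transition[OF assms(2) c'] U])
    show "((\<lambda>x. h (chart_inv ?c x)) has_derivative fd (\<lambda>x. h (chart_inv ?c x)) (?\<tau> x)) (at (?\<tau> x))"
      using assms(1) c' s(5) by (intro Ck_on_has_derivative[of 0 "chart_image ?c"]) (auto simp: C1_function_def simp del: Ck_on.simps)
  qed
  then have "((\<lambda>y. h (chart_inv c y)) has_derivative (\<lambda>u. fd (\<lambda>x. h (chart_inv ?c x)) (?\<tau> x) (fd ?\<tau> x u))) (at x)"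
    by (rule has_derivative_transform_within_open[OF _ open_transition_domain[OF assms(2) c'] U])
      (simp add: transition_simps(2)[OF assms(2) c'])
  note fd = fd_eq[OF this]
  have "linear (fd ?\<tau> x)"
    by (rule fd_linear[OF smooth_on_differentiable[OF smooth_transition[OF assms(2) c'] U]])
  then show ?thesis
    unfolding fd lie_def Let_def
    by (simp add: linear_cmul X_transition[OF assms(2) c' U, symmetric] lee_sq_transition[OF assms(2) c' U, symmetric])
      (simp add: transition_eq)
qed

section \<open>Integrals in charts and the divergence theorem\<close>

definition chart_integral :: "'m chart \<Rightarrow> ('m \<Rightarrow> real) \<Rightarrow> real" where
  "chart_integral c h = integral (chart_image c) (\<lambda>x. vol_density (g c x) * h (chart_inv c x))"

definition chart_continuous :: "('m \<Rightarrow> real) \<Rightarrow> bool" where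
  "chart_continuous h \<longleftrightarrow> (\<forall>c\<in>A. continuous_on (chart_image c) (\<lambda>x. h (chart_inv c x)))"

lemma continuous_vol_density: "c \<in> A \<Longrightarrow> continuous_on (chart_image c) (\<lambda>x. vol_density (g c x))"
  using spin7_chart.C1_vol_density[OF spin7_chart] by (rule Ck_on_imp_continuous)

lemma vol_density_chart_pos:
  assumes "c \<in> A" "x \<in> chart_image c"
  shows "vol_density (g c x) > 0"
  using assms(2) by (intro vol_density_pos spin7_chart.bilinear_g[OF spin7_chart[OF assms(1)]]
    spin7_chart.pos_g[OF spin7_chart[OF assms(1)]])

lemma compact_chart_image: "c \<in> A \<Longrightarrow> compact K \<Longrightarrow> K \<subseteq> fst c \<Longrightarrow> compact (snd c ` K)"
  using continuous_on_chart(1) continuous_on_subset compact_continuous_image by blast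

lemma integrand_absolutely_integrable:
  assumes c: "c \<in> A" and h: "chart_continuous h" and K: "compact K" "K \<subseteq> fst c" "\<And>p. p \<notin> K \<Longrightarrow> h p = 0"
    and S: "snd c ` K \<subseteq> S" "S \<subseteq> chart_image c"
  shows "(\<lambda>x. vol_density (g c x) * h (chart_inv c x)) absolutely_integrable_on S"
proof (rule absolutely_integrable_compact_support[OF _ compact_chart_image[OF c K(1,2)] S(1)])
  show "continuous_on (snd c ` K) (\<lambda>x. vol_density (g c x) * h (chart_inv c x))"
  proof (rule continuous_on_subset)
    show "continuous_on (chart_image c) (\<lambda>x. vol_density (g c x) * h (chart_inv c x))"
      using h c by (intro continuous_on_mult continuous_vol_density) (auto simp: chart_continuous_def)
  qed (use K in auto)
  show "vol_density (g c x) * h (chart_inv c x) = 0" if "x \<in> S" "x \<notin> snd c ` K" for x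
  proof -
    have "x \<in> chart_image c" using that S by auto
    then have "chart_inv c x \<notin> K" using that(2) chart_inv_simps(2)[OF c] by (metis imageI)
    then show ?thesis by (simp add: K(3))
  qed
qed

text \<open>The support condition lets both integrals be restricted to the overlap; there the
  Jacobian of the change of variables is absorbed by the density.\<close>

lemma chart_integral_independent:
  assumes c: "c \<in> A" "c' \<in> A" and h: "chart_continuous h"
    and K: "compact K" "K \<subseteq> fst c \<inter> fst c'" "\<And>p. p \<notin> K \<Longrightarrow> h p = 0"
  shows "chart_integral c h = chart_integral c' h"
proof -
  let ?F = "\<lambda>c x. vol_density (g c x) * h (chart_inv c x)"
  let ?U = "transition_domain c c'" and ?\<tau> = "transition c c'"
  have restrict: "chart_integral c h = integral (transition_domain c c') (?F c)" if "c \<in> A" "K \<subseteq> fst c'" for c c'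
  proof -
    have "(if x \<in> chart_image c then ?F c x else 0) = (if x \<in> transition_domain c c' then ?F c x else 0)" for x
      using that K(3)[of "chart_inv c x"] by (auto simp: transition_domain_iff)
    then show ?thesis
      unfolding chart_integral_def
      using integral_restrict_UNIV[of "chart_image c" "?F c"] integral_restrict_UNIV[of "transition_domain c c'" "?F c"]
      by presburger
  qed
  have im: "?\<tau> ` ?U = transition_domain c' c"
    using transition_simps(1)[OF c] transition_simps(1,3)[OF c(2,1)] by force
  have inj: "inj_on ?\<tau> ?U" by (metis transition_simps(3)[OF c] inj_onI)
  have "integral (?\<tau> ` ?U) (?F c') = integral ?U (\<lambda>x. \<bar>det (matrix (fd ?\<tau> x))\<bar> * ?F c' (?\<tau> x))"
  proof (rule integral_change_of_variables_real_valued[OF _ _ inj])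
    show "?U \<in> sets lebesgue" using open_transition_domain[OF c] by auto
    show "(?\<tau> has_derivative fd ?\<tau> x) (at x within ?U)" if "x \<in> ?U" for x
      using smooth_on_has_derivative[OF smooth_transition[OF c] that] by (rule has_derivative_at_withinI)
    show "?F c' absolutely_integrable_on ?\<tau> ` ?U"
      unfolding im
      by (rule integrand_absolutely_integrable[OF c(2) h K(1) _ K(3)])
        (use K(2) transition_domain_iff[OF c(2)] in \<open>auto simp: transition_domain_def\<close>)
  qed
  also have "\<dots> = integral ?U (?F c)"
  proof (rule integral_cong)
    fix x assume x: "x \<in> ?U"
    show "\<bar>det (matrix (fd ?\<tau> x))\<bar> * ?F c' (?\<tau> x) = ?F c x"
      unfolding vol_density_transition[OF c x] transition_simps(2)[OF c x] by simp
  qed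
  finally show ?thesis
    using restrict[of c c'] restrict[of c' c] K(2) c unfolding im by simp
qed

lemma chart_integral_sum:
  assumes c: "c \<in> A" and K: "compact K" "K \<subseteq> fst c"
    and h: "\<And>i. i \<in> I \<Longrightarrow> chart_continuous (h i)" "\<And>i p. i \<in> I \<Longrightarrow> p \<notin> K \<Longrightarrow> h i p = 0"
    and "finite I"
  shows "chart_integral c (\<lambda>p. \<Sum>i\<in>I. h i p) = (\<Sum>i\<in>I. chart_integral c (h i))"
proof -
  have "(\<lambda>x. vol_density (g c x) * h i (chart_inv c x)) integrable_on chart_image c" if "i \<in> I" for i
    using integrand_absolutely_integrable[OF c h(1)[OF that] K h(2)[OF that], of "chart_image c"] K(2)
    by (auto simp: absolutely_integrable_on_def)
  then show ?thesis
    unfolding chart_integral_def sum_distrib_left by (intro integral_sum assms)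
qed

lemma chart_continuous_lie:
  assumes "C1_function h"
  shows "chart_continuous (lie h)"
  unfolding chart_continuous_def
proof
  fix c assume c: "c \<in> A"
  interpret c: nearly_parallel_chart "chart_image c" "g c" "\<Phi> c" "LC c" "D c" by (rule chart[OF c])
  let ?h = "\<lambda>x. h (chart_inv c x)"
  have h: "Ck_on (Suc 0) (chart_image c) ?h" using assms c by (simp add: C1_function_def del: Ck_on.simps)
  have cont: "continuous_on (chart_image c) (lee_sq c)" "continuous_on (chart_image c) (X c)"
    using c.smooth_on_lee_sq c.smooth_on_X unfolding smooth_on_def by (metis Ck_on.simps(1))+
  have "continuous_on (chart_image c) (\<lambda>x. \<Sum>b\<in>Basis. ((lee_sq c x *\<^sub>R X c x) \<bullet> b) *\<^sub>R fd ?h x b)"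
    using h by (intro continuous_intros cont) auto
  then show "continuous_on (chart_image c) (\<lambda>x. lie h (chart_inv c x))"
  proof (rule continuous_on_eq)
    fix x assume x: "x \<in> chart_image c"
    have "linear (fd ?h x)" using h x by (intro fd_linear) auto
    then show "(\<Sum>b\<in>Basis. ((lee_sq c x *\<^sub>R X c x) \<bullet> b) *\<^sub>R fd ?h x b) = lie h (chart_inv c x)"
      unfolding lie_chart[OF assms c x] by (rule linear_Basis_expansion[symmetric])
  qed
qed

lemma C1_function_continuous: "C1_function h \<Longrightarrow> chart_continuous h"
  unfolding C1_function_def chart_continuous_def using Ck_on_imp_continuous by blast

lemma chart_continuous_norm_sq: "chart_continuous norm_sq"
  unfolding chart_continuous_def
proof
  fix c assume c: "c \<in> A"
  interpret c: nearly_parallel_chart "chart_image c" "g c" "\<Phi> c" "LC c" "D c" by (rule chart[OF c])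
  have "continuous_on (chart_image c) (lee_sq c)"
    using c.smooth_on_lee_sq unfolding smooth_on_def by (metis Ck_on.simps(1))
  then show "continuous_on (chart_image c) (\<lambda>x. norm_sq (chart_inv c x))"
    by (rule continuous_on_eq) (simp add: norm_sq_chart[OF c])
qed

lemma chart_continuous_mult: "chart_continuous h \<Longrightarrow> chart_continuous k \<Longrightarrow> chart_continuous (\<lambda>p. h p * k p)"
  by (auto simp: chart_continuous_def intro: continuous_on_mult)

lemma lie_support:
  assumes "C1_function h" "compact K" "\<And>p. p \<notin> K \<Longrightarrow> h p = 0" "p \<notin> K"
  shows "lie h p = 0"
proof -
  let ?c = "chart_at p"
  have c: "?c \<in> A" "p \<in> fst ?c" by (rule chart_at)+
  let ?W = "snd ?c ` (fst ?c - K)"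
  have W: "open ?W" "snd ?c p \<in> ?W"
    using c assms(2,4) by (auto intro!: open_chart_image open_Diff chart_homeomorphism compact_imp_closed)
  have "((\<lambda>x. h (chart_inv ?c x)) has_derivative (\<lambda>u. 0)) (at (snd ?c p))"
    by (rule has_derivative_transform_within_open[OF has_derivative_const W])
      (use assms(3) chart_inv_simps(1)[OF c(1)] in auto)
  then show ?thesis by (simp add: lie_def Let_def fd_eq)
qed

text \<open>By \<open>divergence_formula\<close>, the integrand times the density is a coordinate
  divergence of a field with compact support, and each partial derivative integrates to 0.\<close>

lemma chart_integral_divergence:
  assumes c: "c \<in> A" and h: "C1_function h" and K: "compact K" "K \<subseteq> fst c" "\<And>p. p \<notin> K \<Longrightarrow> h p = 0"
  shows "chart_integral c (\<lambda>p. lie h p + 7 / 16 * (h p * (norm_sq p)\<^sup>2)) = 0"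
proof -
  interpret c: nearly_parallel_chart "chart_image c" "g c" "\<Phi> c" "LC c" "D c" by (rule chart[OF c])
  let ?S = "chart_image c" and ?K = "snd c ` K" and ?h = "\<lambda>x. h (chart_inv c x)"
  have K': "compact ?K" "?K \<subseteq> ?S" using compact_chart_image[OF c K(1,2)] K(2) by auto
  have h0: "?h x = 0" if "x \<in> ?S" "x \<notin> ?K" for x
    using that K(3) chart_inv_simps(2)[OF c] by (metis imageI)
  have hC: "Ck_on (Suc 0) ?S ?h" using h c by (simp add: C1_function_def del: Ck_on.simps)
  \<comment> \<open>Extension by zero to the whole space. It is continuously differentiable
    everywhere because the chart image and the complement of the compact \<open>?K\<close> are open
    and cover the space.\<close>
  define F where "F b x = (if x \<in> ?S then ?h x * vol_density (g c x) * (lee_sq c x * (X c x \<bullet> b)) else 0)" for b x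
  have F0: "F b x = 0" if "x \<notin> ?K" for b x using h0 that by (simp add: F_def)
  have openK: "open (- ?K)" using K'(1) compact_imp_closed by blast
  have FC: "Ck_on (Suc 0) UNIV (F b)" for b
  proof (rule Ck_on_local)
    fix x
    show "\<exists>V. open V \<and> x \<in> V \<and> Ck_on (Suc 0) V (F b)"
    proof (cases "x \<in> ?S")
      case True
      have sm: "Ck_on (Suc 0) ?S (lee_sq c)" "Ck_on (Suc 0) ?S (X c)"
        using c.smooth_on_lee_sq c.smooth_on_X unfolding smooth_on_def by blast+
      have "Ck_on (Suc 0) ?S (\<lambda>x. ?h x * vol_density (g c x) * (lee_sq c x * (X c x \<bullet> b)))"
        by (intro Ck_on_mult Ck_on_inner Ck_on_const c.open_S hC c.C1_vol_density sm)
      then have "Ck_on (Suc 0) ?S (F b)"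
        by (rule Ck_on_cong[OF c.open_S, rotated]) (simp add: F_def)
      then show ?thesis using True c.open_S by blast
    next
      case False
      have "Ck_on (Suc 0) (- ?K) (F b)"
        by (rule Ck_on_cong[OF openK, of "\<lambda>x. 0"]) (simp_all add: F0 Ck_on_const[OF openK] del: Ck_on.simps)
      then show ?thesis using False K'(2) openK by blast
    qed
  qed
  let ?H = "\<lambda>x. \<Sum>b\<in>Basis. fd (F b) x b"
  have int: "integrable lborel (\<lambda>x. fd (F b) x b)" "(\<integral>x. fd (F b) x b \<partial>lborel) = 0" for b
    by (rule integral_fd_compact_support[OF FC K'(1) F0]; assumption)+
  have intH: "integrable lborel ?H" "(\<integral>x. ?H x \<partial>lborel) = 0"
    using int by (auto simp: Bochner_Integration.integral_sum)
  have H: "?H x = (if x \<in> ?S then vol_density (g c x) *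
      (lie h (chart_inv c x) + 7 / 16 * (?h x * (norm_sq (chart_inv c x))\<^sup>2)) else 0)" for x
  proof (cases "x \<in> ?S")
    case True
    have hd: "?h differentiable (at x)"
      using Ck_on_has_derivative[OF hC True] differentiable_def by blast
    have "fd (F b) x = fd (\<lambda>x. ?h x * vol_density (g c x) * (lee_sq c x * (X c x \<bullet> b))) x" for b
    proof -
      have "((\<lambda>x. ?h x * vol_density (g c x) * (lee_sq c x * (X c x \<bullet> b))) has_derivative fd (F b) x) (at x)"
        by (rule has_derivative_transform_within_open[OF Ck_on_has_derivative[OF FC UNIV_I] c.open_S True])
          (simp add: F_def)
      then show ?thesis by (rule fd_eq[symmetric])
    qed
    then show ?thesis
      using True c.divergence_formula[OF True hd]
      by (simp add: lie_chart[OF h c True] norm_sq_chart[OF c True] algebra_simps)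
  next
    case False
    then have x: "x \<in> - ?K" using K'(2) by auto
    have "(F b has_derivative (\<lambda>u. 0)) (at x)" for b
      by (rule has_derivative_transform_within_open[OF has_derivative_const openK x]) (simp add: F0)
    note fd_eq[OF this]
    then show ?thesis using False by simp
  qed
  have "chart_integral c (\<lambda>p. lie h p + 7 / 16 * (h p * (norm_sq p)\<^sup>2)) = integral UNIV ?H"
    unfolding chart_integral_def H by (rule integral_restrict_UNIV[symmetric])
  then show ?thesis using integral_lborel[OF intH(1)] intH(2) by simp
qed

subsection \<open>A partition of unity\<close>

lemma C1_functionI:
  assumes "\<And>c x. c \<in> A \<Longrightarrow> x \<in> chart_image c \<Longrightarrow>
    \<exists>V. open V \<and> x \<in> V \<and> Ck_on (Suc 0) V (\<lambda>x. h (chart_inv c x))"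
  shows "C1_function h"
  unfolding C1_function_def by (intro ballI Ck_on_local assms)

text \<open>A bump in one chart, extended by zero. Only one continuous derivative is asked for, as
  the divergence theorem uses no more.\<close>

lemma bump_exists:
  "\<exists>c K b. c \<in> A \<and> compact K \<and> K \<subseteq> fst c \<and> C1_function b \<and> (\<forall>p. 0 \<le> b p) \<and>
    (\<forall>p. p \<notin> K \<longrightarrow> b p = 0) \<and> open {p. 0 < b p} \<and> 0 < b q"
proof -
  obtain c where c: "c \<in> A" "q \<in> fst c" using charts_cover by blast
  define a where "a = snd c q"
  obtain r where r: "r > 0" "cball a r \<subseteq> chart_image c"
    using chart_homeomorphism(2)[OF c(1)] c(2) open_contains_cball unfolding a_def by (metis imageI)
  define K where "K = chart_inv c ` cball a r"
  have K: "compact K" "K \<subseteq> fst c"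
    unfolding K_def using r chart_inv_simps(3)[OF c(1)]
    by (auto intro: compact_continuous_image continuous_on_subset[OF continuous_on_chart(2)[OF c(1)]])
  \<comment> \<open>The square of a positive part is continuously differentiable, with derivative
    \<open>2 * max 0 t\<close>; here it is positive exactly on the open ball of radius
    \<open>r\<close>.\<close>
  define \<beta> where "\<beta> y = (max 0 (r\<^sup>2 - (y - a) \<bullet> (y - a)))\<^sup>2" for y :: E
  define b where "b p = (if p \<in> fst c then \<beta> (snd c p) else 0)" for p
  have pos: "0 < \<beta> y \<longleftrightarrow> dist y a < r" for y
  proof -
    have "0 < \<beta> y \<longleftrightarrow> (norm (y - a))\<^sup>2 < r\<^sup>2" by (auto simp: \<beta>_def power2_norm_eq_inner max_def)
    also have "\<dots> \<longleftrightarrow> norm (y - a) < r" using r(1) by (metis abs_le_square_iff abs_norm_cancel abs_of_pos not_le)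
    finally show ?thesis by (simp add: dist_norm)
  qed
  have zero: "\<beta> y = 0" if "y \<notin> cball a r" for y
    using pos[of y] that by (simp add: dist_commute \<beta>_def)
  have C\<beta>: "Ck_on (Suc 0) UNIV \<beta>"
  proof (rule Ck_on_SucI[OF open_UNIV])
    have sq: "((\<lambda>t. (max 0 t)\<^sup>2) has_real_derivative 2 * max 0 t) (at t)" for t :: real
    proof -
      consider "t > 0" | "t < 0" | "t = 0" by linarith
      then show ?thesis
      proof cases
        case 1
        have "((\<lambda>t. t\<^sup>2) has_real_derivative 2 * max 0 t) (at t)" using 1 by (auto intro!: derivative_eq_intros)
        then show ?thesis
          by (rule has_field_derivative_transform_within_open[where S = "{0<..}"]) (use 1 in auto)
      next
        case 2
        have "((\<lambda>t. 0) has_real_derivative 2 * max 0 t) (at t)" using 2 by auto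
        then show ?thesis
          by (rule has_field_derivative_transform_within_open[where S = "{..<0}"]) (use 2 in auto)
      next
        case 3
        have "(\<lambda>h. (max 0 h)\<^sup>2 / h) \<midarrow>0\<rightarrow> (0::real)"
        proof (rule Lim_null_comparison)
          show "\<forall>\<^sub>F h in at 0. norm ((max 0 h)\<^sup>2 / h) \<le> \<bar>h\<bar>"
            by (rule always_eventually) (auto simp: max_def power2_eq_square)
          show "(\<lambda>h::real. \<bar>h\<bar>) \<midarrow>0\<rightarrow> 0" by (rule tendsto_rabs_zero) (rule tendsto_ident_at)
        qed
        then show ?thesis using 3 by (simp add: DERIV_def)
      qed
    qed
    show "(\<beta> has_derivative (\<lambda>h. 2 * max 0 (r\<^sup>2 - (y - a) \<bullet> (y - a)) * - (2 * ((y - a) \<bullet> h)))) (at y)" for y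
    proof -
      have "((\<lambda>y. r\<^sup>2 - (y - a) \<bullet> (y - a)) has_derivative (\<lambda>h. - (2 * ((y - a) \<bullet> h)))) (at y)"
        by (auto intro!: derivative_eq_intros simp: inner_commute)
      from has_derivative_compose[OF this sq[unfolded has_field_derivative_def]]
      show ?thesis unfolding \<beta>_def .
    qed
    show "Ck_on 0 UNIV (\<lambda>y. 2 * max 0 (r\<^sup>2 - (y - a) \<bullet> (y - a)) * - (2 * ((y - a) \<bullet> v)))" for v
      by (auto intro!: continuous_intros)
  qed
  have b0: "b p = 0" if "p \<notin> K" for p
  proof (cases "p \<in> fst c")
    case True
    then have "snd c p \<notin> cball a r" using that chart_inv_simps(1)[OF c(1) True] unfolding K_def by (metis imageI)
    then show ?thesis by (simp add: b_def zero)
  qed (simp add: b_def)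
  have "C1_function b"
  proof (rule C1_functionI)
    fix c' x assume c': "c' \<in> A" and x: "x \<in> chart_image c'"
    show "\<exists>V. open V \<and> x \<in> V \<and> Ck_on (Suc 0) V (\<lambda>x. b (chart_inv c' x))"
    proof (cases "chart_inv c' x \<in> fst c")
      case True
      let ?V = "transition_domain c' c"
      have V: "open ?V" by (rule open_transition_domain[OF c' c(1)])
      have "Ck_on (Suc 0) ?V (\<lambda>x. \<beta> (transition c' c x))"
        using smooth_transition[OF c' c(1)] by (intro C1_compose[OF V _ C\<beta>]) (auto simp: smooth_on_def simp del: Ck_on.simps)
      then have "Ck_on (Suc 0) ?V (\<lambda>x. b (chart_inv c' x))"
        by (rule Ck_on_cong[OF V, rotated]) (simp add: b_def transition_eq transition_domain_iff[OF c'])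
      then show ?thesis using V True x transition_domain_iff[OF c'] by blast
    next
      case False
      \<comment> \<open>Outside the domain of \<open>c\<close>, the extension is smooth because the
        compact \<open>K\<close> is closed in the Hausdorff space and \<open>b\<close> vanishes off
        it.\<close>
      let ?V = "snd c' ` (fst c' - K)"
      have V: "open ?V"
        using K(1) by (intro open_chart_image[OF c'] open_Diff chart_homeomorphism[OF c'] compact_imp_closed) auto
      have "chart_inv c' x \<in> fst c' - K" using chart_inv_simps(3)[OF c' x] False K(2) by auto
      then have xV: "x \<in> ?V" using chart_inv_simps(2)[OF c' x] by (metis imageI)
      have "Ck_on (Suc 0) ?V (\<lambda>x. b (chart_inv c' x))"
        by (rule Ck_on_cong[OF V _ Ck_on_const[OF V, of _ 0]]) (auto simp: chart_inv_simps(1)[OF c'] b0)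
      then show ?thesis using V xV by blast
    qed
  qed
  moreover have "open {p. 0 < b p}"
  proof -
    have "{p. 0 < b p} = fst c \<inter> snd c -` ball a r"
      by (auto simp: b_def pos dist_commute)
    then show ?thesis
      using continuous_open_preimage[OF continuous_on_chart(1) chart_homeomorphism(1)] c(1) by simp
  qed
  moreover have "0 < b q" using c(2) r(1) by (simp add: b_def pos a_def)
  moreover have "\<forall>p. 0 \<le> b p" by (simp add: b_def \<beta>_def)
  ultimately show ?thesis using c(1) K b0 by blast
qed

lemma C1_function_mult: "C1_function h \<Longrightarrow> C1_function k \<Longrightarrow> C1_function (\<lambda>p. h p * k p)"
  unfolding C1_function_def using Ck_on_mult chart_homeomorphism(2) by blast

lemma C1_function_sum:
  assumes "\<And>i. i \<in> I \<Longrightarrow> C1_function (h i)"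
  shows "C1_function (\<lambda>p. \<Sum>i\<in>I. h i p)"
  unfolding C1_function_def
  by (intro ballI Ck_on_sum chart_homeomorphism(2)) (use assms in \<open>auto simp: C1_function_def simp del: Ck_on.simps\<close>)

lemma C1_function_inverse:
  assumes "C1_function h" "\<And>p. h p \<noteq> 0"
  shows "C1_function (\<lambda>p. inverse (h p))"
  unfolding C1_function_def
  by (intro ballI Ck_on_inverse chart_homeomorphism(2)) (use assms in \<open>auto simp: C1_function_def simp del: Ck_on.simps\<close>)

text \<open>One bump around each point; finitely many have a positive sum by compactness, and
  dividing by this sum normalizes them. The points themselves serve as indices.\<close>

lemma partition_of_unity:
  obtains I :: "'m set" and c K \<rho> where "finite I"
    "\<And>i. i \<in> I \<Longrightarrow> c i \<in> A" "\<And>i. i \<in> I \<Longrightarrow> compact (K i)" "\<And>i. i \<in> I \<Longrightarrow> K i \<subseteq> fst (c i)"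
    "\<And>i. i \<in> I \<Longrightarrow> C1_function (\<rho> i)" "\<And>i p. i \<in> I \<Longrightarrow> 0 \<le> \<rho> i p"
    "\<And>i p. i \<in> I \<Longrightarrow> p \<notin> K i \<Longrightarrow> \<rho> i p = 0" "\<And>p. (\<Sum>i\<in>I. \<rho> i p) = 1"
proof -
  obtain c K b where *: "\<And>q. c q \<in> A" "\<And>q. compact (K q)" "\<And>q. K q \<subseteq> fst (c q)" "\<And>q. C1_function (b q)"
    "\<And>q p. 0 \<le> b q p" "\<And>q p. p \<notin> K q \<Longrightarrow> b q p = 0" "\<And>q. open {p. 0 < b q p}" "\<And>q. 0 < b q q"
    using bump_exists by metis
  obtain I where I: "finite I" "UNIV \<subseteq> (\<Union>q\<in>I. {p. 0 < b q p})"
  proof (rule compactE_image[OF compact])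
    show "UNIV \<subseteq> (\<Union>q\<in>UNIV. {p. 0 < b q p})" using *(8) by blast
  qed (use *(7) in auto)
  define s where "s p = (\<Sum>q\<in>I. b q p)" for p
  have s: "s p > 0" for p
  proof -
    obtain q where "q \<in> I" "0 < b q p" using I(2) by blast
    then show ?thesis unfolding s_def using I(1) *(5) by (intro sum_pos2[of I q]) auto
  qed
  have s0: "s p \<noteq> 0" for p using s[of p] by simp
  have sC: "C1_function (\<lambda>p. inverse (s p))"
    using s0 unfolding s_def by (intro C1_function_inverse C1_function_sum *(4)) auto
  show thesis
  proof (rule that[of I c K "\<lambda>q p. b q p * inverse (s p)"])
    show "C1_function (\<lambda>p. b q p * inverse (s p))" for q by (rule C1_function_mult[OF *(4) sC])
    show "(\<Sum>q\<in>I. b q p * inverse (s p)) = 1" for p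
      using s0[of p] unfolding sum_distrib_right[symmetric] s_def by simp
    show "0 \<le> b q p * inverse (s p)" for q p using *(5)[of q p] s[of p] by simp
  qed (use * I in auto)
qed

section \<open>Vanishing of the Lee form\<close>

text \<open>The density is positive, so the integrand is continuous and nonnegative; its integral
  over a box around the point is squeezed to 0.\<close>

lemma chart_integral_eq_0_imp:
  assumes c: "c \<in> A" and h: "chart_continuous h" "\<And>p. 0 \<le> h p"
    and K: "compact K" "K \<subseteq> fst c" "\<And>p. p \<notin> K \<Longrightarrow> h p = 0" and 0: "chart_integral c h = 0"
  shows "h p = 0"
proof (cases "p \<in> fst c")
  case True
  let ?S = "chart_image c" and ?F = "\<lambda>x. vol_density (g c x) * h (chart_inv c x)" and ?x = "snd c p"
  note vol = vol_density_chart_pos[OF c]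
  obtain l u where lu: "?x \<in> box l u" "cbox l u \<subseteq> ?S"
    using True chart_homeomorphism(2)[OF c] open_contains_cbox by (metis imageI)
  have cont: "continuous_on ?S ?F"
    using h c by (intro continuous_on_mult continuous_vol_density) (auto simp: chart_continuous_def)
  have nonneg: "0 \<le> ?F x" if "x \<in> ?S" for x using vol[OF that] h(2) by simp
  have int: "?F integrable_on ?S"
    using integrand_absolutely_integrable[OF c h(1) K, of ?S] K(2) by (auto simp: absolutely_integrable_on_def)
  have intb: "?F integrable_on cbox l u"
    by (rule integrable_continuous[OF continuous_on_subset[OF cont lu(2)]])
  have "integral (cbox l u) ?F \<le> integral ?S ?F"
    by (rule integral_subset_le[OF lu(2) intb int]) (use nonneg in auto)
  moreover have "0 \<le> integral (cbox l u) ?F"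
    by (rule integral_nonneg[OF intb]) (use nonneg lu(2) in auto)
  ultimately have "integral (cbox l u) ?F = 0" using 0 by (simp add: chart_integral_def)
  then have "(?F has_integral 0) (cbox l u)" using intb by (metis integrable_integral)
  then have "?F ?x = 0"
    using lu nonneg box_subset_cbox[of l u]
    by (intro has_integral_0_cbox_imp_0[OF continuous_on_subset[OF cont lu(2)]]) blast+
  then show ?thesis using vol[of ?x] True chart_inv_simps(1)[OF c True] by auto
qed (use K in auto)

lemma lie_sum:
  assumes "\<And>i. i \<in> I \<Longrightarrow> C1_function (h i)"
  shows "lie (\<lambda>p. \<Sum>i\<in>I. h i p) p = (\<Sum>i\<in>I. lie (h i) p)"
proof -
  let ?c = "chart_at p"
  have c: "?c \<in> A" "snd ?c p \<in> chart_image ?c" using chart_at by auto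
  have "((\<lambda>x. h i (chart_inv ?c x)) has_derivative fd (\<lambda>x. h i (chart_inv ?c x)) (snd ?c p)) (at (snd ?c p))"
    if "i \<in> I" for i
    using assms[OF that] c by (intro Ck_on_has_derivative[of 0 "chart_image ?c"]) (auto simp: C1_function_def simp del: Ck_on.simps)
  then have "((\<lambda>x. \<Sum>i\<in>I. h i (chart_inv ?c x)) has_derivative
      (\<lambda>v. \<Sum>i\<in>I. fd (\<lambda>x. h i (chart_inv ?c x)) (snd ?c p) v)) (at (snd ?c p))"
    by (intro has_derivative_sum)
  from fd_eq[OF this] show ?thesis by (simp add: lie_def Let_def)
qed

lemma norm_sq_eq_0: "norm_sq p = 0"
proof -
  obtain I :: "'m set" and c K \<rho> where I: "finite I"
    and c: "\<And>i. i \<in> I \<Longrightarrow> c i \<in> A" and K: "\<And>i. i \<in> I \<Longrightarrow> compact (K i)" "\<And>i. i \<in> I \<Longrightarrow> K i \<subseteq> fst (c i)"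
    and C1: "\<And>i. i \<in> I \<Longrightarrow> C1_function (\<rho> i)" and pos: "\<And>i p. i \<in> I \<Longrightarrow> 0 \<le> \<rho> i p"
    and supp: "\<And>i p. i \<in> I \<Longrightarrow> p \<notin> K i \<Longrightarrow> \<rho> i p = 0" and one: "\<And>p. (\<Sum>i\<in>I. \<rho> i p) = 1"
    by (rule partition_of_unity) blast
  let ?J = "\<lambda>i. chart_integral (c i)"
  let ?k = "\<lambda>i p. 7 / 16 * (\<rho> i p * (norm_sq p)\<^sup>2)"
  have supp': "lie (\<rho> i) p = 0" if "i \<in> I" "p \<notin> K i" for i p
    by (rule lie_support[OF C1 K(1) supp]) (use that in auto)
  have cc: "chart_continuous (lie (\<rho> i))" "chart_continuous (\<rho> i)" if "i \<in> I" for i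
    using C1[OF that] by (auto intro: chart_continuous_lie C1_function_continuous)
  have const: "chart_continuous (\<lambda>p. r)" for r by (simp add: chart_continuous_def)
  have kc: "chart_continuous (?k i)" if "i \<in> I" for i
    unfolding power2_eq_square
    by (intro chart_continuous_mult const cc(2)[OF that] chart_continuous_norm_sq)
  have lie0: "(\<Sum>i\<in>I. lie (\<rho> i) p) = 0" for p
  proof -
    have "lie (\<lambda>p. \<Sum>i\<in>I. \<rho> i p) p = 0" by (simp add: one lie_def Let_def frechet_derivative_const)
    then show ?thesis by (simp add: lie_sum C1)
  qed
  have split: "?J i (lie (\<rho> i)) + ?J i (?k i) = 0" if i: "i \<in> I" for i
  proof -
    \<comment> \<open>A sum of two terms, written as a sum over \<open>bool\<close> to fit
      \<open>chart_integral_sum\<close>.\<close>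
    have "?J i (\<lambda>p. \<Sum>b\<in>UNIV. if b then lie (\<rho> i) p else ?k i p) =
        (\<Sum>b\<in>UNIV. ?J i (\<lambda>p. if b then lie (\<rho> i) p else ?k i p))"
    proof (rule chart_integral_sum[OF c[OF i] K[OF i]])
      show "chart_continuous (\<lambda>p. if b then lie (\<rho> i) p else ?k i p)" for b
        using cc(1)[OF i] kc[OF i] by (cases b) auto
      show "p \<notin> K i \<Longrightarrow> (if b then lie (\<rho> i) p else ?k i p) = 0" for b p
        using supp'[OF i] supp[OF i] by simp
    qed auto
    then show ?thesis
      using chart_integral_divergence[OF c[OF i] C1[OF i] K[OF i] supp[OF i]] by (simp add: UNIV_bool add.commute)
  qed
  have prod0: "\<rho> j p * lie (\<rho> i) p = 0" if "i \<in> I" "j \<in> I" "p \<notin> K i \<inter> K j" for i j p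
    using that supp supp' by auto
  have pc: "chart_continuous (\<lambda>p. \<rho> j p * lie (\<rho> i) p)" if "i \<in> I" "j \<in> I" for i j
    using that by (intro chart_continuous_mult cc)
  \<comment> \<open>Inserting the factor 1, the sum of the \<open>\<rho> j\<close>, gives pieces
    supported in \<open>K i \<inter> K j\<close>, whose integral may be moved from chart
    \<open>i\<close> to chart \<open>j\<close>. There the sum over \<open>i\<close> can be taken
    under the integral, where it is the derivative of a constant.\<close>
  have "?J i (lie (\<rho> i)) = (\<Sum>j\<in>I. ?J i (\<lambda>p. \<rho> j p * lie (\<rho> i) p))" if i: "i \<in> I" for i
  proof -
    have "lie (\<rho> i) = (\<lambda>p. \<Sum>j\<in>I. \<rho> j p * lie (\<rho> i) p)"
      by (simp add: sum_distrib_right[symmetric] one)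
    then show ?thesis
      using chart_integral_sum[OF c[OF i] K[OF i], of I "\<lambda>j p. \<rho> j p * lie (\<rho> i) p"] pc[OF i] supp'[OF i] I by simp
  qed
  then have "(\<Sum>i\<in>I. ?J i (lie (\<rho> i))) = (\<Sum>i\<in>I. \<Sum>j\<in>I. ?J i (\<lambda>p. \<rho> j p * lie (\<rho> i) p))"
    by simp
  also have "\<dots> = (\<Sum>i\<in>I. \<Sum>j\<in>I. ?J j (\<lambda>p. \<rho> j p * lie (\<rho> i) p))"
  proof (intro sum.cong refl)
    fix i j assume ij: "i \<in> I" "j \<in> I"
    show "?J i (\<lambda>p. \<rho> j p * lie (\<rho> i) p) = ?J j (\<lambda>p. \<rho> j p * lie (\<rho> i) p)"
    proof (rule chart_integral_independent[where K = "K i \<inter> K j"])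
      show "compact (K i \<inter> K j)" using K(1) ij by (simp add: compact_Int)
    qed (use ij c K pc prod0 in auto)
  qed
  also have "\<dots> = (\<Sum>j\<in>I. \<Sum>i\<in>I. ?J j (\<lambda>p. \<rho> j p * lie (\<rho> i) p))" by (rule sum.swap)
  also have "\<dots> = (\<Sum>j\<in>I. ?J j (\<lambda>p. \<Sum>i\<in>I. \<rho> j p * lie (\<rho> i) p))"
  proof (intro sum.cong refl)
    fix j assume j: "j \<in> I"
    show "(\<Sum>i\<in>I. ?J j (\<lambda>p. \<rho> j p * lie (\<rho> i) p)) = ?J j (\<lambda>p. \<Sum>i\<in>I. \<rho> j p * lie (\<rho> i) p)"
      by (rule chart_integral_sum[OF c[OF j] K[OF j], symmetric]) (simp_all add: pc j supp[OF j] I)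
  qed
  also have "\<dots> = 0"
    by (simp add: sum_distrib_left[symmetric] lie0 chart_integral_def)
  finally have "(\<Sum>i\<in>I. ?J i (?k i)) = 0"
    using split by (simp add: add_eq_0_iff sum_negf)
  moreover have "0 \<le> ?J i (?k i)" if i: "i \<in> I" for i
  proof -
    let ?F = "\<lambda>x. vol_density (g (c i) x) * ?k i (chart_inv (c i) x)"
    have "?F absolutely_integrable_on chart_image (c i)"
      by (rule integrand_absolutely_integrable[OF c[OF i] kc[OF i] K[OF i]])
        (use supp[OF i] K(2)[OF i] in auto)
    then have "?F integrable_on chart_image (c i)" by (simp only: absolutely_integrable_on_def)
    moreover have "0 \<le> ?F x" if "x \<in> chart_image (c i)" for x
      using vol_density_chart_pos[OF c[OF i] that] pos[OF i] by simp
    ultimately show ?thesis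
      unfolding chart_integral_def by (rule Henstock_Kurzweil_Integration.integral_nonneg)
  qed
  ultimately have J0: "?J i (?k i) = 0" if "i \<in> I" for i
    using that I by (simp add: sum_nonneg_eq_0_iff)
  have "?k i p = 0" if i: "i \<in> I" for i
    by (rule chart_integral_eq_0_imp[OF c[OF i] kc[OF i] _ K[OF i] _ J0[OF i]])
      (use pos[OF i] supp[OF i] in auto)
  then have "(\<Sum>i\<in>I. \<rho> i p * (norm_sq p)\<^sup>2) = 0" by (intro sum.neutral) auto
  then show ?thesis by (simp add: sum_distrib_right[symmetric] one)
qed

lemma lee_form_vanishes: "lee_form_vanishes A g \<Phi>"
  unfolding lee_form_vanishes_def
proof (intro ballI ext)
  fix c x v assume c: "c \<in> A" and x: "x \<in> chart_image c"
  interpret c: nearly_parallel_chart "chart_image c" "g c" "\<Phi> c" "LC c" "D c" by (rule chart[OF c])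
  have "lee_sq c x = 0" using norm_sq_chart[OF c x] norm_sq_eq_0 by simp
  then have "X c x = 0" using c.lee_sq_pos[OF x] by force
  then show "lee_form (g c) (\<Phi> c) x v = 0"
    using c.g_X[OF x, of "v 0"] bilinear_lzero[OF c.bilinear_g[OF x]] c.lee_form_eq by simp
qed

end

theorem corollary3p4:
  shows "\<nexists>(A :: 'm::{t2_space, second_countable_topology} chart set) g \<Phi>.
    compact (UNIV :: 'm set) \<and>
    spin7_structure A g \<Phi> \<and>
    locally_conformal_parallel A g \<Phi> \<and> \<not> lee_form_vanishes A g \<Phi> \<and>
    second_order_nearly_parallel A g \<Phi>"
  using compact_nearly_parallel.lee_form_vanishes
  unfolding compact_nearly_parallel_def second_order_nearly_parallel_def by blast

end
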